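(* Let $X$ be a recursively presented Polish space. There is a recursive map $u^X_f:2\times\omega\times\omega^\omega\to\omega^\omega$ such that for each $(\xi,a,n,\gamma)\in(\omega_1\setminus\{0\})\times2\times\omega\times\omega^\omega$: (a) If $(\gamma)_i\in BC_1\cup BC_\xi$ for each $i\le n$, then $u^X_f(a,n,\gamma)\in BC_1\cup BC_\xi$. Moreover, the equalities $\rho^X[u^X_f(0,n,\gamma)]=\bigcap_{i\le n}\rho^X[(\gamma)_i]$ and $\rho^X[u^X_f(1,n,\gamma)]=\bigcup_{i\le n}\rho^X[(\gamma)_i]$ hold. (b) If moreover $\xi\ge2$ and $(\gamma)_i\in BC_\xi$ for some $i\le n$, then $u^X_f(a,n,\gamma)\in BC_\xi$.
   Context: $2=\{0,1\}$. For $\gamma\in\omega^\omega$ and $i\in\omega$, $(\gamma)_i\in\omega^\omega$ is defined by $(\gamma)_i(j):=\gamma(2^i(2j+1)-1)$. Effective notions (recursively presented Polish spaces, recursive functions) are those of Moschovakis' book "Descriptive Set Theory". Each recursively presented Polish space $X$ has its standard effective enumeration $(N(X,k))_{k\in\omega}$ of a neighbourhood basis (possibly with empty sets; $N(X,0)=\emptyset$). $X$ is of type at most $1$ if it is a finite product of spaces equal to $\omega$, $\omega^\omega$ or $2^\omega$. $B\in\Sigma^0_1(X)$ iff $B=\bigcup_{i}N(X,\varepsilon(i))$ for some recursive $\varepsilon:\omega\to\omega$. A map $f:X\to Y$ is recursive if $\{(x,k)\mid f(x)\in N(Y,k)\}\in\Sigma^0_1(X\times\omega)$. Fix a good parametrization: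 sets $G^X\in\Sigma^0_1(\omega^\omega\times X)$, one for each recursively presented Polish $X$, such that $P\subseteq X$ is open iff $P=G^X_\gamma$ for some $\gamma\in\omega^\omega$, $P$ is $\Sigma^0_1$ iff $P=G^X_\gamma$ for some recursive $\gamma$, and for $X$ of type at most 1 and any $Y$ there is a recursive $S^{X,Y}:\omega^\omega\times X\to\omega^\omega$ with $(\gamma,x,y)\in G^{X\times Y}\Leftrightarrow(S^{X,Y}(\gamma,x),y)\in G^Y$. For $\gamma\in\omega^\omega$, $\{\gamma\}^{X,Y}$ is the partial function from $X$ to $Y$ with $\{\gamma\}^{X,Y}(x)$ defined and equal to $y$ iff $y$ is the (unique) point with $\forall k\,[y\in N(Y,k)\Leftrightarrow(\gamma,x,k)\in G^{X\times\omega}]$; write $\{\gamma\}$ when $Y=\omega^\omega$. Borel codes: let $\gamma^*(i):=\gamma(i+1)$. $BC_1:=\{\gamma\in\omega^\omega\mid\gamma(0)=0\}$ and for $2\le\xi<\omega_1$, $BC_\xi:=\{\gamma\in\omega^\omega\mid\gamma(0)=1$ and $\forall i\in\omega$, $\{\gamma^*\}(i)$ is defined and in $\bigcup_{1\le\eta<\xi}BC_\eta\}$; $BC:=\bigcup_{1\le\xi<\omega_1}BC_\xi$. For $\gamma\in BC$, $\rho^X(\gamma):=\bigcup_iN(X,\gamma^*(i))$ if $\gamma\in BC_1$, and $\rho^X(\gamma):=\bigcup_iX\setminus\rho^X(\{\gamma^*\}(i))$ otherwise. *)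

theory Defs
  imports "HOL-Analysis.Analysis" "HOL-Computational_Algebra.Primes" "HOL-Library.Infinite_Set"
begin

text \<open>
  \<open>recfn n f\<close>: the \<open>n\<close>-ary function \<open>f\<close>, acting on lists of length \<open>n\<close>, is (total) recursive.
  Only the values of \<open>f\<close> on lists of length \<open>n\<close> matter (rule \<open>ext\<close>), and minimalization is only
  applied when it yields a total function.
\<close>

inductive recfn :: "nat \<Rightarrow> (nat list \<Rightarrow> nat) \<Rightarrow> bool" where
  const: "recfn n (\<lambda>_. c)"
| succ: "recfn 1 (\<lambda>xs. Suc (xs ! 0))"
| proj: "i < n \<Longrightarrow> recfn n (\<lambda>xs. xs ! i)"
| comp: "\<lbrakk>recfn (length hs) g; \<And>h. h \<in> set hs \<Longrightarrow> recfn n h\<rbrakk>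
    \<Longrightarrow> recfn n (\<lambda>xs. g (map (\<lambda>h. h xs) hs))"
| prec: "\<lbrakk>recfn n g; recfn (Suc (Suc n)) h\<rbrakk>
    \<Longrightarrow> recfn (Suc n) (\<lambda>xs. rec_nat (g (tl xs)) (\<lambda>k v. h (k # v # tl xs)) (hd xs))"
| mini: "\<lbrakk>recfn (Suc n) g; \<And>xs. length xs = n \<Longrightarrow> \<exists>k. g (k # xs) = 0\<rbrakk>
    \<Longrightarrow> recfn n (\<lambda>xs. LEAST k. g (k # xs) = 0)"
| ext: "\<lbrakk>recfn n g; \<And>xs. length xs = n \<Longrightarrow> f xs = g xs\<rbrakk> \<Longrightarrow> recfn n f"

definition recursive_seq :: "(nat \<Rightarrow> nat) \<Rightarrow> bool" where
  "recursive_seq \<epsilon> \<longleftrightarrow> recfn 1 (\<lambda>xs. \<epsilon> (xs ! 0))"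

definition recursive_rel4 :: "(nat \<Rightarrow> nat \<Rightarrow> nat \<Rightarrow> nat \<Rightarrow> bool) \<Rightarrow> bool" where
  "recursive_rel4 R \<longleftrightarrow> recfn 4 (\<lambda>xs. of_bool (R (xs ! 0) (xs ! 1) (xs ! 2) (xs ! 3)))"

text \<open>Moschovakis' coding of finite sequences,
  \<open>\<langle>x\<^sub>0,\<dots>,x\<^bsub>n-1\<^esub>\<rangle> = \<Prod>i<n. p\<^sub>i ^ (x\<^sub>i + 1)\<close> with \<open>p\<^sub>i\<close> the \<open>i\<close>-th prime, and the decoding \<open>(u)\<^sub>i\<close>,
  which is \<open>0\<close> when \<open>u\<close> is not a code or \<open>i\<close> is beyond the length.\<close>

definition seq_code :: "nat list \<Rightarrow> nat" where
  "seq_code xs = (\<Prod>i<length xs. enumerate {p::nat. prime p} i ^ (xs ! i + 1))"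

definition seq_nth :: "nat \<Rightarrow> nat \<Rightarrow> nat" where
  "seq_nth u i =
    (if \<exists>xs. u = seq_code xs \<and> i < length xs then (THE xs. u = seq_code xs) ! i else 0)"

text \<open>
  All spaces live in the universe \<open>'a pt\<close>, which contains \<open>\<omega>\<close> (\<open>NumP\<close>), \<open>\<omega>\<^sup>\<omega>\<close> (\<open>SeqP\<close>), an
  arbitrary type \<open>'a\<close> (\<open>ElemP\<close>) and is closed under pairs. This makes it possible to quantify over
  families indexed by all recursively presented Polish spaces; as \<open>'a\<close> is arbitrary, a space on
  any type is covered.
\<close>

datatype 'a pt =
    NumP (the_num: nat)
  | SeqP (the_seq: "nat \<Rightarrow> nat")
  | ElemP 'a
  | PairP (pt_fst: "'a pt") (pt_snd: "'a pt")

record 'p rspace =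
  pts :: "'p set"
  dst :: "'p \<Rightarrow> 'p \<Rightarrow> real"
  pres :: "nat \<Rightarrow> 'p"

definition rp_polish :: "'p rspace \<Rightarrow> bool" where
  "rp_polish X \<longleftrightarrow>
     Metric_space (pts X) (dst X) \<and>
     Metric_space.mcomplete (pts X) (dst X) \<and>
     range (pres X) \<subseteq> pts X \<and>
     Metric_space.mtopology (pts X) (dst X) closure_of range (pres X) = pts X \<and>
     recursive_rel4 (\<lambda>i j m k. dst X (pres X i) (pres X j) \<le> real m / (real k + 1)) \<and>
     recursive_rel4 (\<lambda>i j m k. dst X (pres X i) (pres X j) < real m / (real k + 1))"

text \<open>Radius-\<open>0\<close> balls are empty, so in particular \<open>nbhd X 0 = {}\<close>.\<close>

definition nbhd :: "'p rspace \<Rightarrow> nat \<Rightarrow> 'p set" where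
  "nbhd X s = Metric_space.mball (pts X) (dst X)
     (pres X (seq_nth s 0)) (real (seq_nth s 1) / (real (seq_nth s 2) + 1))"

definition omega :: "'a pt rspace" where
  "omega = \<lparr>pts = range NumP, dst = (\<lambda>x y. dist (the_num x) (the_num y)), pres = NumP\<rparr>"

definition two :: "'a pt rspace" where
  "two = \<lparr>pts = NumP ` {0, 1}, dst = (\<lambda>x y. dist (the_num x) (the_num y)),
          pres = (\<lambda>i. NumP (min i 1))\<rparr>"

definition baire_dist :: "(nat \<Rightarrow> nat) \<Rightarrow> (nat \<Rightarrow> nat) \<Rightarrow> real" where
  "baire_dist \<alpha> \<beta> = (if \<alpha> = \<beta> then 0 else 1 / (real (LEAST n. \<alpha> n \<noteq> \<beta> n) + 1))"

definition baire :: "'a pt rspace" where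
  "baire = \<lparr>pts = range SeqP, dst = (\<lambda>x y. baire_dist (the_seq x) (the_seq y)),
            pres = (\<lambda>i. SeqP (seq_nth i))\<rparr>"

definition cantor :: "'a pt rspace" where
  "cantor = \<lparr>pts = SeqP ` {\<alpha>. \<forall>n. \<alpha> n \<in> {0, 1}},
             dst = (\<lambda>x y. baire_dist (the_seq x) (the_seq y)),
             pres = (\<lambda>i. SeqP (\<lambda>n. min (seq_nth i n) 1))\<rparr>"

definition rprod :: "'a pt rspace \<Rightarrow> 'a pt rspace \<Rightarrow> 'a pt rspace" (infixr "\<otimes>\<^sub>r" 70) where
  "X \<otimes>\<^sub>r Y = \<lparr>pts = {PairP x y |x y. x \<in> pts X \<and> y \<in> pts Y},
     dst = (\<lambda>p q. max (dst X (pt_fst p) (pt_fst q)) (dst Y (pt_snd p) (pt_snd q))),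
     pres = (\<lambda>i. PairP (pres X (seq_nth i 0)) (pres Y (seq_nth i 1)))\<rparr>"

inductive type_le1 :: "'a pt rspace \<Rightarrow> bool" where
  "type_le1 omega"
| "type_le1 baire"
| "type_le1 cantor"
| "\<lbrakk>type_le1 X; type_le1 Y\<rbrakk> \<Longrightarrow> type_le1 (X \<otimes>\<^sub>r Y)"

definition Sigma01 :: "'p rspace \<Rightarrow> 'p set \<Rightarrow> bool" where
  "Sigma01 X B \<longleftrightarrow> (\<exists>\<epsilon>. recursive_seq \<epsilon> \<and> B = (\<Union>i. nbhd X (\<epsilon> i)))"

definition recursive_map :: "'a pt rspace \<Rightarrow> 'a pt rspace \<Rightarrow> ('a pt \<Rightarrow> 'a pt) \<Rightarrow> bool" where
  "recursive_map X Y f \<longleftrightarrow> f ` pts X \<subseteq> pts Y \<and>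
     Sigma01 (X \<otimes>\<^sub>r omega) {PairP x (NumP k) |x k. x \<in> pts X \<and> f x \<in> nbhd Y k}"

definition section_of :: "'a pt set \<Rightarrow> (nat \<Rightarrow> nat) \<Rightarrow> 'a pt set" where
  "section_of A \<gamma> = {x. PairP (SeqP \<gamma>) x \<in> A}"

definition good_parametrization :: "('a pt rspace \<Rightarrow> 'a pt set) \<Rightarrow> bool" where
  "good_parametrization G \<longleftrightarrow>
     (\<forall>X. rp_polish X \<longrightarrow>
        Sigma01 (baire \<otimes>\<^sub>r X) (G X) \<and>
        (\<forall>P \<subseteq> pts X.
           (openin (Metric_space.mtopology (pts X) (dst X)) P
              \<longleftrightarrow> (\<exists>\<gamma>. P = section_of (G X) \<gamma>)) \<and>
           (Sigma01 X P \<longleftrightarrow> (\<exists>\<gamma>. recursive_seq \<gamma> \<and> P = section_of (G X) \<gamma>)))) \<and>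
     (\<forall>X Y. type_le1 X \<and> rp_polish Y \<longrightarrow>
        (\<exists>S. recursive_map (baire \<otimes>\<^sub>r X) baire S \<and>
           (\<forall>\<gamma>. \<forall>x \<in> pts X. \<forall>y \<in> pts Y.
              PairP (SeqP \<gamma>) (PairP x y) \<in> G (X \<otimes>\<^sub>r Y)
                \<longleftrightarrow> PairP (S (PairP (SeqP \<gamma>) x)) y \<in> G Y)))"

text \<open>\<open>{\<gamma>}\<close> as a partial function from \<open>X\<close> to \<open>Y\<close>; \<open>None\<close> means undefined.\<close>

definition papp :: "('a pt rspace \<Rightarrow> 'a pt set) \<Rightarrow> 'a pt rspace \<Rightarrow> 'a pt rspace
    \<Rightarrow> (nat \<Rightarrow> nat) \<Rightarrow> 'a pt \<Rightarrow> 'a pt option" where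
  "papp G X Y \<gamma> x =
     (let is_val = (\<lambda>y. y \<in> pts Y \<and>
            (\<forall>k. y \<in> nbhd Y k \<longleftrightarrow> PairP (SeqP \<gamma>) (PairP x (NumP k)) \<in> G (X \<otimes>\<^sub>r omega)))
      in if \<exists>!y. is_val y then Some (THE y. is_val y) else None)"

text \<open>\<open>{\<gamma>}(i)\<close> for \<open>{\<gamma>}\<close> from \<open>\<omega>\<close> to \<open>\<omega>\<^sup>\<omega>\<close>; all points of \<open>baire\<close> have the form \<open>SeqP \<delta>\<close>.\<close>

definition kapp :: "('a pt rspace \<Rightarrow> 'a pt set) \<Rightarrow> (nat \<Rightarrow> nat) \<Rightarrow> nat \<Rightarrow> (nat \<Rightarrow> nat) option" where
  "kapp G \<gamma> i = map_option the_seq (papp G omega baire \<gamma> (NumP i))"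

text \<open>\<open>\<omega>\<^sub>1\<close>: the initial well-order \<open>cardSuc natLeq\<close> of least uncountable cardinality.\<close>

typedef omega1 = "Field (cardSuc natLeq) :: nat set set"
  morphisms rep_omega1 abs_omega1
proof -
  have "Field (cardSuc natLeq) \<noteq> {}"
    using cardSuc_greater[OF natLeq_Card_order] cardSuc_Card_order[OF natLeq_Card_order]
    by (metis card_order_on_def infinite_imp_nonempty Cinfinite_cardSuc natLeq_Cinfinite cinfinite_def)
  then show "\<exists>x. x \<in> Field (cardSuc natLeq)" by blast
qed

instantiation omega1 :: linorder
begin

definition less_eq_omega1 :: "omega1 \<Rightarrow> omega1 \<Rightarrow> bool" where
  "\<xi> \<le> \<eta> \<longleftrightarrow> (rep_omega1 \<xi>, rep_omega1 \<eta>) \<in> cardSuc natLeq"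

definition less_omega1 :: "omega1 \<Rightarrow> omega1 \<Rightarrow> bool" where
  "(\<xi> :: omega1) < \<eta> \<longleftrightarrow> \<xi> \<le> \<eta> \<and> \<xi> \<noteq> \<eta>"

instance
proof
  have wo: "well_order_on (Field (cardSuc natLeq)) (cardSuc natLeq)"
    using cardSuc_Card_order[OF natLeq_Card_order] by (auto simp: card_order_on_def)
  then have lin: "refl_on (Field (cardSuc natLeq)) (cardSuc natLeq)" "trans (cardSuc natLeq)"
    "antisym (cardSuc natLeq)" "total_on (Field (cardSuc natLeq)) (cardSuc natLeq)"
    by (auto simp: order_on_defs)
  fix x y z :: omega1
  have anti: "x \<le> y \<Longrightarrow> y \<le> x \<Longrightarrow> x = y" for x y :: omega1
    using lin(3) unfolding less_eq_omega1_def by (meson antisymD rep_omega1_inject)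
  show "(x < y) = (x \<le> y \<and> \<not> y \<le> x)"
    unfolding less_omega1_def
    using anti refl_onD[OF lin(1)] rep_omega1 less_eq_omega1_def by metis
  show "x \<le> y \<Longrightarrow> y \<le> x \<Longrightarrow> x = y" by (rule anti)
  show "x \<le> x"
    unfolding less_eq_omega1_def using refl_onD[OF lin(1)] rep_omega1 by blast
  show "x \<le> y \<Longrightarrow> y \<le> z \<Longrightarrow> x \<le> z"
    using lin(2) unfolding less_eq_omega1_def by (meson transD)
  show "x \<le> y \<or> y \<le> x"
    unfolding less_eq_omega1_def
    using lin(4) refl_onD[OF lin(1)] rep_omega1 unfolding total_on_def by metis
qed

end

instance omega1 :: wellorder
proof
  fix P :: "omega1 \<Rightarrow> bool" and a
  assume step: "\<And>x. (\<And>y. y < x \<Longrightarrow> P y) \<Longrightarrow> P x"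
  have "wf (cardSuc natLeq - Id)"
    using cardSuc_Card_order[OF natLeq_Card_order]
    by (auto simp: card_order_on_def well_order_on_def)
  then have "wf (inv_image (cardSuc natLeq - Id) rep_omega1)"
    by (rule wf_inv_image)
  then show "P a"
  proof (induction a rule: wf_induct_rule)
    case (less x)
    then show ?case
      using step[of x] by (auto simp: less_omega1_def less_eq_omega1_def rep_omega1_inject)
  qed
qed

text \<open>The ordinals \<open>0\<close> and \<open>1\<close>; thus \<open>1 < \<xi>\<close> expresses \<open>\<xi> \<ge> 2\<close>.\<close>

instantiation omega1 :: "{zero, one}"
begin

definition zero_omega1 :: omega1 where
  "(0 :: omega1) = (LEAST \<xi>. True)"

definition one_omega1 :: omega1 where
  "(1 :: omega1) = (LEAST \<xi>. 0 < \<xi>)"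

instance ..

end

definition component :: "(nat \<Rightarrow> nat) \<Rightarrow> nat \<Rightarrow> (nat \<Rightarrow> nat)" where
  "component \<gamma> i = (\<lambda>j. \<gamma> (2 ^ i * (2 * j + 1) - 1))"

definition shift :: "(nat \<Rightarrow> nat) \<Rightarrow> (nat \<Rightarrow> nat)" where
  "shift \<gamma> = (\<lambda>i. \<gamma> (i + 1))"

function BC :: "('a pt rspace \<Rightarrow> 'a pt set) \<Rightarrow> omega1 \<Rightarrow> (nat \<Rightarrow> nat) set" where
  "BC G \<xi> =
     (if \<xi> = 1 then {\<gamma>. \<gamma> 0 = 0}
      else if 1 < \<xi> then
        {\<gamma>. \<gamma> 0 = 1 \<and> (\<forall>i. \<exists>\<delta>. kapp G (shift \<gamma>) i = Some \<delta> \<and> \<delta> \<in> (\<Union>\<eta> \<in> {1..<\<xi>}. BC G \<eta>))}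
      else {})"
  by pat_completeness auto
termination
  by (relation "inv_image {(\<eta>, \<xi>). \<eta> < \<xi>} snd") (auto intro: wf)

declare BC.simps [simp del]

definition BC_all :: "('a pt rspace \<Rightarrow> 'a pt set) \<Rightarrow> (nat \<Rightarrow> nat) set" where
  "BC_all G = (\<Union>\<xi> \<in> {1..}. BC G \<xi>)"

text \<open>The value of \<open>rho\<close> outside \<open>BC_all\<close> is irrelevant.\<close>

function rho :: "('a pt rspace \<Rightarrow> 'a pt set) \<Rightarrow> 'a pt rspace \<Rightarrow> (nat \<Rightarrow> nat) \<Rightarrow> 'a pt set" where
  "rho G X \<gamma> =
     (if \<gamma> \<in> BC_all G then
        if \<gamma> \<in> BC G 1 then (\<Union>i. nbhd X (shift \<gamma> i))
        else (\<Union>i. pts X - rho G X (the (kapp G (shift \<gamma>) i)))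
      else {})"
  by pat_completeness auto
termination
proof (relation "inv_image {(\<eta>, \<xi>). \<eta> < \<xi>} (\<lambda>(G, X, \<gamma>). LEAST \<xi>. \<gamma> \<in> BC G \<xi>)", goal_cases)
  case 1
  show ?case by (auto intro: wf)
next
  case (2 G X \<gamma> i)
  define \<xi> where "\<xi> = (LEAST \<xi>. \<gamma> \<in> BC G \<xi>)"
  from 2 have "\<exists>\<xi>. \<gamma> \<in> BC G \<xi>" by (auto simp: BC_all_def)
  then have "\<gamma> \<in> BC G \<xi>" unfolding \<xi>_def by (rule LeastI_ex)
  moreover from this 2 have "\<xi> \<noteq> 1" by auto
  ultimately obtain \<eta> where "\<eta> < \<xi>" "the (kapp G (shift \<gamma>) i) \<in> BC G \<eta>"
    using that by (force simp: BC.simps[of G \<xi>] split: if_splits dest: spec[of _ i])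
  then have "(LEAST \<xi>. the (kapp G (shift \<gamma>) i) \<in> BC G \<xi>) < \<xi>"
    using Least_le[of "\<lambda>\<xi>. the (kapp G (shift \<gamma>) i) \<in> BC G \<xi>" \<eta>] by simp
  then show ?case by (simp add: \<xi>_def)
qed

declare rho.simps [simp del]

end

theory Submission
  imports Defs
begin

text \<open>
  No recursion theorem is needed. If all \<open>(\<gamma>)\<^sub>i\<close> are in \<open>BC\<^sub>1\<close>, then codes of the union and of the
  intersection are enumerated directly; for the intersection one lists the basic neighbourhoods
  strictly inside a chosen neighbourhood of each factor. Otherwise every \<open>\<rho>((\<gamma>)\<^sub>i)\<close> is the union over
  \<open>t\<close> of the sets \<open>X \<setminus> \<rho>(\<delta>(i,t))\<close>, with \<open>\<delta>(i,t) = {(\<gamma>)\<^sub>i*}(t)\<close> if \<open>(\<gamma>)\<^sub>i\<close> is not in \<open>BC\<^sub>1\<close>, while an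
  open set is written as a union of closed balls, whose complements have codes in \<open>BC\<^sub>1\<close>. The union
  is then the union of all these pieces, and the intersection is the union, over all finite
  sequences \<open>t\<close>, of the complements of \<open>\<Union>i\<le>n. \<rho>(\<delta>(i,t(i)))\<close>, which are coded by the map for unions
  already constructed. The codes themselves come from the \<open>S\<close>-\<open>m\<close>-\<open>n\<close> property. Effectivity
  is handled through functionals \<open>(\<nat> \<Rightarrow> \<nat>) \<Rightarrow> \<nat>\<close> that are recursive in their argument: closure
  properties are immediate for them, and each can be computed from finite parts of its argument,
  which turns semirecursive relations into \<open>\<Sigma>\<^sup>0\<^sub>1\<close> sets.
\<close>

section \<open>Functionals recursive in an oracle\<close>

text \<open>Two obstacles shape the construction. The map may not depend on \<xi>, and it must be
  total although \<open>{\<gamma>*}(t)\<close> can be undefined when \<gamma> is not a Borel code.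
  For the first, only the heads of the first n + 1 components are read: whether all are 0 is
  decidable and selects the construction. For the second, no value \<delta>(i,t) is computed. It
  suffices that the relation "the value lies in the k-th neighbourhood" is semirecursive: the S-m-n
  property then gives an index for every \<gamma>, which has the intended value wherever there is
  one. The intersection applies the union map to a sequence made of such values, hence known only
  through a semirecursive graph; for this the functional is run on finite parts of its argument.
  Levels are preserved because the family is finite: for one t the finitely many \<delta>(i,t(i))
  have levels below \<xi>, hence so has their maximum, which bounds the level of their union. Closed
  balls enter because the definition of \<rho> forces an open set to be written with complements of
  coded sets, and the complement of a closed ball is open with an enumeration that can be
  computed.\<close>

named_theorems orec_intro

text \<open>The argument serves both as oracle and as environment: a number argument \<open>k\<close> is pushed in front
  of the oracle by \<open>case_nat k\<close>, and \<open>shift\<close> removes it again.\<close>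

inductive orec :: "((nat \<Rightarrow> nat) \<Rightarrow> nat) \<Rightarrow> bool" where
  orec_const: "orec (\<lambda>\<alpha>. c)"
| orec_Suc: "orec f \<Longrightarrow> orec (\<lambda>\<alpha>. Suc (f \<alpha>))"
| orec_app: "orec f \<Longrightarrow> orec (\<lambda>\<alpha>. \<alpha> (f \<alpha>))"
| orec_comp: "\<lbrakk>orec f; orec h\<rbrakk> \<Longrightarrow> orec (\<lambda>\<alpha>. f (\<lambda>x. h (case_nat x \<alpha>)))"
| orec_prec: "\<lbrakk>orec g; orec f; orec h\<rbrakk>
    \<Longrightarrow> orec (\<lambda>\<alpha>. rec_nat (g \<alpha>) (\<lambda>k v. h (case_nat k (case_nat v \<alpha>))) (f \<alpha>))"
| orec_mini: "\<lbrakk>orec g; \<And>\<alpha>. \<exists>k. g (case_nat k \<alpha>) = 0\<rbrakk>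
    \<Longrightarrow> orec (\<lambda>\<alpha>. LEAST k. g (case_nat k \<alpha>) = 0)"

lemmas [orec_intro] = orec_const orec_Suc orec_app

abbreviation odec :: "((nat \<Rightarrow> nat) \<Rightarrow> bool) \<Rightarrow> bool" where
  "odec P \<equiv> orec (\<lambda>\<alpha>. of_bool (P \<alpha>))"

lemma shift_apply: "shift \<alpha> i = \<alpha> (Suc i)"
  by (simp add: shift_def)

lemma shift_case_nat [simp]: "shift (case_nat k \<alpha>) = \<alpha>"
  by (simp add: shift_def fun_eq_iff)

lemma orec_shift: "orec f \<Longrightarrow> orec (\<lambda>\<alpha>. f (shift \<alpha>))"
proof -
  assume f: "orec f"
  \<comment> \<open>On \<open>case_nat x \<alpha>\<close> this functional reads \<alpha> at
    \<open>Suc x\<close>.\<close>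
  have "orec (\<lambda>\<beta>. \<beta> (Suc (Suc (\<beta> 0))))"
    by (intro orec_intro)
  from orec_comp[OF f this] show ?thesis
    by (simp add: shift_def)
qed

lemma orec_shifts:
  assumes "orec f"
  shows "orec (\<lambda>\<alpha>. f (shift \<alpha>))" "orec (\<lambda>\<alpha>. f (shift (shift \<alpha>)))"
    "orec (\<lambda>\<alpha>. f (shift (shift (shift \<alpha>))))" "orec (\<lambda>\<alpha>. f (shift (shift (shift (shift \<alpha>)))))"
  by (intro orec_shift assms)+

text \<open>A bound variable becomes \<open>\<alpha> 0\<close> and the outer environment
  \<open>shift \<alpha>\<close>. The rules for binders share this shape, so that
  \<open>intro\<close> can traverse nested bindings.\<close>

lemma orec_subst:
  assumes "orec f" "orec (\<lambda>\<alpha>. h (\<alpha> 0) (shift \<alpha>))"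
  shows "orec (\<lambda>\<alpha>. f (\<lambda>x. h x \<alpha>))"
  using orec_comp[OF assms] by simp

lemma orec_rec:
  assumes "orec g" "orec f" "orec (\<lambda>\<alpha>. h (\<alpha> 0) (\<alpha> 1) (shift (shift \<alpha>)))"
  shows "orec (\<lambda>\<alpha>. rec_nat (g \<alpha>) (\<lambda>k v. h k v \<alpha>) (f \<alpha>))"
  using orec_prec[OF assms] by simp

text \<open>Under nested bindings the outer environment is reached through iterated shifts.\<close>

lemma orec_shift_app [orec_intro]:
  "orec f \<Longrightarrow> orec (\<lambda>\<alpha>. shift \<alpha> (f \<alpha>))"
  "orec f \<Longrightarrow> orec (\<lambda>\<alpha>. shift (shift \<alpha>) (f \<alpha>))"
  "orec f \<Longrightarrow> orec (\<lambda>\<alpha>. shift (shift (shift \<alpha>)) (f \<alpha>))"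
  "orec f \<Longrightarrow> orec (\<lambda>\<alpha>. shift (shift (shift (shift \<alpha>))) (f \<alpha>))"
  "orec f \<Longrightarrow> orec (\<lambda>\<alpha>. shift (shift (shift (shift (shift \<alpha>)))) (f \<alpha>))"
  "orec f \<Longrightarrow> orec (\<lambda>\<alpha>. shift (shift (shift (shift (shift (shift \<alpha>))))) (f \<alpha>))"
  by (simp_all add: shift_apply orec_intro)

lemma orec_case_nat [orec_intro]:
  assumes "orec g" "orec f" "orec (\<lambda>\<alpha>. h (\<alpha> 0) (shift \<alpha>))"
  shows "orec (\<lambda>\<alpha>. case_nat (g \<alpha>) (\<lambda>k. h k \<alpha>) (f \<alpha>))"
proof -
  have "orec (\<lambda>\<alpha>. h (\<alpha> 0) (shift (shift \<alpha>)))"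
  proof -
    \<comment> \<open>Turns the environment (k, v, \<alpha>) into (k, \<alpha>). Entry 1 is the
      recursive value pushed by \<open>orec_rec\<close>; a case distinction is a recursion that
      ignores it.\<close>
    have "orec (\<lambda>\<beta>. rec_nat (\<beta> 1) (\<lambda>k v. \<beta> (Suc (Suc (Suc k)))) (\<beta> 0))"
      by (rule orec_rec) (intro orec_intro)+
    from orec_comp[OF assms(3) this]
    show ?thesis
      by (simp add: shift_def)
  qed
  then have "orec (\<lambda>\<alpha>. rec_nat (g \<alpha>) (\<lambda>k v. h k \<alpha>) (f \<alpha>))"
    using assms by (intro orec_rec) 
  moreover have "rec_nat (g \<alpha>) (\<lambda>k v. h k \<alpha>) (f \<alpha>) = case_nat (g \<alpha>) (\<lambda>k. h k \<alpha>) (f \<alpha>)" for \<alpha>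
    by (cases "f \<alpha>") auto
  ultimately show ?thesis by simp
qed

lemma orec_num:
  assumes "orec (\<lambda>\<alpha>. f (\<alpha> 0) (shift \<alpha>))" "orec g"
  shows "orec (\<lambda>\<alpha>. f (g \<alpha>) \<alpha>)"
proof -
  have "orec (\<lambda>\<alpha>. f (case_nat (g \<alpha>) (\<lambda>k. \<alpha> k) 0) (shift (\<lambda>x. case_nat (g \<alpha>) (\<lambda>k. \<alpha> k) x)))"
    by (rule orec_subst[OF assms(1)]) (intro orec_intro orec_shifts[OF assms(2)] assms)
  then show ?thesis
    by simp
qed

lemma orec_num2:
  assumes "orec (\<lambda>\<alpha>. f (\<alpha> 0) (\<alpha> 1))" "orec g" "orec h"
  shows "orec (\<lambda>\<alpha>. f (g \<alpha>) (h \<alpha>))"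
proof -
  have "orec (\<lambda>\<alpha>. f (case_nat (g \<alpha>) (\<lambda>k. h \<alpha>) 0) (case_nat (g \<alpha>) (\<lambda>k. h \<alpha>) 1))"
    by (rule orec_subst[OF assms(1)]) (intro orec_intro orec_shifts[OF assms(2)] orec_shifts[OF assms(3)] assms)
  then show ?thesis
    by simp
qed

lemma orec_num1:
  assumes "orec (\<lambda>\<alpha>. f (\<alpha> 0))" "orec g"
  shows "orec (\<lambda>\<alpha>. f (g \<alpha>))"
  using orec_num[of "\<lambda>k \<alpha>. f k"] assms by simp

lemma orec_num3:
  assumes "orec (\<lambda>\<alpha>. f (\<alpha> 0) (\<alpha> 1) (\<alpha> 2))" "orec g" "orec h" "orec k"
  shows "orec (\<lambda>\<alpha>. f (g \<alpha>) (h \<alpha>) (k \<alpha>))"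
proof -
  have "orec (\<lambda>\<alpha>. (\<lambda>\<beta>. f (\<beta> 0) (\<beta> 1) (\<beta> 2)) (\<lambda>x. case_nat (g \<alpha>) (\<lambda>i. case_nat (h \<alpha>) (\<lambda>_. k \<alpha>) i) x))"
    by (rule orec_subst[OF assms(1)]) (intro orec_intro orec_shifts[OF assms(2)] orec_shifts[OF assms(3)] orec_shifts[OF assms(4)] assms)
  then show ?thesis
    by (simp add: eval_nat_numeral)
qed

lemma orec_num4:
  assumes "orec (\<lambda>\<alpha>. f (\<alpha> 0) (\<alpha> 1) (\<alpha> 2) (\<alpha> 3))" "orec g" "orec h" "orec k" "orec l"
  shows "orec (\<lambda>\<alpha>. f (g \<alpha>) (h \<alpha>) (k \<alpha>) (l \<alpha>))"
proof -
  have "orec (\<lambda>\<alpha>. (\<lambda>\<beta>. f (\<beta> 0) (\<beta> 1) (\<beta> 2) (\<beta> 3)) (\<lambda>x. case_nat (g \<alpha>)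
      (\<lambda>i. case_nat (h \<alpha>) (\<lambda>i. case_nat (k \<alpha>) (\<lambda>_. l \<alpha>) i) i) x))"
    by (rule orec_subst[OF assms(1)]) (intro orec_intro orec_shifts[OF assms(2)] orec_shifts[OF assms(3)] orec_shifts[OF assms(4)] orec_shifts[OF assms(5)] assms)
  then show ?thesis
    by (simp add: eval_nat_numeral)
qed

section \<open>Arithmetic, decidable predicates and bounded quantifiers\<close>

lemma orec_add [orec_intro]: "orec f \<Longrightarrow> orec g \<Longrightarrow> orec (\<lambda>\<alpha>. f \<alpha> + g \<alpha>)"
proof -
  assume a: "orec f" "orec g"
  have "orec (\<lambda>\<alpha>. rec_nat (f \<alpha>) (\<lambda>k v. Suc v) (g \<alpha>))"
    by (rule orec_rec) (intro orec_intro a)+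
  moreover have "rec_nat x (\<lambda>k v. Suc v) y = x + y" for x y by (induction y) auto
  ultimately show ?thesis by simp
qed

lemma orec_mult [orec_intro]: "orec f \<Longrightarrow> orec g \<Longrightarrow> orec (\<lambda>\<alpha>. f \<alpha> * g \<alpha>)"
proof -
  assume a: "orec f" "orec g"
  have "orec (\<lambda>\<alpha>. rec_nat 0 (\<lambda>k v. v + f \<alpha>) (g \<alpha>))"
    by (rule orec_rec) (intro orec_intro orec_shifts[OF a(1)] orec_shifts[OF a(2)] a)+
  moreover have "rec_nat 0 (\<lambda>k v. v + x) y = x * y" for x y :: nat by (induction y) auto
  ultimately show ?thesis by simp
qed

lemma orec_power [orec_intro]: "orec f \<Longrightarrow> orec g \<Longrightarrow> orec (\<lambda>\<alpha>. f \<alpha> ^ g \<alpha>)"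
proof -
  assume a: "orec f" "orec g"
  have "orec (\<lambda>\<alpha>. rec_nat 1 (\<lambda>k v. v * f \<alpha>) (g \<alpha>))"
    by (rule orec_rec) (intro orec_intro orec_shifts[OF a(1)] orec_shifts[OF a(2)] a)+
  moreover have "rec_nat 1 (\<lambda>k v. v * x) y = x ^ y" for x y :: nat by (induction y) auto
  ultimately show ?thesis by simp
qed

lemma orec_diff [orec_intro]: "orec f \<Longrightarrow> orec g \<Longrightarrow> orec (\<lambda>\<alpha>. f \<alpha> - g \<alpha>)"
proof -
  assume a: "orec f" "orec g"
  have "orec (\<lambda>\<alpha>. rec_nat (f \<alpha>) (\<lambda>k v. case_nat 0 (\<lambda>i. i) v) (g \<alpha>))"
    by (rule orec_rec) (intro orec_intro a)+
  moreover have "rec_nat x (\<lambda>k v. case_nat 0 (\<lambda>i. i) v) y = x - y" for x y :: nat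
    by (induction y) (auto split: nat.split)
  ultimately show ?thesis by simp
qed

lemma odec_zero: "orec f \<Longrightarrow> odec (\<lambda>\<alpha>. f \<alpha> = 0)"
proof -
  assume a: "orec f"
  have "orec (\<lambda>\<alpha>. 1 - f \<alpha>)" by (intro orec_intro a)
  moreover have "of_bool (x = 0) = 1 - x" for x :: nat by (cases x) auto
  ultimately show ?thesis by simp
qed

lemma odec_not [orec_intro]: "odec P \<Longrightarrow> odec (\<lambda>\<alpha>. \<not> P \<alpha>)"
  using odec_zero[of "\<lambda>\<alpha>. of_bool (P \<alpha>)"] by simp

lemma odec_conj [orec_intro]: "odec P \<Longrightarrow> odec Q \<Longrightarrow> odec (\<lambda>\<alpha>. P \<alpha> \<and> Q \<alpha>)"
  using orec_mult[of "\<lambda>\<alpha>. of_bool (P \<alpha>)" "\<lambda>\<alpha>. of_bool (Q \<alpha>)"] by (simp add: of_bool_conj)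

lemma odec_disj [orec_intro]: "odec P \<Longrightarrow> odec Q \<Longrightarrow> odec (\<lambda>\<alpha>. P \<alpha> \<or> Q \<alpha>)"
  using odec_not[OF odec_conj[OF odec_not odec_not], of P Q] by simp

lemma odec_imp [orec_intro]: "odec P \<Longrightarrow> odec Q \<Longrightarrow> odec (\<lambda>\<alpha>. P \<alpha> \<longrightarrow> Q \<alpha>)"
  unfolding imp_conv_disj by (intro orec_intro)

lemma odec_le [orec_intro]: "orec f \<Longrightarrow> orec g \<Longrightarrow> odec (\<lambda>\<alpha>. f \<alpha> \<le> g \<alpha>)"
  using odec_zero[OF orec_diff, of f g] by simp

lemma odec_less [orec_intro]: "orec f \<Longrightarrow> orec g \<Longrightarrow> odec (\<lambda>\<alpha>. f \<alpha> < g \<alpha>)"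
  using odec_not[OF odec_le, of g f] by (simp add: not_le)

lemma odec_eq [orec_intro]: "orec f \<Longrightarrow> orec g \<Longrightarrow> odec (\<lambda>\<alpha>. f \<alpha> = g \<alpha>)"
  using odec_conj[OF odec_le odec_le, of f g g f] by (simp add: eq_iff)

lemma orec_if [orec_intro]:
  assumes "odec P" "orec f" "orec g"
  shows "orec (\<lambda>\<alpha>. if P \<alpha> then f \<alpha> else g \<alpha>)"
proof -
  have "orec (\<lambda>\<alpha>. case_nat (g \<alpha>) (\<lambda>_. f \<alpha>) (of_bool (P \<alpha>)))"
    by (intro orec_intro orec_shifts[OF assms(2)] orec_shifts[OF assms(3)] assms)
  moreover have "case_nat (g \<alpha>) (\<lambda>_. f \<alpha>) (of_bool (P \<alpha>)) = (if P \<alpha> then f \<alpha> else g \<alpha>)" for \<alpha>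
    by simp
  ultimately show ?thesis by simp
qed

lemma orec_min [orec_intro]: "orec f \<Longrightarrow> orec g \<Longrightarrow> orec (\<lambda>\<alpha>. min (f \<alpha>) (g \<alpha>))"
  unfolding min_def by (intro orec_intro)

lemma orec_LEAST:
  assumes "odec (\<lambda>\<alpha>. P (\<alpha> 0) (shift \<alpha>))" "\<And>\<alpha>. \<exists>k. P k \<alpha>"
  shows "orec (\<lambda>\<alpha>. LEAST k. P k \<alpha>)"
  using orec_mini[OF odec_not[OF assms(1)]] assms(2) by simp

lemma odec_bex [orec_intro]:
  assumes "orec b" "odec (\<lambda>\<alpha>. P (\<alpha> 0) (shift \<alpha>))"
  shows "odec (\<lambda>\<alpha>. \<exists>k<b \<alpha>. P k \<alpha>)"
proof -
  have "odec (\<lambda>\<alpha>. P (\<alpha> 0) (shift (shift \<alpha>)))"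
  proof -
    have "orec (\<lambda>\<alpha>. (\<lambda>\<beta>. of_bool (P (\<beta> 0) (shift \<beta>))) (\<lambda>x. case_nat (\<alpha> 0) (\<lambda>i. \<alpha> (Suc (Suc i))) x))"
      by (rule orec_subst[OF assms(2)]) (intro orec_intro)
    then show ?thesis by (simp add: shift_def)
  qed
  then have "orec (\<lambda>\<alpha>. rec_nat 0 (\<lambda>k v. if P k \<alpha> then 1 else v) (b \<alpha>))"
    by (intro orec_rec assms orec_intro)
  moreover have "rec_nat 0 (\<lambda>k v. if Q k then 1 else v) n = (of_bool (\<exists>k<n. Q k) :: nat)" for Q and n :: nat
    by (induction n) (auto simp: less_Suc_eq)
  ultimately show ?thesis by (simp only:)
qed

lemma odec_ball [orec_intro]:
  assumes "orec b" "odec (\<lambda>\<alpha>. P (\<alpha> 0) (shift \<alpha>))"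
  shows "odec (\<lambda>\<alpha>. \<forall>k<b \<alpha>. P k \<alpha>)"
  using odec_not[OF odec_bex[OF assms(1) odec_not[OF assms(2)]]] by simp

lemma odec_ball_le [orec_intro]:
  assumes "orec b" "odec (\<lambda>\<alpha>. P (\<alpha> 0) (shift \<alpha>))"
  shows "odec (\<lambda>\<alpha>. \<forall>k\<le>b \<alpha>. P k \<alpha>)"
  using odec_ball[OF orec_Suc assms(2)] assms(1) by (simp add: less_Suc_eq_le)

lemma odec_bex_le [orec_intro]:
  assumes "orec b" "odec (\<lambda>\<alpha>. P (\<alpha> 0) (shift \<alpha>))"
  shows "odec (\<lambda>\<alpha>. \<exists>k\<le>b \<alpha>. P k \<alpha>)"
  using odec_bex[OF orec_Suc assms(2)] assms(1) by (simp add: less_Suc_eq_le)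

lemma odec_dvd [orec_intro]:
  assumes "orec f" "orec g"
  shows "odec (\<lambda>\<alpha>. f \<alpha> dvd g \<alpha>)"
proof -
  have "odec (\<lambda>\<alpha>. \<exists>k\<le>g \<alpha>. g \<alpha> = f \<alpha> * k)"
    by (intro orec_intro assms orec_shifts[OF assms(1)] orec_shifts[OF assms(2)])
  moreover have "(\<exists>k\<le>y. y = x * k) \<longleftrightarrow> x dvd y" for x y :: nat
    by (cases "x = 0") (auto simp: dvd_def)
  ultimately show ?thesis by simp
qed

section \<open>Comparison with recursive functions, and effective continuity\<close>

lemma recfn_reindex:
  assumes "recfn (length is) f" "\<And>i. i \<in> set is \<Longrightarrow> i < n"
  shows "recfn n (\<lambda>xs. f (map (\<lambda>i. xs ! i) is))"
proof -
  have "recfn n (\<lambda>xs. f (map (\<lambda>h. h xs) (map (\<lambda>i xs. xs ! i) is)))"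
    by (rule recfn.comp) (use assms recfn.proj in auto)
  then show ?thesis by (simp add: comp_def)
qed

lemma map_nth_shift: "length xs = n + d \<Longrightarrow> map (\<lambda>i. xs ! i) [d..<n + d] = drop d xs"
  by (intro nth_equalityI) (auto simp: add.commute)

lemma recfn_cons:
  assumes "recfn (Suc n) f" "recfn n g"
  shows "recfn n (\<lambda>xs. f (g xs # xs))"
proof -
  have "recfn n (\<lambda>xs. f (map (\<lambda>h. h xs) (g # map (\<lambda>i xs. xs ! i) [0..<n])))"
    by (rule recfn.comp) (use assms recfn.proj in auto)
  then show ?thesis
    by (rule recfn.ext) (auto simp: comp_def map_nth_shift[of _ _ 0, simplified])
qed

text \<open>Pushing a number onto an environment that is itself computed: if \<open>f\<close>
  computes the entries of \<alpha> from parameters \<open>xs\<close>, the new function computes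
  those of \<open>case_nat x \<alpha>\<close> from \<open>x # xs\<close>.\<close>

lemma recfn_case:
  assumes "recfn (Suc n) f"
  shows "recfn (Suc (Suc n)) (\<lambda>ys. case_nat (ys ! 1) (\<lambda>i. f (i # drop 2 ys)) (ys ! 0))"
proof -
  have "recfn (Suc (Suc (Suc n))) (\<lambda>ys. f (map (\<lambda>i. ys ! i) (0 # [3..<n + 3])))"
    by (rule recfn_reindex) (use assms in auto)
  then have h: "recfn (Suc (Suc (Suc n))) (\<lambda>ys. f (ys ! 0 # drop 3 ys))"
    by (rule recfn.ext) (simp add: map_nth_shift)
  have "recfn (Suc n) (\<lambda>xs. xs ! 0)"
    by (rule recfn.proj) simp
  from recfn.prec[OF this h] show ?thesis
  proof (rule recfn.ext)
    fix ys :: "nat list"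
    assume "length ys = Suc (Suc n)"
    then obtain N x xs where "ys = N # x # xs"
      by (metis length_Suc_conv)
    then show "case_nat (ys ! 1) (\<lambda>i. f (i # drop 2 ys)) (ys ! 0)
      = rec_nat (tl ys ! 0) (\<lambda>k v. f ((k # v # tl ys) ! 0 # drop 3 (k # v # tl ys))) (hd ys)"
      by (cases N) auto
  qed
qed

text \<open>The oracle is replaced by a function computed from the parameters \<open>xs\<close>. The
  induction needs arbitrary \<open>K\<close> and \<open>n\<close>, because substitution and
  recursion extend the oracle, which costs one more parameter each time
  (\<open>recfn_case\<close>).\<close>

lemma recfn_orec_aux:
  assumes "orec f"
  shows "recfn (Suc n) K \<Longrightarrow> recfn n (\<lambda>xs. f (\<lambda>i. K (i # xs)))"
  using assms
proof (induction f arbitrary: n K rule: orec.induct)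
  case (orec_const c)
  show ?case by (rule recfn.const)
next
  case (orec_Suc f)
  have "recfn n (\<lambda>xs. Suc (map (\<lambda>h. h xs) [\<lambda>xs. f (\<lambda>i. K (i # xs))] ! 0))"
    by (rule recfn.comp[where g = "\<lambda>xs. Suc (xs ! 0)"]) (use orec_Suc recfn.succ in auto)
  then show ?case by simp
next
  case (orec_app f)
  from recfn_cons[OF orec_app.prems orec_app.IH[OF orec_app.prems]] show ?case .
next
  case (orec_comp f h)
  let ?K = "\<lambda>ys. case_nat (ys ! 1) (\<lambda>i. K (i # drop 2 ys)) (ys ! 0)"
  have "recfn (Suc n) (\<lambda>ys. h (\<lambda>i. ?K (i # ys)))"
    by (rule orec_comp.IH(2)) (rule recfn_case[OF orec_comp.prems])
  from orec_comp.IH(1)[OF this] show ?case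
    by (simp cong: nat.case_cong)
next
  case (orec_prec g f h)
  let ?K = "\<lambda>ys. case_nat (ys ! 1) (\<lambda>i. K (i # drop 2 ys)) (ys ! 0)"
  let ?L = "\<lambda>ys. case_nat (ys ! 1) (\<lambda>i. ?K (i # drop 2 ys)) (ys ! 0)"
  have "recfn (Suc (Suc n)) (\<lambda>ys. h (\<lambda>i. ?L (i # ys)))"
    by (rule orec_prec.IH(3)) (intro recfn_case orec_prec.prems)
  from recfn.prec[OF orec_prec.IH(1)[OF orec_prec.prems] this]
  have "recfn (Suc n) (\<lambda>ys. rec_nat (g (\<lambda>i. K (i # tl ys)))
     (\<lambda>k v. h (case_nat k (case_nat v (\<lambda>i. K (i # tl ys))))) (hd ys))"
    by (simp cong: nat.case_cong)
  from recfn_cons[OF this orec_prec.IH(2)[OF orec_prec.prems]] show ?case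
    by simp
next
  case (orec_mini g)
  let ?K = "\<lambda>ys. case_nat (ys ! 1) (\<lambda>i. K (i # drop 2 ys)) (ys ! 0)"
  have g: "recfn (Suc n) (\<lambda>ys. g (\<lambda>i. ?K (i # ys)))"
    by (rule orec_mini.IH) (rule recfn_case[OF orec_mini.prems])
  from recfn.mini[OF this] orec_mini.hyps show ?case
    by (simp cong: nat.case_cong)
qed

lemma recfn_orec:
  assumes "orec f"
  shows "recfn n (\<lambda>xs. f (\<lambda>i. if i < n then xs ! i else 0))"
proof -
  have "recfn (Suc n) (\<lambda>ys. if ys ! 0 < n then tl ys ! (ys ! 0) else 0)"
  proof (induction n)
    case 0
    have "recfn 1 (\<lambda>ys. 0)" by (rule recfn.const)
    then show ?case by simp
  next
    case (Suc n)
    from recfn_case[OF this] show ?case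
    proof (rule recfn.ext)
      fix ys :: "nat list"
      assume "length ys = Suc (Suc n)"
      then obtain N x xs where "ys = N # x # xs"
        by (metis length_Suc_conv)
      then show "(if ys ! 0 < Suc n then tl ys ! (ys ! 0) else 0) =
         case_nat (ys ! 1) (\<lambda>i. if (i # drop 2 ys) ! 0 < n then tl (i # drop 2 ys) ! ((i # drop 2 ys) ! 0) else 0) (ys ! 0)"
        by (cases N) auto
    qed
  qed
  from recfn_orec_aux[OF assms this] show ?thesis
    by (simp only: nth_Cons_0 list.sel)
qed

lemma recursive_seq_orec: "orec (\<lambda>\<alpha>. f (\<alpha> 0)) \<Longrightarrow> recursive_seq f"
  unfolding recursive_seq_def using recfn_orec[of "\<lambda>\<alpha>. f (\<alpha> 0)" 1] by simp

lemma recursive_rel4_orec: "odec (\<lambda>\<alpha>. R (\<alpha> 0) (\<alpha> 1) (\<alpha> 2) (\<alpha> 3)) \<Longrightarrow> recursive_rel4 R"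
  unfolding recursive_rel4_def
  using recfn_orec[of "\<lambda>\<alpha>. of_bool (R (\<alpha> 0) (\<alpha> 1) (\<alpha> 2) (\<alpha> 3))" 4] by simp

text \<open>Composition in \<open>recfn\<close> substitutes a whole list of functions, whereas
  \<open>orec_subst\<close> substitutes one family indexed by a number; here the list is made into
  such a family.\<close>

lemma orec_nth_list:
  assumes "\<And>h. h \<in> set hs \<Longrightarrow> orec h"
  shows "orec (\<lambda>\<alpha>. if \<alpha> 0 < length hs then (hs ! \<alpha> 0) (shift \<alpha>) else 0)"
  using assms
proof (induction hs)
  case Nil
  show ?case using orec_const[of 0] by simp
next
  case (Cons h hs)
  have h: "orec h"
    using Cons.prems by simp
  have "orec (\<lambda>\<alpha>. if \<alpha> 0 < length hs then (hs ! \<alpha> 0) (shift \<alpha>) else 0)"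
    using Cons by simp
  then have "orec (\<lambda>\<alpha>. (\<lambda>\<beta>. if \<beta> 0 < length hs then (hs ! \<beta> 0) (shift \<beta>) else 0)
      (\<lambda>x. case_nat (\<alpha> 0) (\<lambda>i. \<alpha> (Suc (Suc i))) x))"
    by (rule orec_subst) (intro orec_intro)
  then have "orec (\<lambda>\<alpha>. if \<alpha> 0 < length hs then (hs ! \<alpha> 0) (shift (shift \<alpha>)) else 0)"
    by (simp add: shift_def cong: if_cong)
  then have "orec (\<lambda>\<alpha>. case_nat (h (shift \<alpha>)) 
     (\<lambda>i. if i < length hs then (hs ! i) (shift \<alpha>) else 0) (\<alpha> 0))"
    by (intro orec_case_nat orec_shifts(1)[OF h] orec_app orec_const)
  moreover have "case_nat (h (shift \<alpha>)) (\<lambda>i. if i < length hs then (hs ! i) (shift \<alpha>) else 0) (\<alpha> 0)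
    = (if \<alpha> 0 < length (h # hs) then ((h # hs) ! \<alpha> 0) (shift \<alpha>) else 0)" for \<alpha> :: "nat \<Rightarrow> nat"
    by (cases "\<alpha> 0") auto
  ultimately show ?case by (simp only:)
qed

lemma map_upt_Suc0: "map \<alpha> [0..<Suc n] = \<alpha> 0 # map (shift \<alpha>) [0..<n]"
  by (rule nth_equalityI) (auto simp: nth_Cons shift_apply simp del: upt_Suc split: nat.split)

lemma orec_recfn: "recfn n f \<Longrightarrow> orec (\<lambda>\<alpha>. f (map \<alpha> [0..<n]))"
proof (induction rule: recfn.induct)
  case (const n c)
  show ?case by (rule orec_const)
next
  case succ
  show ?case by (simp add: orec_intro)
next
  case (proj i n)
  then show ?case by (simp add: orec_intro)
next
  case (comp hs g n)
  let ?H = "map (\<lambda>h \<alpha>. h (map \<alpha> [0..<n])) hs"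
  have "orec (\<lambda>\<alpha>. (\<lambda>\<beta>. g (map \<beta> [0..<length hs])) (\<lambda>x. if x < length ?H then (?H ! x) \<alpha> else 0))"
    by (rule orec_subst[OF comp.IH(1)], rule orec_nth_list) (use comp.IH(2) in auto)
  moreover have "map (\<lambda>x. if x < length ?H then (?H ! x) \<alpha> else 0) [0..<length hs] 
    = map (\<lambda>h. h (map \<alpha> [0..<n])) hs" for \<alpha>
    by (intro nth_equalityI) auto
  ultimately show ?case by simp
next
  case (prec n g h)
  have "orec (\<lambda>\<alpha>. rec_nat (g (map (shift \<alpha>) [0..<n])) 
    (\<lambda>k v. h (map (case_nat k (case_nat v (shift \<alpha>))) [0..<Suc (Suc n)])) (\<alpha> 0))"
  proof -
    have "orec (\<lambda>\<alpha>. h (map (\<lambda>x. case_nat (\<alpha> 0) (case_nat (\<alpha> 1) (shift (shift (shift \<alpha>)))) x) [0..<Suc (Suc n)]))"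
      by (rule orec_subst[OF prec.IH(2)], unfold shift_apply) (intro orec_intro)
    then show ?thesis
      using prec.IH(1) by (intro orec_rec orec_shifts[of "\<lambda>\<alpha>. g (map \<alpha> [0..<n])"] orec_intro) (simp_all only: One_nat_def)
  qed
  then show ?case
    by (simp only: map_upt_Suc0 shift_case_nat list.sel nat.case)
next
  case (mini n g)
  have "\<exists>k. g (map (case_nat k \<alpha>) [0..<Suc n]) = 0" for \<alpha>
    using mini(2)[of "map \<alpha> [0..<n]"] unfolding map_upt_Suc0 by simp
  from orec_mini[OF mini.IH this] show ?case
    by (simp only: map_upt_Suc0 shift_case_nat nat.case)
next
  case (ext n g f)
  then show ?case by simp
qed

lemma orec_recursive_seq: "recursive_seq f \<Longrightarrow> orec (\<lambda>\<alpha>. f (\<alpha> 0))"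
  unfolding recursive_seq_def by (drule orec_recfn) simp

lemma orec_recursive_rel4: "recursive_rel4 R \<Longrightarrow> odec (\<lambda>\<alpha>. R (\<alpha> 0) (\<alpha> 1) (\<alpha> 2) (\<alpha> 3))"
  unfolding recursive_rel4_def by (drule orec_recfn) (simp add: eval_nat_numeral)

text \<open>Continuity made effective: \<open>a m \<alpha>\<close> tries to compute \<open>f \<alpha>\<close> from the first \<open>m\<close> values of \<open>\<alpha>\<close>
  and returns \<open>0\<close> if these do not suffice, and \<open>Suc (f \<alpha>)\<close> otherwise.\<close>

definition approx :: "((nat \<Rightarrow> nat) \<Rightarrow> nat) \<Rightarrow> (nat \<Rightarrow> (nat \<Rightarrow> nat) \<Rightarrow> nat) \<Rightarrow> bool" where
  "approx f a \<longleftrightarrow> orec (\<lambda>\<alpha>. a (\<alpha> 0) (shift \<alpha>)) \<and>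
    (\<forall>m \<alpha>. a m \<alpha> = 0 \<or> a m \<alpha> = Suc (f \<alpha>)) \<and>
    (\<forall>m \<alpha> \<beta>. (\<forall>i<m. \<alpha> i = \<beta> i) \<longrightarrow> a m \<alpha> = a m \<beta>) \<and>
    (\<forall>\<alpha>. \<forall>\<^sub>F m in sequentially. a m \<alpha> = Suc (f \<alpha>))"

lemma approx_orec: "approx f a \<Longrightarrow> orec (\<lambda>\<alpha>. a (\<alpha> 0) (shift \<alpha>))"
  and approx_sound: "approx f a \<Longrightarrow> a m \<alpha> = 0 \<or> a m \<alpha> = Suc (f \<alpha>)"
  and approx_local: "approx f a \<Longrightarrow> (\<And>i. i < m \<Longrightarrow> \<alpha> i = \<beta> i) \<Longrightarrow> a m \<alpha> = a m \<beta>"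
  and approx_eventually: "approx f a \<Longrightarrow> \<forall>\<^sub>F m in sequentially. a m \<alpha> = Suc (f \<alpha>)"
  unfolding approx_def by blast+

text \<open>\<open>f\<close> inspects finitely many entries of its oracle, and each of them needs
  finitely many values of \<alpha>. With m values of \<alpha>, an initial segment of length
  \<open>?L m \<alpha>\<close> of the inner sequence is known, and \<open>a\<close> is run on that
  segment only.\<close>

lemma approx_comp:
  assumes "approx f a" "approx h b"
  shows "\<exists>c. approx (\<lambda>\<alpha>. f (\<lambda>x. h (case_nat x \<alpha>))) c"
proof
  \<comment> \<open>\<open>Suc m\<close> because \<open>x\<close> stands in front: the first
    \<open>Suc m\<close> entries of \<open>case_nat x \<alpha>\<close> involve only m values of
    \<alpha>. The alternative \<open>x = m\<close> in \<open>?L\<close> makes the search total, and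
    subtracting 1 turns an answer \<open>Suc v\<close> into \<open>v\<close>.\<close>
  let ?v = "\<lambda>m \<alpha> x. b (Suc m) (case_nat x \<alpha>)"
  let ?L = "\<lambda>m \<alpha>. LEAST x. ?v m \<alpha> x = 0 \<or> x = m"
  let ?c = "\<lambda>m \<alpha>. a (?L m \<alpha>) (\<lambda>x. ?v m \<alpha> x - 1)"
  have a: "orec (\<lambda>\<alpha>. a (\<alpha> 0) (shift \<alpha>))" and b: "orec (\<lambda>\<alpha>. b (\<alpha> 0) (shift \<alpha>))"
    and lf: "\<And>m \<alpha> \<beta>. (\<And>i. i < m \<Longrightarrow> \<alpha> i = \<beta> i) \<Longrightarrow> a m \<alpha> = a m \<beta>"
    and lh: "\<And>m \<alpha> \<beta>. (\<And>i. i < m \<Longrightarrow> \<alpha> i = \<beta> i) \<Longrightarrow> b m \<alpha> = b m \<beta>"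
    and sf: "\<And>m \<alpha>. a m \<alpha> = 0 \<or> a m \<alpha> = Suc (f \<alpha>)"
    and sh: "\<And>m \<alpha>. b m \<alpha> = 0 \<or> b m \<alpha> = Suc (h \<alpha>)"
    and ef: "\<And>\<alpha>. \<forall>\<^sub>F m in sequentially. a m \<alpha> = Suc (f \<alpha>)"
    and eh: "\<And>\<alpha>. \<forall>\<^sub>F m in sequentially. b m \<alpha> = Suc (h \<alpha>)"
    using approx_orec approx_sound approx_local approx_eventually assms by blast+
  have v: "orec (\<lambda>\<alpha>. ?v (\<alpha> 1) (shift (shift \<alpha>)) (\<alpha> 0))"
  proof -
    have "orec (\<lambda>\<alpha>. (\<lambda>\<beta>. b (\<beta> 0) (shift \<beta>))
       (\<lambda>x. case_nat (Suc (\<alpha> 1)) (\<lambda>i. case_nat (\<alpha> 0) (\<lambda>i. shift (shift \<alpha>) i) i) x))"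
      by (rule orec_subst[OF b]) (intro orec_intro)
    then show ?thesis by simp
  qed
  have v': "orec (\<lambda>\<alpha>. ?v (shift \<alpha> 0) (shift (shift \<alpha>)) (\<alpha> 0))"
    using v by (simp add: shift_apply)
  have L: "orec (\<lambda>\<alpha>. ?L (\<alpha> 0) (shift \<alpha>))"
    by (rule orec_LEAST) (intro orec_intro v', blast)
  have "orec (\<lambda>\<alpha>. (\<lambda>\<beta>. a (\<beta> 0) (shift \<beta>))
      (\<lambda>x. case_nat (?L (\<alpha> 0) (shift \<alpha>)) (\<lambda>y. ?v (\<alpha> 0) (shift \<alpha>) y - 1) x))"
  proof (rule orec_subst[OF a], rule orec_case_nat)
    show "orec (\<lambda>\<alpha>. ?L (shift \<alpha> 0) (shift (shift \<alpha>)))"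
      by (rule orec_shift[OF L])
    show "orec (\<lambda>\<alpha>. ?v (shift (shift \<alpha>) 0) (shift (shift (shift \<alpha>))) (\<alpha> 0) - 1)"
    proof -
      have "orec (\<lambda>\<alpha>. (\<lambda>\<beta>. ?v (shift \<beta> 0) (shift (shift \<beta>)) (\<beta> 0))
         (\<lambda>x. case_nat (\<alpha> 0) (\<lambda>y. shift (shift \<alpha>) y) x))"
        by (rule orec_subst[OF v']) (intro orec_intro)
      then show ?thesis
        by (intro orec_intro) simp
    qed
  qed (intro orec_intro)
  then have c: "orec (\<lambda>\<alpha>. ?c (\<alpha> 0) (shift \<alpha>))"
    by simp
  have ex: "\<exists>x. ?v m \<alpha> x = 0 \<or> x = m" for m \<alpha>
    by blast
  have below: "?v m \<alpha> x = Suc (h (case_nat x \<alpha>))" if "x < ?L m \<alpha>" for m \<alpha> x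
    using not_less_Least[OF that] sh[of "Suc m" "case_nat x \<alpha>"] by auto
  have c_eq: "?c m \<alpha> = a (?L m \<alpha>) (\<lambda>x. h (case_nat x \<alpha>))" for m \<alpha>
    by (rule lf, drule below, simp only: diff_Suc_1)
  have s: "?c m \<alpha> = 0 \<or> ?c m \<alpha> = Suc (f (\<lambda>x. h (case_nat x \<alpha>)))" for m \<alpha>
    unfolding c_eq by (rule sf)
  have l: "?c m \<alpha> = ?c m \<beta>" if "\<And>i. i < m \<Longrightarrow> \<alpha> i = \<beta> i" for m \<alpha> \<beta>
  proof -
    have "?v m \<alpha> x = ?v m \<beta> x" for x
    proof -
      show "?v m \<alpha> x = ?v m \<beta> x"
        by (rule lh) (use that in \<open>auto split: nat.split\<close>)
    qed
    then show ?thesis by simp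
  qed
  have e: "\<forall>\<^sub>F m in sequentially. ?c m \<alpha> = Suc (f (\<lambda>x. h (case_nat x \<alpha>)))" for \<alpha>
  proof -
    obtain M where M: "\<And>m. m \<ge> M \<Longrightarrow> a m (\<lambda>x. h (case_nat x \<alpha>)) = Suc (f (\<lambda>x. h (case_nat x \<alpha>)))"
      using ef[of "\<lambda>x. h (case_nat x \<alpha>)"] unfolding eventually_sequentially by blast
    have "\<forall>\<^sub>F m in sequentially. \<forall>x\<in>{..<M}. ?v m \<alpha> x = Suc (h (case_nat x \<alpha>))"
      by (intro eventually_ball_finite ballI iffD2[OF eventually_sequentially_Suc] eh) simp
    then show ?thesis
      using eventually_ge_at_top[of M]
    proof eventually_elim
      case (elim m)
      have "M \<le> ?L m \<alpha>"
        by (rule LeastI2_ex[OF ex]) (use elim in \<open>force simp: not_less[symmetric]\<close>)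
      then show ?case
        unfolding c_eq by (rule M)
    qed
  qed
  show "approx (\<lambda>\<alpha>. f (\<lambda>x. h (case_nat x \<alpha>))) ?c"
    unfolding approx_def using c s l e by blast
qed

lemma ex_approx: "orec f \<Longrightarrow> \<exists>a. approx f a"
proof (induction rule: orec.induct)
  case (orec_const c)
  have "approx (\<lambda>_. c) (\<lambda>_ _. Suc c)"
    by (auto simp: approx_def orec_intro)
  then show ?case by blast
next
  case (orec_Suc f)
  then obtain a where a: "approx f a" by blast
  have "approx (\<lambda>\<alpha>. Suc (f \<alpha>)) (\<lambda>m \<alpha>. case_nat 0 (\<lambda>v. Suc (Suc v)) (a m \<alpha>))"
    unfolding approx_def
  proof (intro conjI)
    show "orec (\<lambda>\<alpha>. case_nat 0 (\<lambda>v. Suc (Suc v)) (a (\<alpha> 0) (shift \<alpha>)))"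
      by (intro orec_intro approx_orec[OF a])
    show "\<forall>\<alpha>. \<forall>\<^sub>F m in sequentially. case_nat 0 (\<lambda>v. Suc (Suc v)) (a m \<alpha>) = Suc (Suc (f \<alpha>))"
    proof
      fix \<alpha>
      note approx_eventually[OF a, of \<alpha>]
      then show "\<forall>\<^sub>F m in sequentially. case_nat 0 (\<lambda>v. Suc (Suc v)) (a m \<alpha>) = Suc (Suc (f \<alpha>))"
        by eventually_elim simp
    qed
  qed (use a in \<open>unfold approx_def, (metis nat.case)+\<close>)
  then show ?case by blast
next
  case (orec_app f)
  then obtain a where a: "approx f a" by blast
  \<comment> \<open>The oracle may be asked at \<open>v\<close> only if \<open>v < m\<close>;
    otherwise the answer 0 keeps \<open>?b m\<close> dependent on the first m values alone.\<close>
  let ?b = "\<lambda>m \<alpha>. case_nat 0 (\<lambda>v. if v < m then Suc (\<alpha> v) else 0) (a m \<alpha>)"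
  have "approx (\<lambda>\<alpha>. \<alpha> (f \<alpha>)) ?b"
    unfolding approx_def
  proof (intro conjI allI)
    show "orec (\<lambda>\<alpha>. ?b (\<alpha> 0) (shift \<alpha>))"
      by (intro orec_intro approx_orec[OF a])
    fix \<alpha>
    from approx_eventually[OF a, of \<alpha>] show "\<forall>\<^sub>F m in sequentially. ?b m \<alpha> = Suc (\<alpha> (f \<alpha>))"
      using eventually_gt_at_top[of "f \<alpha>"] by eventually_elim auto
    fix m
    show "?b m \<alpha> = 0 \<or> ?b m \<alpha> = Suc (\<alpha> (f \<alpha>))"
      using approx_sound[OF a, of m \<alpha>] by auto
    fix \<beta>
    show "(\<forall>i<m. \<alpha> i = \<beta> i) \<longrightarrow> ?b m \<alpha> = ?b m \<beta>"
    proof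
      assume eq: "\<forall>i<m. \<alpha> i = \<beta> i"
      then have "a m \<alpha> = a m \<beta>"
        using a unfolding approx_def by blast
      then show "?b m \<alpha> = ?b m \<beta>"
        using eq by (auto split: nat.split)
    qed
  qed
  then show ?case by blast
next
  case (orec_comp f h)
  then show ?case using approx_comp by blast
next
  case (orec_prec g f h)
  then obtain a b c where a: "approx g a" and b: "approx f b" and c: "approx h c" by blast
  \<comment> \<open>Two numbers are pushed in front of \<alpha>, hence \<open>Suc (Suc m)\<close>. A
    failed stage, with answer 0, makes all later stages fail.\<close>
  let ?s = "\<lambda>m \<alpha> k w. case_nat 0 (\<lambda>v. c (Suc (Suc m)) (case_nat k (case_nat v \<alpha>))) w"
  let ?r = "\<lambda>m \<alpha> n. rec_nat (a m \<alpha>) (?s m \<alpha>) n"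
  let ?R = "\<lambda>\<alpha> n. rec_nat (g \<alpha>) (\<lambda>k v. h (case_nat k (case_nat v \<alpha>))) n"
  let ?d = "\<lambda>m \<alpha>. case_nat 0 (?r m \<alpha>) (b m \<alpha>)"
  have oa: "orec (\<lambda>\<alpha>. a (\<alpha> 0) (shift \<alpha>))" and ob: "orec (\<lambda>\<alpha>. b (\<alpha> 0) (shift \<alpha>))"
    and oc: "orec (\<lambda>\<alpha>. c (\<alpha> 0) (shift \<alpha>))"
    by (intro approx_orec[OF a] approx_orec[OF b] approx_orec[OF c])+
  have step: "orec (\<lambda>\<alpha>. c (Suc (Suc (\<alpha> 4))) (case_nat (\<alpha> 1) (case_nat (\<alpha> 0) (shift (shift (shift (shift (shift \<alpha>))))))))"
  proof -
    have "orec (\<lambda>\<alpha>. (\<lambda>\<beta>. c (\<beta> 0) (shift \<beta>)) (\<lambda>x. case_nat (Suc (Suc (\<alpha> 4))) (\<lambda>i. case_nat (\<alpha> 1) 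
      (\<lambda>i. case_nat (\<alpha> 0) (\<lambda>i. \<alpha> (Suc (Suc (Suc (Suc (Suc i)))))) i) i) x))"
      by (rule orec_subst[OF oc]) (intro orec_intro)
    then show ?thesis by (simp add: shift_def cong: nat.case_cong)
  qed
  have r: "orec (\<lambda>\<alpha>. ?r (\<alpha> 1) (shift (shift \<alpha>)) (\<alpha> 0))"
    using step orec_shift[OF oa] by (intro orec_rec orec_case_nat orec_intro)
      (simp_all add: shift_apply eval_nat_numeral)
  have d: "orec (\<lambda>\<alpha>. ?d (\<alpha> 0) (shift \<alpha>))"
    using r by (intro orec_case_nat ob orec_intro) (simp add: shift_apply cong: nat.case_cong)
  have sr: "?r m \<alpha> n = 0 \<or> ?r m \<alpha> n = Suc (?R \<alpha> n)" for m \<alpha> n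
  proof (induction n)
    case 0
    show ?case using approx_sound[OF a] by simp
  next
    case (Suc n)
    then show ?case
      using approx_sound[OF c, of "Suc (Suc m)" "case_nat n (case_nat (?R \<alpha> n) \<alpha>)"] by auto
  qed
  have s: "?d m \<alpha> = 0 \<or> ?d m \<alpha> = Suc (?R \<alpha> (f \<alpha>))" for m \<alpha>
  proof -
    show ?thesis using approx_sound[OF b, of m \<alpha>] sr[of m \<alpha> "f \<alpha>"] by auto
  qed
  have l: "?d m \<alpha> = ?d m \<beta>" if "\<forall>i<m. \<alpha> i = \<beta> i" for m \<alpha> \<beta>
  proof -
    have "c (Suc (Suc m)) (case_nat k (case_nat v \<alpha>)) = c (Suc (Suc m)) (case_nat k (case_nat v \<beta>))" for k v
    proof -
      have "\<forall>i<Suc (Suc m). case_nat k (case_nat v \<alpha>) i = case_nat k (case_nat v \<beta>) i"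
        using that by (auto split: nat.split)
      then show ?thesis using c unfolding approx_def by blast
    qed
    moreover have "a m \<alpha> = a m \<beta>" "b m \<alpha> = b m \<beta>"
      using that a b unfolding approx_def by blast+
    ultimately show ?thesis by (simp cong: nat.case_cong)
  qed
  have er: "\<forall>\<^sub>F m in sequentially. ?r m \<alpha> n = Suc (?R \<alpha> n)" for \<alpha> n
  proof (induction n)
    case 0
    show ?case using approx_eventually[OF a] by simp
  next
    case (Suc n)
    let ?\<beta> = "case_nat n (case_nat (?R \<alpha> n) \<alpha>)"
    have "\<forall>\<^sub>F m in sequentially. c m ?\<beta> = Suc (h ?\<beta>)"
      by (rule approx_eventually[OF c])
    then have "\<forall>\<^sub>F m in sequentially. c (Suc (Suc m)) ?\<beta> = Suc (h ?\<beta>)"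
      using eventually_sequentially_Suc[of "\<lambda>m. c m ?\<beta> = Suc (h ?\<beta>)"]
        eventually_sequentially_Suc[of "\<lambda>m. c (Suc m) ?\<beta> = Suc (h ?\<beta>)"] by simp
    with Suc show ?case
      by eventually_elim simp
  qed
  have e: "\<forall>\<^sub>F m in sequentially. ?d m \<alpha> = Suc (?R \<alpha> (f \<alpha>))" for \<alpha>
  proof -
    from approx_eventually[OF b, of \<alpha>] er[of \<alpha> "f \<alpha>"] show ?thesis
      by eventually_elim simp
  qed
  have "approx (\<lambda>\<alpha>. ?R \<alpha> (f \<alpha>)) ?d"
    unfolding approx_def using d s l e by blast
  then show ?case by blast
next
  case (orec_mini g)
  then obtain a where a: "approx g a" by blast
  let ?v = "\<lambda>m \<alpha> k. a (Suc m) (case_nat k \<alpha>)"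
  \<comment> \<open>The search stops at the first k whose value is unknown (0) or known to vanish (1
    = \<open>Suc 0\<close>), at the latest at m. An answer is given only if the value there is 1,
    since then all smaller values are known to be nonzero.\<close>
  let ?K = "\<lambda>m \<alpha>. LEAST k. ?v m \<alpha> k \<le> 1 \<or> k = m"
  let ?d = "\<lambda>m \<alpha>. if ?v m \<alpha> (?K m \<alpha>) = 1 then Suc (?K m \<alpha>) else 0"
  have oa: "orec (\<lambda>\<alpha>. a (\<alpha> 0) (shift \<alpha>))"
    and la: "\<And>m \<alpha> \<beta>. (\<And>i. i < m \<Longrightarrow> \<alpha> i = \<beta> i) \<Longrightarrow> a m \<alpha> = a m \<beta>"
    and sa: "\<And>m \<alpha>. a m \<alpha> = 0 \<or> a m \<alpha> = Suc (g \<alpha>)"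
    and ea: "\<And>\<alpha>. \<forall>\<^sub>F m in sequentially. a m \<alpha> = Suc (g \<alpha>)"
    using approx_orec approx_sound approx_local approx_eventually a by blast+
  have v: "orec (\<lambda>\<alpha>. ?v (shift \<alpha> 0) (shift (shift \<alpha>)) (\<alpha> 0))"
  proof -
    have "orec (\<lambda>\<alpha>. (\<lambda>\<beta>. a (\<beta> 0) (shift \<beta>))
       (\<lambda>x. case_nat (Suc (\<alpha> 1)) (\<lambda>i. case_nat (\<alpha> 0) (\<lambda>i. shift (shift \<alpha>) i) i) x))"
      by (rule orec_subst[OF oa]) (intro orec_intro)
    then show ?thesis by (simp add: shift_apply)
  qed
  have K: "orec (\<lambda>\<alpha>. ?K (\<alpha> 0) (shift \<alpha>))"
    by (rule orec_LEAST) (intro orec_intro v, blast)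
  have d: "orec (\<lambda>\<alpha>. ?d (\<alpha> 0) (shift \<alpha>))"
    by (intro orec_intro K orec_num[where f = "\<lambda>k \<alpha>. ?v (\<alpha> 0) (shift \<alpha>) k"] v)
  have ex: "\<exists>k. ?v m \<alpha> k \<le> 1 \<or> k = m" for m \<alpha>
    by blast
  have s: "?d m \<alpha> = 0 \<or> ?d m \<alpha> = Suc (LEAST k. g (case_nat k \<alpha>) = 0)" for m \<alpha>
  proof (cases "?v m \<alpha> (?K m \<alpha>) = 1")
    case True
    then have "g (case_nat (?K m \<alpha>) \<alpha>) = 0"
      using sa[of "Suc m" "case_nat (?K m \<alpha>) \<alpha>"] by auto
    moreover have "?K m \<alpha> \<le> k" if "g (case_nat k \<alpha>) = 0" for k
      using sa[of "Suc m" "case_nat k \<alpha>"] that by (intro Least_le) auto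
    ultimately have "(LEAST k. g (case_nat k \<alpha>) = 0) = ?K m \<alpha>"
      by (rule Least_equality)
    with True show ?thesis by simp
  qed simp
  have l: "?d m \<alpha> = ?d m \<beta>" if "\<forall>i<m. \<alpha> i = \<beta> i" for m \<alpha> \<beta>
  proof -
    have "?v m \<alpha> x = ?v m \<beta> x" for x
    proof -
      show "?v m \<alpha> x = ?v m \<beta> x"
        by (rule la) (use that in \<open>auto split: nat.split\<close>)
    qed
    then show ?thesis by simp
  qed
  have e: "\<forall>\<^sub>F m in sequentially. ?d m \<alpha> = Suc (LEAST k. g (case_nat k \<alpha>) = 0)" for \<alpha>
  proof -
    define M where "M = (LEAST k. g (case_nat k \<alpha>) = 0)"
    have M: "g (case_nat M \<alpha>) = 0"
      unfolding M_def by (rule LeastI_ex) (rule orec_mini.hyps)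
    have "\<forall>\<^sub>F m in sequentially. \<forall>x\<in>{..M}. ?v m \<alpha> x = Suc (g (case_nat x \<alpha>))"
      by (intro eventually_ball_finite ballI iffD2[OF eventually_sequentially_Suc] ea) simp
    then show ?thesis
      using eventually_ge_at_top[of M]
    proof eventually_elim
      case (elim m)
      have "?K m \<alpha> = M"
      proof (rule Least_equality)
        show "?v m \<alpha> M \<le> 1 \<or> M = m"
          using elim M by simp
        fix k assume k: "?v m \<alpha> k \<le> 1 \<or> k = m"
        show "M \<le> k"
        proof (rule ccontr)
          assume "\<not> M \<le> k"
          then have "g (case_nat k \<alpha>) \<noteq> 0" "?v m \<alpha> k = Suc (g (case_nat k \<alpha>))" "k \<noteq> m"
            using elim not_less_Least[of k "\<lambda>k. g (case_nat k \<alpha>) = 0"] by (auto simp: M_def[symmetric])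
          with k show False by simp
        qed
      qed
      then show ?case
        using elim M by (simp add: M_def[symmetric])
    qed
  qed
  have "approx (\<lambda>\<alpha>. LEAST k. g (case_nat k \<alpha>) = 0) ?d"
    unfolding approx_def using d s l e by blast
  then show ?case by blast
qed

section \<open>Recursiveness of the coding of finite sequences\<close>

abbreviation nth_prime :: "nat \<Rightarrow> nat" where
  "nth_prime \<equiv> enumerate {p. prime p}"

lemma infinite_primes: "infinite {p::nat. prime p}"
  by (rule primes_infinite)

lemma prime_nth_prime: "prime (nth_prime i)"
  using enumerate_in_set[OF infinite_primes, of i] by simp

lemma nth_prime_eq_iff: "nth_prime i = nth_prime j \<longleftrightarrow> i = j"
  using enumerate_mono_iff[OF infinite_primes] by (metis linorder_neqE_nat less_irrefl)

lemma ex_nth_prime: "prime p \<Longrightarrow> \<exists>i. p = nth_prime i"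
  using range_enumerate[OF infinite_primes] by blast

lemma orec_nth_prime [orec_intro]:
  assumes "orec f"
  shows "orec (\<lambda>\<alpha>. nth_prime (f \<alpha>))"
proof -
  have "odec (\<lambda>\<alpha>. 1 < \<alpha> 0 \<and> (\<forall>m\<le>\<alpha> 0. m dvd \<alpha> 0 \<longrightarrow> m = 1 \<or> m = \<alpha> 0) \<and> \<alpha> 2 < \<alpha> 0)"
    by (intro orec_intro)
  moreover have "1 < q \<and> (\<forall>m\<le>q. m dvd q \<longrightarrow> m = 1 \<or> m = q) \<and> v < q \<longleftrightarrow> prime q \<and> v < q" for q v :: nat
    unfolding prime_nat_iff by (meson dvd_imp_le order.strict_trans zero_less_one)
  ultimately have "odec (\<lambda>\<alpha>. prime (\<alpha> 0) \<and> shift \<alpha> 1 < \<alpha> 0)"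
    by (simp add: shift_apply eval_nat_numeral)
  moreover have "\<exists>q. prime q \<and> n < q" for n :: nat
    using bigger_prime by blast
  ultimately have "orec (\<lambda>\<alpha>. LEAST q. prime q \<and> \<alpha> 1 < q)"
    by (intro orec_LEAST)
  then have "orec (\<lambda>\<alpha>. rec_nat 2 (\<lambda>k v. LEAST q. prime q \<and> v < q) (f \<alpha>))"
    by (intro orec_rec assms orec_intro)
  moreover have "rec_nat 2 (\<lambda>k v. LEAST q. prime q \<and> v < q) n = nth_prime n" for n
  proof (induction n)
    case 0
    have "(LEAST p::nat. prime p) = 2"
      by (rule Least_equality) (auto dest: prime_ge_2_nat)
    then show ?case by (simp add: enumerate_0)
  next
    case (Suc n)
    then show ?case by (simp add: enumerate_Suc''[OF infinite_primes])
  qed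
  ultimately show ?thesis by simp
qed

lemma seq_code_pos: "seq_code xs > 0"
  unfolding seq_code_def
  by (intro prod_pos) (auto simp: prime_gt_0_nat prime_nth_prime)

lemma multiplicity_seq_code:
  "multiplicity (nth_prime j) (seq_code xs) = (if j < length xs then xs ! j + 1 else 0)"
proof -
  have "multiplicity (nth_prime j) (seq_code xs)
    = (\<Sum>i<length xs. multiplicity (nth_prime j) (nth_prime i ^ (xs ! i + 1)))"
    unfolding seq_code_def
    by (rule prime_elem_multiplicity_prod_distrib)
      (use prime_nth_prime prime_gt_0_nat in \<open>auto simp: image_iff\<close>)
  also have "\<dots> = (\<Sum>i<length xs. if i = j then xs ! i + 1 else 0)"
  proof (rule sum.cong)
    fix i
    show "multiplicity (nth_prime j) (nth_prime i ^ (xs ! i + 1)) = (if i = j then xs ! i + 1 else 0)"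
      using multiplicity_distinct_prime_power[OF prime_nth_prime[of j] prime_nth_prime[of i], of "xs ! i + 1"]
        multiplicity_same_power[of "nth_prime j" "xs ! j + 1"] prime_nth_prime[of j] nth_prime_eq_iff[of i j]
        prime_gt_Suc_0_nat[OF prime_nth_prime[of j]]
      by (auto simp: prime_gt_0_nat)
  qed simp
  finally show ?thesis by simp
qed

lemma nth_prime_dvd_seq_code: "nth_prime j dvd seq_code xs \<longleftrightarrow> j < length xs"
  using multiplicity_seq_code[of j xs] prime_multiplicity_gt_zero_iff[of "nth_prime j" "seq_code xs"]
    prime_nth_prime[of j] seq_code_pos[of xs] by (auto split: if_splits)

lemma seq_code_inject: "seq_code xs = seq_code ys \<longleftrightarrow> xs = ys"
proof
  assume eq: "seq_code xs = seq_code ys"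
  then have "j < length xs \<longleftrightarrow> j < length ys" for j
    using nth_prime_dvd_seq_code by metis
  then have len: "length xs = length ys"
    by (metis linorder_neqE_nat less_irrefl)
  show "xs = ys"
  proof (rule nth_equalityI[OF len])
    fix j assume "j < length xs"
    then show "xs ! j = ys ! j"
      using multiplicity_seq_code[of j xs] multiplicity_seq_code[of j ys] eq len by simp
  qed
qed simp

lemma seq_nth_seq_code [simp]: "seq_nth (seq_code xs) i = (if i < length xs then xs ! i else 0)"
proof -
  have "(THE ys. seq_code xs = seq_code ys) = xs"
    by (simp add: seq_code_inject)
  then show ?thesis
    unfolding seq_nth_def by (auto simp: seq_code_inject)
qed

text \<open>If \<open>nth_prime i\<close> divides \<open>u > 0\<close>, then \<open>i < u\<close>;
  this bounds every search through the prime divisors of a code.\<close>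

lemma less_nth_prime: "i < nth_prime i"
  by (induction i) (use enumerate_step[OF infinite_primes] prime_gt_0_nat[OF prime_nth_prime] 
     in \<open>auto simp del: enumerate_Suc intro: le_less_trans\<close>, meson Suc_leI le_less_trans)

text \<open>Codes are the positive numbers whose prime divisors form an initial segment of the
  primes: all exponents up to the length are at least 1. The bound \<open>i < u\<close> makes the
  condition decidable and loses nothing by \<open>less_nth_prime\<close>.\<close>

lemma is_seq_code_iff:
  "(\<exists>xs. u = seq_code xs) \<longleftrightarrow> 0 < u \<and> (\<forall>i<u. nth_prime (Suc i) dvd u \<longrightarrow> nth_prime i dvd u)"
proof
  assume "\<exists>xs. u = seq_code xs"
  then show "0 < u \<and> (\<forall>i<u. nth_prime (Suc i) dvd u \<longrightarrow> nth_prime i dvd u)"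
    by (auto simp: nth_prime_dvd_seq_code seq_code_pos simp del: enumerate_Suc)
next
  assume u: "0 < u \<and> (\<forall>i<u. nth_prime (Suc i) dvd u \<longrightarrow> nth_prime i dvd u)"
  have bound: "i < u" if "nth_prime i dvd u" for i
    using less_nth_prime[of i] dvd_imp_le[OF that] u by auto
  \<comment> \<open>The length of the coded sequence: every earlier prime divides u, and by the
    assumption no later one does.\<close>
  define n where "n = (LEAST i. \<not> nth_prime i dvd u)"
  have ex: "\<not> nth_prime u dvd u"
    using bound by blast
  have n: "\<not> nth_prime n dvd u"
    unfolding n_def by (rule LeastI) (rule ex)
  have lt: "nth_prime i dvd u" if "i < n" for i
    using not_less_Least[of i "\<lambda>i. \<not> nth_prime i dvd u"] that by (auto simp: n_def)
  have ge: "\<not> nth_prime i dvd u" if "n \<le> i" for i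
    using that
  proof (induction i rule: dec_induct)
    case base
    show ?case by (rule n)
  next
    case (step i)
    then show ?case using u bound[of "Suc i"] by (meson Suc_lessD)
  qed
  define xs where "xs = map (\<lambda>i. multiplicity (nth_prime i) u - 1) [0..<n]"
  have "u = seq_code xs"
  proof (rule multiplicity_eq_nat)
    fix p :: nat assume p: "prime p"
    then obtain j where j: "p = nth_prime j"
      using ex_nth_prime by blast
    show "multiplicity p u = multiplicity p (seq_code xs)"
    proof (cases "j < n")
      case True
      then have "0 < multiplicity p u"
        using lt[of j] j p u prime_multiplicity_gt_zero_iff[of p u] by auto
      then show ?thesis
        unfolding j multiplicity_seq_code using True by (simp add: xs_def)
    next
      case False
      then show ?thesis
        using ge[of j] unfolding j multiplicity_seq_code by (simp add: xs_def not_dvd_imp_multiplicity_0)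
    qed
  qed (use u seq_code_pos in auto)
  then show "\<exists>xs. u = seq_code xs" by blast
qed

text \<open>The exponent of the i-th prime is the entry plus one, hence \<open>Suc (Suc e)\<close>.
  The alternative \<open>u = 0\<close> makes the search total, as 0 is divisible by
  everything.\<close>

lemma seq_nth_eq:
  "seq_nth u i = (if 0 < u \<and> (\<forall>i<u. nth_prime (Suc i) dvd u \<longrightarrow> nth_prime i dvd u) \<and> nth_prime i dvd u
     then LEAST e. u = 0 \<or> \<not> nth_prime i ^ Suc (Suc e) dvd u else 0)" 
proof (cases "\<exists>xs. u = seq_code xs \<and> i < length xs")
  case True
  then obtain xs where xs: "u = seq_code xs" "i < length xs" by blast
  have "nth_prime i ^ Suc (Suc e) dvd u \<longleftrightarrow> Suc e \<le> xs ! i" for e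
    using power_dvd_iff_le_multiplicity[of u "nth_prime i" "Suc (Suc e)"] xs seq_code_pos[of xs]
      prime_nth_prime[of i] multiplicity_seq_code[of i xs] prime_gt_Suc_0_nat[OF prime_nth_prime[of i]] by (auto simp del: power_Suc)
  then have "(LEAST e. u = 0 \<or> \<not> nth_prime i ^ Suc (Suc e) dvd u) = xs ! i"
    using seq_code_pos[of xs] xs by (intro Least_equality) auto
  moreover have "0 < u \<and> (\<forall>i<u. nth_prime (Suc i) dvd u \<longrightarrow> nth_prime i dvd u)"
    using is_seq_code_iff[of u] xs by blast
  moreover have "nth_prime i dvd u"
    using xs by (simp add: nth_prime_dvd_seq_code)
  ultimately show ?thesis
    using xs by (simp del: power_Suc enumerate_Suc)
next
  case False
  then have "\<not> (0 < u \<and> (\<forall>i<u. nth_prime (Suc i) dvd u \<longrightarrow> nth_prime i dvd u) \<and> nth_prime i dvd u)"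
    using is_seq_code_iff[of u] nth_prime_dvd_seq_code by blast
  with False show ?thesis
    unfolding seq_nth_def by (simp only: if_False)
qed

lemma orec_seq_nth [orec_intro]:
  assumes "orec f" "orec g"
  shows "orec (\<lambda>\<alpha>. seq_nth (f \<alpha>) (g \<alpha>))"
proof -
  have "\<exists>e. u = 0 \<or> \<not> nth_prime i ^ Suc (Suc e) dvd u" for u i
  proof -
    have "\<not> nth_prime i ^ Suc (Suc u) dvd u" if "u > 0"
    proof -
      have "Suc (Suc u) < 2 ^ Suc (Suc u)" by (rule less_exp)
      also have "2 ^ Suc (Suc u) \<le> nth_prime i ^ Suc (Suc u)"
        using prime_ge_2_nat[OF prime_nth_prime[of i]] by (rule power_mono) simp
      finally show ?thesis
        using that dvd_imp_le[of "nth_prime i ^ Suc (Suc u)" u] by linarith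
    qed
    then show ?thesis by blast
  qed
  then have "orec (\<lambda>\<alpha>. LEAST e. \<alpha> 0 = 0 \<or> \<not> nth_prime (\<alpha> 1) ^ Suc (Suc e) dvd \<alpha> 0)"
    by (intro orec_LEAST) (intro orec_intro)
  then have "orec (\<lambda>\<alpha>. seq_nth (\<alpha> 0) (\<alpha> 1))"
    unfolding seq_nth_eq by (intro orec_if orec_intro)
  then show ?thesis
    by (rule orec_num2[where f = seq_nth]) fact+
qed

lemma orec_seq_code2 [orec_intro]:
  assumes "orec f" "orec g"
  shows "orec (\<lambda>\<alpha>. seq_code [f \<alpha>, g \<alpha>])"
proof -
  have "seq_code [x, y] = nth_prime 0 ^ Suc x * nth_prime 1 ^ Suc y" for x y
    by (simp add: seq_code_def lessThan_Suc del: enumerate_Suc)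
  then show ?thesis
    by (simp only:) (intro orec_intro assms)
qed

lemma orec_seq_code3 [orec_intro]:
  assumes "orec f" "orec g" "orec h"
  shows "orec (\<lambda>\<alpha>. seq_code [f \<alpha>, g \<alpha>, h \<alpha>])"
proof -
  have "seq_code [x, y, z] = nth_prime 0 ^ Suc x * nth_prime 1 ^ Suc y * nth_prime 2 ^ Suc z" for x y z
    by (simp add: seq_code_def lessThan_Suc numeral_2_eq_2 del: enumerate_Suc)
  then show ?thesis
    by (simp only:) (intro orec_intro assms)
qed

lemma seq_nth_0 [simp]: "seq_nth 0 i = 0"
  unfolding seq_nth_def using seq_code_pos by (metis less_irrefl)

text \<open>Supplies a single number for finitely many chosen witnesses, and for a finite part of a
  sequence.\<close>

lemma ex_seq_nth: "\<exists>s. \<forall>i<n. seq_nth s i = f i"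
  by (rule exI[of _ "seq_code (map f [0..<n])"]) simp

section \<open>Products of \<open>\<omega>\<close> and \<open>\<omega>\<^sup>\<omega>\<close> as recursively presented Polish spaces\<close>

text \<open>Completeness and density become statements about distances, and the two decidability
  conditions become \<open>odec\<close>, so that instances can be verified without topology.\<close>

lemma rp_polish_iff:
  fixes X :: "'p rspace"
  shows "rp_polish X \<longleftrightarrow>
     Metric_space (pts X) (dst X) \<and>
     (\<forall>\<sigma> :: nat \<Rightarrow> 'p. range \<sigma> \<subseteq> pts X \<and> (\<forall>\<epsilon>>0. \<exists>N. \<forall>n\<ge>N. \<forall>n'\<ge>N. dst X (\<sigma> n) (\<sigma> n') < \<epsilon>) \<longrightarrow>
       (\<exists>x\<in>pts X. \<forall>\<epsilon>>0. \<exists>N. \<forall>n\<ge>N. dst X (\<sigma> n) x < \<epsilon>)) \<and>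
     range (pres X) \<subseteq> pts X \<and>
     (\<forall>x\<in>pts X. \<forall>\<epsilon>>0. \<exists>i. dst X x (pres X i) < \<epsilon>) \<and>
     odec (\<lambda>\<alpha>. dst X (pres X (\<alpha> 0)) (pres X (\<alpha> 1)) \<le> real (\<alpha> 2) / (real (\<alpha> 3) + 1)) \<and>
     odec (\<lambda>\<alpha>. dst X (pres X (\<alpha> 0)) (pres X (\<alpha> 1)) < real (\<alpha> 2) / (real (\<alpha> 3) + 1))"
proof (cases "Metric_space (pts X) (dst X)")
  case True
  interpret Metric_space "pts X" "dst X" by fact
  have complete: "mcomplete \<longleftrightarrow> (\<forall>\<sigma> :: nat \<Rightarrow> 'p. range \<sigma> \<subseteq> pts X \<and> (\<forall>\<epsilon>>0. \<exists>N. \<forall>n\<ge>N. \<forall>n'\<ge>N. dst X (\<sigma> n) (\<sigma> n') < \<epsilon>) \<longrightarrow>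
       (\<exists>x\<in>pts X. \<forall>\<epsilon>>0. \<exists>N. \<forall>n\<ge>N. dst X (\<sigma> n) x < \<epsilon>))"
  proof -
    have "MCauchy \<sigma> \<longleftrightarrow> range \<sigma> \<subseteq> pts X \<and> (\<forall>\<epsilon>>0. \<exists>N. \<forall>n\<ge>N. \<forall>n'\<ge>N. dst X (\<sigma> n) (\<sigma> n') < \<epsilon>)" for \<sigma>
      unfolding MCauchy_def by meson
    moreover have "(\<exists>x. limitin mtopology \<sigma> x sequentially) \<longleftrightarrow>
        (\<exists>x\<in>pts X. \<forall>\<epsilon>>0. \<exists>N. \<forall>n\<ge>N. dst X (\<sigma> n) x < \<epsilon>)" if "range \<sigma> \<subseteq> pts X" for \<sigma>
      using that by (auto simp: limitin_metric eventually_sequentially image_subset_iff)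
    ultimately have "(MCauchy \<sigma> \<longrightarrow> (\<exists>x. limitin mtopology \<sigma> x sequentially)) \<longleftrightarrow>
        (range \<sigma> \<subseteq> pts X \<and> (\<forall>\<epsilon>>0. \<exists>N. \<forall>n\<ge>N. \<forall>n'\<ge>N. dst X (\<sigma> n) (\<sigma> n') < \<epsilon>) \<longrightarrow>
         (\<exists>x\<in>pts X. \<forall>\<epsilon>>0. \<exists>N. \<forall>n\<ge>N. dst X (\<sigma> n) x < \<epsilon>))" for \<sigma>
      by (cases "range \<sigma> \<subseteq> pts X") (simp_all only: simp_thms)
    then show ?thesis
      unfolding mcomplete_def by simp
  qed
  have dense: "mtopology closure_of range (pres X) = pts X \<longleftrightarrow> (\<forall>x\<in>pts X. \<forall>\<epsilon>>0. \<exists>i. dst X x (pres X i) < \<epsilon>)"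
    if "range (pres X) \<subseteq> pts X"
    unfolding metric_closure_of set_eq_iff using that by (simp add: image_subset_iff) blast
  have rel: "recursive_rel4 R \<longleftrightarrow> odec (\<lambda>\<alpha>. R (\<alpha> 0) (\<alpha> 1) (\<alpha> 2) (\<alpha> 3))" for R
    using recursive_rel4_orec orec_recursive_rel4 by blast
  show ?thesis
    unfolding rp_polish_def complete rel using dense by blast
qed (simp add: rp_polish_def)

section \<open>Comparing distances with fractions; the spaces of numbers and sequences\<close>

lemma real_less_frac: "real a < real m / (real k + 1) \<longleftrightarrow> a * (k + 1) < m"
proof -
  have "real a < real m / (real k + 1) \<longleftrightarrow> real (a * (k + 1)) < real m"
    by (simp add: field_simps)
  then show ?thesis by (simp only: of_nat_less_iff)
qed

lemma real_le_frac: "real a \<le> real m / (real k + 1) \<longleftrightarrow> a * (k + 1) \<le> m"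
proof -
  have "real a \<le> real m / (real k + 1) \<longleftrightarrow> real (a * (k + 1)) \<le> real m"
    by (simp add: field_simps)
  then show ?thesis by (simp only: of_nat_le_iff)
qed

lemma abs_diff_nat: "\<bar>real a - real b\<bar> = real ((a - b) + (b - a))"
  by linarith

lemma Metric_space_omega: "Metric_space (pts omega) (dst omega)"
  by unfold_locales (auto simp: omega_def dist_commute dist_triangle)

lemma Metric_space_two: "Metric_space (pts two) (dst two)"
  by unfold_locales (auto simp: two_def dist_commute dist_triangle)

lemma rp_polish_omega: "rp_polish omega"
proof (subst rp_polish_iff, intro conjI allI impI ballI Metric_space_omega)
  fix \<sigma> :: "nat \<Rightarrow> 'a pt"
  assume \<sigma>: "range \<sigma> \<subseteq> pts omega \<and> (\<forall>\<epsilon>>0. \<exists>N. \<forall>n\<ge>N. \<forall>n'\<ge>N. dst omega (\<sigma> n) (\<sigma> n') < \<epsilon>)"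
  then obtain N where N: "\<And>n n'. n \<ge> N \<Longrightarrow> n' \<ge> N \<Longrightarrow> dst omega (\<sigma> n) (\<sigma> n') < 1"
    by (meson zero_less_one)
  have "\<sigma> n = \<sigma> N" if "n \<ge> N" for n
  proof -
    have "the_num (\<sigma> n) = the_num (\<sigma> N)"
      using N[OF that order.refl] by (simp add: omega_def dist_real_def)
    moreover have "\<sigma> n \<in> range NumP" "\<sigma> N \<in> range NumP"
      using \<sigma> by (auto simp: omega_def)
    ultimately show ?thesis by auto
  qed
  then have "dst omega (\<sigma> n) (\<sigma> N) = 0" if "n \<ge> N" for n
    using that by (metis dist_self omega_def rspace.select_convs(2))
  then have "\<forall>\<epsilon>>0. \<exists>N'. \<forall>n\<ge>N'. dst omega (\<sigma> n) (\<sigma> N) < \<epsilon>"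
    by (intro allI impI exI[of _ N]) simp
  moreover have "\<sigma> N \<in> pts omega" using \<sigma> by auto
  ultimately show "\<exists>x\<in>pts omega. \<forall>\<epsilon>>0. \<exists>N. \<forall>n\<ge>N. dst omega (\<sigma> n) x < \<epsilon>" by blast
next
  show "odec (\<lambda>\<alpha>. dst (omega :: 'a pt rspace) (pres omega (\<alpha> 0)) (pres omega (\<alpha> 1)) \<le> real (\<alpha> 2) / (real (\<alpha> 3) + 1))"
    by (simp only: omega_def rspace.simps pt.sel dist_real_def abs_diff_nat real_le_frac) (intro orec_intro)
  show "odec (\<lambda>\<alpha>. dst (omega :: 'a pt rspace) (pres omega (\<alpha> 0)) (pres omega (\<alpha> 1)) < real (\<alpha> 2) / (real (\<alpha> 3) + 1))"
    by (simp only: omega_def rspace.simps pt.sel dist_real_def abs_diff_nat real_less_frac) (intro orec_intro)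
next
  fix x :: "'a pt" and \<epsilon> :: real
  assume "x \<in> pts omega" "0 < \<epsilon>"
  then have "dst omega x (pres omega (the_num x)) < \<epsilon>"
    by (auto simp: omega_def)
  then show "\<exists>i. dst omega x (pres omega i) < \<epsilon>" ..
next
  show "range (pres omega) \<subseteq> pts omega"
    by (auto simp: omega_def)
qed

lemma baire_dist_neqE:
  assumes "\<alpha> \<noteq> \<beta>"
  obtains L where "baire_dist \<alpha> \<beta> = 1 / (real L + 1)" "\<alpha> L \<noteq> \<beta> L" "\<And>n. n < L \<Longrightarrow> \<alpha> n = \<beta> n"
proof
  let ?L = "LEAST n. \<alpha> n \<noteq> \<beta> n"
  show "baire_dist \<alpha> \<beta> = 1 / (real ?L + 1)"
    using assms by (simp add: baire_dist_def)
  have "\<exists>n. \<alpha> n \<noteq> \<beta> n"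
    using assms by (simp add: fun_eq_iff)
  then show "\<alpha> ?L \<noteq> \<beta> ?L"
    by (rule LeastI_ex)
  show "\<alpha> n = \<beta> n" if "n < ?L" for n
    using not_less_Least[OF that] by simp
qed

text \<open>The distance 1 / (L + 1) is below r iff each n with r \<le> 1 / (n + 1) comes before the
  first difference L. The multiplicative form becomes arithmetic of natural numbers once r is a
  fraction.\<close>

lemma baire_dist_less:
  "baire_dist \<alpha> \<beta> < r \<longleftrightarrow> 0 < r \<and> (\<forall>n. r * (real n + 1) \<le> 1 \<longrightarrow> \<alpha> n = \<beta> n)"
proof (cases "\<alpha> = \<beta>")
  case False
  then obtain L where d: "baire_dist \<alpha> \<beta> = 1 / (real L + 1)" and L: "\<alpha> L \<noteq> \<beta> L"
    and below: "\<And>n. n < L \<Longrightarrow> \<alpha> n = \<beta> n"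
    by (rule baire_dist_neqE) blast
  have "1 / (real L + 1) < r \<longleftrightarrow> 0 < r \<and> (\<forall>n. r * (real n + 1) \<le> 1 \<longrightarrow> \<alpha> n = \<beta> n)"
  proof
    assume less: "1 / (real L + 1) < r"
    have r: "0 < r" by (rule order.strict_trans[OF _ less]) simp
    have "n < L" if "r * (real n + 1) \<le> 1" for n
    proof -
      have "r * (real n + 1) < r * (real L + 1)"
        using that less by (simp add: field_simps)
      with r show ?thesis by simp
    qed
    with r below show "0 < r \<and> (\<forall>n. r * (real n + 1) \<le> 1 \<longrightarrow> \<alpha> n = \<beta> n)" by blast
  next
    assume "0 < r \<and> (\<forall>n. r * (real n + 1) \<le> 1 \<longrightarrow> \<alpha> n = \<beta> n)"
    then have "\<not> r * (real L + 1) \<le> 1" using L by blast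
    then show "1 / (real L + 1) < r" by (simp add: field_simps)
  qed
  then show ?thesis unfolding d .
qed (simp add: baire_dist_def)

lemma baire_dist_le:
  "baire_dist \<alpha> \<beta> \<le> r \<longleftrightarrow> 0 \<le> r \<and> (\<forall>n. r * (real n + 1) < 1 \<longrightarrow> \<alpha> n = \<beta> n)"
proof (cases "\<alpha> = \<beta>")
  case False
  then obtain L where d: "baire_dist \<alpha> \<beta> = 1 / (real L + 1)" and L: "\<alpha> L \<noteq> \<beta> L"
    and below: "\<And>n. n < L \<Longrightarrow> \<alpha> n = \<beta> n"
    by (rule baire_dist_neqE) blast
  have "1 / (real L + 1) \<le> r \<longleftrightarrow> 0 \<le> r \<and> (\<forall>n. r * (real n + 1) < 1 \<longrightarrow> \<alpha> n = \<beta> n)"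
  proof
    assume le: "1 / (real L + 1) \<le> r"
    have r: "0 < r" by (rule order.strict_trans2[OF _ le]) simp
    have "n < L" if "r * (real n + 1) < 1" for n
    proof -
      have "r * (real n + 1) < r * (real L + 1)"
        using that le by (simp add: field_simps)
      with r show ?thesis by simp
    qed
    with r below show "0 \<le> r \<and> (\<forall>n. r * (real n + 1) < 1 \<longrightarrow> \<alpha> n = \<beta> n)" by auto
  next
    assume "0 \<le> r \<and> (\<forall>n. r * (real n + 1) < 1 \<longrightarrow> \<alpha> n = \<beta> n)"
    then have "\<not> r * (real L + 1) < 1" using L by blast
    then show "1 / (real L + 1) \<le> r" by (simp add: field_simps)
  qed
  then show ?thesis unfolding d .
qed (simp add: baire_dist_def)

lemma baire_dist_nonneg: "0 \<le> baire_dist \<alpha> \<beta>"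
  by (simp add: baire_dist_def)

lemma baire_dist_commute: "baire_dist \<alpha> \<beta> = baire_dist \<beta> \<alpha>"
  by (auto simp: baire_dist_def intro!: arg_cong[where f = Least])

text \<open>For a fixed radius, \<open>baire_dist_less\<close> expresses agreement on a fixed set of
  positions, which is a transitive relation.\<close>

lemma baire_dist_ultra: "baire_dist \<alpha> \<gamma> \<le> max (baire_dist \<alpha> \<beta>) (baire_dist \<beta> \<gamma>)"
proof (rule ccontr)
  assume "\<not> ?thesis"
  then have "baire_dist \<alpha> \<beta> < baire_dist \<alpha> \<gamma>" "baire_dist \<beta> \<gamma> < baire_dist \<alpha> \<gamma>" by auto
  then have "baire_dist \<alpha> \<gamma> < baire_dist \<alpha> \<gamma>"
    using baire_dist_less[of \<alpha> \<beta> "baire_dist \<alpha> \<gamma>"] baire_dist_less[of \<beta> \<gamma> "baire_dist \<alpha> \<gamma>"]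
      baire_dist_less[of \<alpha> \<gamma> "baire_dist \<alpha> \<gamma>"] by metis
  then show False by simp
qed

lemma Metric_space_baire: "Metric_space (pts baire) (dst baire)"
proof
  show "dst baire x z \<le> dst baire x y + dst baire y z" for x y z :: "'a pt"
    using baire_dist_ultra[of "the_seq x" "the_seq z" "the_seq y"]
      baire_dist_nonneg[of "the_seq x" "the_seq y"] baire_dist_nonneg[of "the_seq y" "the_seq z"]
    by (simp add: baire_def)
  show "dst baire x y = 0 \<longleftrightarrow> x = y" if "x \<in> pts baire" "y \<in> pts baire" for x y :: "'a pt"
    using that by (auto simp: baire_def baire_dist_def split: if_splits)
qed (auto simp: baire_def baire_dist_nonneg baire_dist_commute)

lemma seq_nth_large: "u \<le> i \<Longrightarrow> seq_nth u i = 0"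
proof -
  assume "u \<le> i"
  then have "\<not> (0 < u \<and> nth_prime i dvd u)"
    using less_nth_prime[of i] dvd_imp_le[of "nth_prime i" u] by auto
  then show ?thesis unfolding seq_nth_eq by auto
qed

lemma frac_mult_less: "real m / (real k + 1) * (real n + 1) < 1 \<longleftrightarrow> m * (n + 1) < k + 1"
proof -
  have "real m / (real k + 1) * (real n + 1) < 1 \<longleftrightarrow> real (m * (n + 1)) < real (k + 1)"
    by (simp add: field_simps)
  then show ?thesis by (simp only: of_nat_less_iff)
qed

lemma frac_mult_le: "real m / (real k + 1) * (real n + 1) \<le> 1 \<longleftrightarrow> m * (n + 1) \<le> k + 1"
proof -
  have "real m / (real k + 1) * (real n + 1) \<le> 1 \<longleftrightarrow> real (m * (n + 1)) \<le> real (k + 1)"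
    by (simp add: field_simps)
  then show ?thesis by (simp only: of_nat_le_iff)
qed

lemma baire_dist_less_frac:
  "baire_dist \<alpha> \<beta> < real m / (real k + 1) \<longleftrightarrow> 0 < m \<and> (\<forall>n\<le>k. m * (n + 1) \<le> k + 1 \<longrightarrow> \<alpha> n = \<beta> n)"
proof -
  have "n \<le> k" if "0 < m" "m * (n + 1) \<le> k + 1" for n
  proof -
    have "n + 1 \<le> m * (n + 1)" using mult_le_mono1[of 1 m "n + 1"] that by simp
    with that show ?thesis by simp
  qed
  then show ?thesis
    unfolding baire_dist_less frac_mult_le by (auto simp: zero_less_divide_iff)
qed

text \<open>For \<open>m = 0\<close> this is equality of two sequences, so \<open>k\<close> gives no
  bound on \<open>n\<close>. The bound \<open>i + j\<close> works because the presented sequences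
  vanish from their codes on.\<close>

lemma baire_dist_le_frac:
  "baire_dist (seq_nth i) (seq_nth j) \<le> real m / (real k + 1)
    \<longleftrightarrow> (\<forall>n<i + j. m * (n + 1) < k + 1 \<longrightarrow> seq_nth i n = seq_nth j n)"
proof -
  have "seq_nth i n = seq_nth j n" if "\<not> n < i + j" for n
    using that by (simp add: seq_nth_large)
  then show ?thesis
    unfolding baire_dist_le frac_mult_less by auto
qed

lemma baire_dist_less_approx:
  assumes "0 < \<epsilon>"
  shows "\<exists>M. \<forall>\<alpha> \<beta>. (\<forall>i<M. \<alpha> i = \<beta> i) \<longrightarrow> baire_dist \<alpha> \<beta> < \<epsilon>"
proof (intro exI allI impI)
  fix \<alpha> \<beta> :: "nat \<Rightarrow> nat"
  assume eq: "\<forall>i<nat \<lceil>1 / \<epsilon>\<rceil>. \<alpha> i = \<beta> i"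
  have "n < nat \<lceil>1 / \<epsilon>\<rceil>" if "\<epsilon> * (real n + 1) \<le> 1" for n
  proof -
    have "real n + 1 \<le> 1 / \<epsilon>" using that assms by (simp add: field_simps)
    then show ?thesis by linarith
  qed
  then show "baire_dist \<alpha> \<beta> < \<epsilon>"
    unfolding baire_dist_less using eq assms by blast
qed

lemma rp_polish_baire: "rp_polish baire"
proof (subst rp_polish_iff, intro conjI allI impI ballI Metric_space_baire)
  fix \<sigma> :: "nat \<Rightarrow> 'a pt"
  assume \<sigma>: "range \<sigma> \<subseteq> pts baire \<and> (\<forall>\<epsilon>>0. \<exists>N. \<forall>n\<ge>N. \<forall>n'\<ge>N. dst baire (\<sigma> n) (\<sigma> n') < \<epsilon>)"
  define s where "s n = the_seq (\<sigma> n)" for n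
  have cauchy: "\<exists>N. \<forall>n\<ge>N. \<forall>n'\<ge>N. baire_dist (s n) (s n') < \<epsilon>" if "\<epsilon> > 0" for \<epsilon>
    using \<sigma> that by (simp add: baire_def s_def)
  have "\<exists>N. \<forall>p\<ge>N. \<forall>q\<ge>N. s p i = s q i" for i
  proof -
    obtain N where "\<forall>n\<ge>N. \<forall>n'\<ge>N. baire_dist (s n) (s n') < 1 / (real i + 1)"
      using cauchy[of "1 / (real i + 1)"] by auto
    then have "s p i = s q i" if "p \<ge> N" "q \<ge> N" for p q
      using that baire_dist_less[of "s p" "s q" "1 / (real i + 1)"] by simp
    then show ?thesis by blast
  qed
  then obtain N where N: "\<And>i p q. p \<ge> N i \<Longrightarrow> q \<ge> N i \<Longrightarrow> s p i = s q i"
    by metis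
  \<comment> \<open>Coordinate i is constant from \<open>N i\<close> on, and \<delta> takes this
    final value.\<close>
  define \<delta> where "\<delta> i = s (N i) i" for i
  have "\<exists>K. \<forall>n\<ge>K. dst baire (\<sigma> n) (SeqP \<delta>) < \<epsilon>" if \<epsilon>: "\<epsilon> > 0" for \<epsilon>
  proof -
    obtain K where K: "\<And>p q. p \<ge> K \<Longrightarrow> q \<ge> K \<Longrightarrow> baire_dist (s p) (s q) < \<epsilon>"
      using cauchy[OF \<epsilon>] by blast
    have "s p i = \<delta> i" if "p \<ge> K" "\<epsilon> * (real i + 1) \<le> 1" for p i
    proof -
      \<comment> \<open>The intermediate index lets K depend on \<epsilon> only, although
        \<open>N i\<close> depends on the coordinate.\<close>
      have "s p i = s (max K (N i)) i"
        using K[OF that(1), of "max K (N i)"] that(2) unfolding baire_dist_less by auto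
      also have "\<dots> = \<delta> i"
        unfolding \<delta>_def by (rule N) auto
      finally show ?thesis .
    qed
    then have "baire_dist (s p) \<delta> < \<epsilon>" if "p \<ge> K" for p
      unfolding baire_dist_less using \<epsilon> that by blast
    then show ?thesis by (auto simp: baire_def s_def)
  qed
  moreover have "SeqP \<delta> \<in> pts baire" by (simp add: baire_def)
  ultimately show "\<exists>x\<in>pts baire. \<forall>\<epsilon>>0. \<exists>N. \<forall>n\<ge>N. dst baire (\<sigma> n) x < \<epsilon>" by blast
next
  fix x :: "'a pt" and \<epsilon> :: real
  assume "x \<in> pts baire" "0 < \<epsilon>"
  then obtain \<alpha> where "x = SeqP \<alpha>"
    by (auto simp: baire_def)
  moreover obtain M where "\<forall>\<alpha> \<beta>. (\<forall>i<M. \<alpha> i = \<beta> i) \<longrightarrow> baire_dist \<alpha> \<beta> < \<epsilon>"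
    using baire_dist_less_approx[OF \<open>0 < \<epsilon>\<close>] by blast
  moreover obtain u where "\<forall>i<M. seq_nth u i = \<alpha> i"
    using ex_seq_nth[of M \<alpha>] by blast
  ultimately have "dst baire x (pres baire u) < \<epsilon>"
    by (simp add: baire_def)
  then show "\<exists>i. dst baire x (pres baire i) < \<epsilon>" ..
next
  show "odec (\<lambda>\<alpha>. dst (baire :: 'a pt rspace) (pres baire (\<alpha> 0)) (pres baire (\<alpha> 1)) \<le> real (\<alpha> 2) / (real (\<alpha> 3) + 1))"
    by (simp only: baire_def rspace.simps pt.sel baire_dist_le_frac) (intro orec_intro)
  show "odec (\<lambda>\<alpha>. dst (baire :: 'a pt rspace) (pres baire (\<alpha> 0)) (pres baire (\<alpha> 1)) < real (\<alpha> 2) / (real (\<alpha> 3) + 1))"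
    by (simp only: baire_def rspace.simps pt.sel baire_dist_less_frac) (intro orec_intro)
next
  show "range (pres baire) \<subseteq> pts baire"
    by (auto simp: baire_def)
qed

section \<open>Products with the maximum metric\<close>

lemma rprod_simps:
  "pts (X \<otimes>\<^sub>r Y) = {PairP x y |x y. x \<in> pts X \<and> y \<in> pts Y}"
  "dst (X \<otimes>\<^sub>r Y) p q = max (dst X (pt_fst p) (pt_fst q)) (dst Y (pt_snd p) (pt_snd q))"
  "pres (X \<otimes>\<^sub>r Y) i = PairP (pres X (seq_nth i 0)) (pres Y (seq_nth i 1))"
  by (simp_all add: rprod_def)

lemma Metric_space_rprod:
  assumes "Metric_space (pts X) (dst X)" "Metric_space (pts Y) (dst Y)"
  shows "Metric_space (pts (X \<otimes>\<^sub>r Y)) (dst (X \<otimes>\<^sub>r Y))"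
proof -
  interpret X: Metric_space "pts X" "dst X" by fact
  interpret Y: Metric_space "pts Y" "dst Y" by fact
  show ?thesis
  proof
    fix x y z :: "'a pt"
    show "0 \<le> dst (X \<otimes>\<^sub>r Y) x y"
      by (simp add: rprod_simps le_max_iff_disj)
    show "dst (X \<otimes>\<^sub>r Y) x y = dst (X \<otimes>\<^sub>r Y) y x"
      by (simp add: rprod_simps X.commute Y.commute)
    assume x: "x \<in> pts (X \<otimes>\<^sub>r Y)" and y: "y \<in> pts (X \<otimes>\<^sub>r Y)"
    show "dst (X \<otimes>\<^sub>r Y) x y = 0 \<longleftrightarrow> x = y"
    proof -
      have "max a b = 0 \<longleftrightarrow> a = 0 \<and> b = 0" if "0 \<le> a" "0 \<le> b" for a b :: real
        using that by linarith
      then show ?thesis using x y by (auto simp: rprod_simps)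
    qed
    assume z: "z \<in> pts (X \<otimes>\<^sub>r Y)"
    have "dst X (pt_fst x) (pt_fst z) \<le> dst X (pt_fst x) (pt_fst y) + dst X (pt_fst y) (pt_fst z)"
      "dst Y (pt_snd x) (pt_snd z) \<le> dst Y (pt_snd x) (pt_snd y) + dst Y (pt_snd y) (pt_snd z)"
      using x y z by (auto simp: rprod_simps intro: X.triangle Y.triangle)
    then show "dst (X \<otimes>\<^sub>r Y) x z \<le> dst (X \<otimes>\<^sub>r Y) x y + dst (X \<otimes>\<^sub>r Y) y z"
      unfolding rprod_simps by linarith
  qed
qed

lemma rp_polish_rprod:
  assumes "rp_polish X" "rp_polish Y"
  shows "rp_polish (X \<otimes>\<^sub>r Y)"
proof -
  note X = assms(1)[unfolded rp_polish_iff] and Y = assms(2)[unfolded rp_polish_iff]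
  show ?thesis
  proof (subst rp_polish_iff, intro conjI allI impI ballI Metric_space_rprod)
    fix \<sigma> :: "nat \<Rightarrow> 'a pt"
    assume \<sigma>: "range \<sigma> \<subseteq> pts (X \<otimes>\<^sub>r Y) \<and> (\<forall>\<epsilon>>0. \<exists>N. \<forall>n\<ge>N. \<forall>n'\<ge>N. dst (X \<otimes>\<^sub>r Y) (\<sigma> n) (\<sigma> n') < \<epsilon>)"
    then have "\<forall>n. \<sigma> n \<in> pts (X \<otimes>\<^sub>r Y)"
      by blast
    then have "pt_fst (\<sigma> n) \<in> pts X" "pt_snd (\<sigma> n) \<in> pts Y" for n
      by (auto simp: rprod_simps dest!: spec[of _ n])
    then have "range (\<lambda>n. pt_fst (\<sigma> n)) \<subseteq> pts X" "range (\<lambda>n. pt_snd (\<sigma> n)) \<subseteq> pts Y"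
      by blast+
    moreover have "\<forall>\<epsilon>>0. \<exists>N. \<forall>n\<ge>N. \<forall>n'\<ge>N. dst X (pt_fst (\<sigma> n)) (pt_fst (\<sigma> n')) < \<epsilon>"
      "\<forall>\<epsilon>>0. \<exists>N. \<forall>n\<ge>N. \<forall>n'\<ge>N. dst Y (pt_snd (\<sigma> n)) (pt_snd (\<sigma> n')) < \<epsilon>"
      using \<sigma> unfolding rprod_simps max_less_iff_conj by meson+
    ultimately have
      "\<exists>x\<in>pts X. \<forall>\<epsilon>>0. \<exists>N. \<forall>n\<ge>N. dst X (pt_fst (\<sigma> n)) x < \<epsilon>"
      "\<exists>y\<in>pts Y. \<forall>\<epsilon>>0. \<exists>N. \<forall>n\<ge>N. dst Y (pt_snd (\<sigma> n)) y < \<epsilon>"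
      using X[THEN conjunct2, THEN conjunct1, THEN spec, of "\<lambda>n. pt_fst (\<sigma> n)"]
        Y[THEN conjunct2, THEN conjunct1, THEN spec, of "\<lambda>n. pt_snd (\<sigma> n)"] by blast+
    then obtain x y where x: "x \<in> pts X" "\<And>\<epsilon>. \<epsilon> > 0 \<Longrightarrow> \<exists>N. \<forall>n\<ge>N. dst X (pt_fst (\<sigma> n)) x < \<epsilon>"
      and y: "y \<in> pts Y" "\<And>\<epsilon>. \<epsilon> > 0 \<Longrightarrow> \<exists>N. \<forall>n\<ge>N. dst Y (pt_snd (\<sigma> n)) y < \<epsilon>"
      by blast
    have "\<exists>N. \<forall>n\<ge>N. dst (X \<otimes>\<^sub>r Y) (\<sigma> n) (PairP x y) < \<epsilon>" if \<epsilon>: "\<epsilon> > 0" for \<epsilon>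
    proof -
      obtain N M where "\<forall>n\<ge>N. dst X (pt_fst (\<sigma> n)) x < \<epsilon>" "\<forall>n\<ge>M. dst Y (pt_snd (\<sigma> n)) y < \<epsilon>"
        using x(2)[OF \<epsilon>] y(2)[OF \<epsilon>] by blast
      then show ?thesis
        by (intro exI[of _ "max N M"]) (simp add: rprod_simps)
    qed
    moreover have "PairP x y \<in> pts (X \<otimes>\<^sub>r Y)"
      using x y by (simp add: rprod_simps)
    ultimately show "\<exists>x\<in>pts (X \<otimes>\<^sub>r Y). \<forall>\<epsilon>>0. \<exists>N. \<forall>n\<ge>N. dst (X \<otimes>\<^sub>r Y) (\<sigma> n) x < \<epsilon>"
      by blast
  next
    show "range (pres (X \<otimes>\<^sub>r Y)) \<subseteq> pts (X \<otimes>\<^sub>r Y)"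
      using X Y by (auto simp: rprod_simps image_subset_iff)
  next
    fix p :: "'a pt" and \<epsilon> :: real
    assume "p \<in> pts (X \<otimes>\<^sub>r Y)" and \<epsilon>: "0 < \<epsilon>"
    then obtain x y where p: "p = PairP x y" "x \<in> pts X" "y \<in> pts Y"
      by (auto simp: rprod_simps)
    obtain i j where "dst X x (pres X i) < \<epsilon>" "dst Y y (pres Y j) < \<epsilon>"
      using X Y p \<epsilon> by meson
    then have "dst (X \<otimes>\<^sub>r Y) p (pres (X \<otimes>\<^sub>r Y) (seq_code [i, j])) < \<epsilon>"
      by (simp add: rprod_simps p)
    then show "\<exists>i. dst (X \<otimes>\<^sub>r Y) p (pres (X \<otimes>\<^sub>r Y) i) < \<epsilon>" ..
  next
    note sub = orec_num4[where f = "\<lambda>i j m k. of_bool (R i j m k)" for R]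
    have "odec (\<lambda>\<alpha>. dst X (pres X (seq_nth (\<alpha> 0) 0)) (pres X (seq_nth (\<alpha> 1) 0)) \<le> real (\<alpha> 2) / (real (\<alpha> 3) + 1))"
      by (rule sub) (use X in blast, (intro orec_intro)+)
    moreover have "odec (\<lambda>\<alpha>. dst Y (pres Y (seq_nth (\<alpha> 0) 1)) (pres Y (seq_nth (\<alpha> 1) 1)) \<le> real (\<alpha> 2) / (real (\<alpha> 3) + 1))"
      by (rule sub) (use Y in blast, (intro orec_intro)+)
    ultimately show "odec (\<lambda>\<alpha>. dst (X \<otimes>\<^sub>r Y) (pres (X \<otimes>\<^sub>r Y) (\<alpha> 0)) (pres (X \<otimes>\<^sub>r Y) (\<alpha> 1)) \<le> real (\<alpha> 2) / (real (\<alpha> 3) + 1))"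
      unfolding rprod_simps pt.sel max.bounded_iff by (rule odec_conj)
    have "odec (\<lambda>\<alpha>. dst X (pres X (seq_nth (\<alpha> 0) 0)) (pres X (seq_nth (\<alpha> 1) 0)) < real (\<alpha> 2) / (real (\<alpha> 3) + 1))"
      by (rule sub) (use X in blast, (intro orec_intro)+)
    moreover have "odec (\<lambda>\<alpha>. dst Y (pres Y (seq_nth (\<alpha> 0) 1)) (pres Y (seq_nth (\<alpha> 1) 1)) < real (\<alpha> 2) / (real (\<alpha> 3) + 1))"
      by (rule sub) (use Y in blast, (intro orec_intro)+)
    ultimately show "odec (\<lambda>\<alpha>. dst (X \<otimes>\<^sub>r Y) (pres (X \<otimes>\<^sub>r Y) (\<alpha> 0)) (pres (X \<otimes>\<^sub>r Y) (\<alpha> 1)) < real (\<alpha> 2) / (real (\<alpha> 3) + 1))"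
      unfolding rprod_simps pt.sel max_less_iff_conj by (rule odec_conj)
  qed (use X Y in blast)+
qed

text \<open>A ball given by three separate numbers. In a product it splits into balls of the same
  radius around the coordinates of the centre, which the single code in \<open>nbhd\<close>
  hides.\<close>

definition in_ball :: "'p rspace \<Rightarrow> nat \<Rightarrow> nat \<Rightarrow> nat \<Rightarrow> 'p \<Rightarrow> bool" where
  "in_ball X c m q x \<longleftrightarrow> x \<in> pts X \<and> dst X (pres X c) x < real m / (real q + 1)"

lemma in_nbhd_iff:
  assumes "Metric_space (pts X) (dst X)" "range (pres X) \<subseteq> pts X"
  shows "x \<in> nbhd X s \<longleftrightarrow> in_ball X (seq_nth s 0) (seq_nth s 1) (seq_nth s 2) x"
  unfolding nbhd_def in_ball_def using assms(2) by (auto simp: Metric_space.in_mball[OF assms(1)])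

lemma in_ball_rprod [simp]:
  "in_ball (X \<otimes>\<^sub>r Y) c m q (PairP x y) \<longleftrightarrow>
    in_ball X (seq_nth c 0) m q x \<and> in_ball Y (seq_nth c 1) m q y"
  by (auto simp: in_ball_def rprod_simps)

lemma in_ball_omega [simp]:
  "in_ball omega c m q (NumP n) \<longleftrightarrow> ((c - n) + (n - c)) * (q + 1) < m"
  unfolding in_ball_def omega_def rspace.simps pt.sel dist_real_def abs_diff_nat real_less_frac by simp

lemma in_ball_two [simp]:
  "in_ball two c m q (NumP n) \<longleftrightarrow> n \<le> 1 \<and> ((min c 1 - n) + (n - min c 1)) * (q + 1) < m"
  unfolding in_ball_def two_def rspace.simps pt.sel dist_real_def abs_diff_nat real_less_frac by auto

lemma in_ball_baire [simp]:
  "in_ball baire c m q (SeqP \<alpha>) \<longleftrightarrow>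
    0 < m \<and> (\<forall>n\<le>q. m * (n + 1) \<le> q + 1 \<longrightarrow> seq_nth c n = \<alpha> n)"
  unfolding in_ball_def baire_def rspace.simps pt.sel baire_dist_less_frac by simp

lemma presentation_range:
  "range (pres omega) \<subseteq> pts omega" "range (pres two) \<subseteq> pts two" "range (pres baire) \<subseteq> pts baire"
  by (auto simp: omega_def two_def baire_def)

lemma presentation_range_rprod:
  "range (pres X) \<subseteq> pts X \<Longrightarrow> range (pres Y) \<subseteq> pts Y \<Longrightarrow> range (pres (X \<otimes>\<^sub>r Y)) \<subseteq> pts (X \<otimes>\<^sub>r Y)"
  by (auto simp: rprod_simps image_subset_iff)

section \<open>Semirecursive relations and \<open>\<Sigma>\<^sup>0\<^sub>1\<close> sets\<close>

lemma orec_apply1: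
  assumes "orec (\<lambda>\<alpha>. f (\<alpha> 0) (shift \<alpha>))" "orec g" "orec (\<lambda>\<alpha>. h (\<alpha> 0) (shift \<alpha>))"
  shows "orec (\<lambda>\<alpha>. f (g \<alpha>) (\<lambda>x. h x \<alpha>))"
proof -
  have "orec (\<lambda>\<alpha>. (\<lambda>\<beta>. f (\<beta> 0) (shift \<beta>)) (\<lambda>x. case_nat (g \<alpha>) (\<lambda>y. h y \<alpha>) x))"
  proof (rule orec_subst[OF assms(1)], rule orec_case_nat)
    have "orec (\<lambda>\<alpha>. (\<lambda>\<beta>. h (\<beta> 0) (shift \<beta>)) (\<lambda>x. case_nat (\<alpha> 0) (\<lambda>y. shift (shift \<alpha>) y) x))"
      by (rule orec_subst[OF assms(3)]) (intro orec_intro)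
    then show "orec (\<lambda>\<alpha>. h (\<alpha> 0) (shift (shift \<alpha>)))"
      by simp
  qed (intro orec_shifts(1)[OF assms(2)] orec_intro)+
  then show ?thesis by simp
qed

text \<open>The semirecursive relations of a sequence, as projections of decidable relations along a
  number.\<close>

definition semi :: "((nat \<Rightarrow> nat) \<Rightarrow> bool) \<Rightarrow> bool" where
  "semi R \<longleftrightarrow> (\<exists>T. odec (\<lambda>\<alpha>. T (\<alpha> 0) (shift \<alpha>)) \<and> (\<forall>\<alpha>. R \<alpha> \<longleftrightarrow> (\<exists>t. T t \<alpha>)))"

lemma semiI: "odec (\<lambda>\<alpha>. T (\<alpha> 0) (shift \<alpha>)) \<Longrightarrow> (\<And>\<alpha>. R \<alpha> \<longleftrightarrow> (\<exists>t. T t \<alpha>)) \<Longrightarrow> semi R"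
  unfolding semi_def by blast

lemma semiE:
  assumes "semi R"
  obtains T where "odec (\<lambda>\<alpha>. T (\<alpha> 0) (shift \<alpha>))" "\<And>\<alpha>. R \<alpha> \<longleftrightarrow> (\<exists>t. T t \<alpha>)"
  using assms unfolding semi_def by blast

lemma semi_odec: "odec P \<Longrightarrow> semi P"
  by (rule semiI[where T = "\<lambda>t. P"]) (rule orec_shift, auto)

lemma semi_conj:
  assumes "semi P" "semi Q"
  shows "semi (\<lambda>\<alpha>. P \<alpha> \<and> Q \<alpha>)"
proof -
  obtain S where S: "odec (\<lambda>\<alpha>. S (\<alpha> 0) (shift \<alpha>))" "\<And>\<alpha>. P \<alpha> \<longleftrightarrow> (\<exists>t. S t \<alpha>)"
    using assms(1) by (rule semiE) blast
  obtain T where T: "odec (\<lambda>\<alpha>. T (\<alpha> 0) (shift \<alpha>))" "\<And>\<alpha>. Q \<alpha> \<longleftrightarrow> (\<exists>t. T t \<alpha>)"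
    using assms(2) by (rule semiE) blast
  show ?thesis
  proof (rule semiI)
    have "odec (\<lambda>\<alpha>. S (seq_nth (\<alpha> 0) 0) (shift \<alpha>))" "odec (\<lambda>\<alpha>. T (seq_nth (\<alpha> 0) 1) (shift \<alpha>))"
      by (rule orec_apply1[where f = "\<lambda>k \<beta>. of_bool (S k \<beta>)" and h = "\<lambda>x \<alpha>. shift \<alpha> x", OF S(1)]
        orec_apply1[where f = "\<lambda>k \<beta>. of_bool (T k \<beta>)" and h = "\<lambda>x \<alpha>. shift \<alpha> x", OF T(1)]; intro orec_intro)+
    then show "odec (\<lambda>\<alpha>. S (seq_nth (\<alpha> 0) 0) (shift \<alpha>) \<and> T (seq_nth (\<alpha> 0) 1) (shift \<alpha>))"
      by (rule odec_conj)
    show "P \<alpha> \<and> Q \<alpha> \<longleftrightarrow> (\<exists>t. S (seq_nth t 0) \<alpha> \<and> T (seq_nth t 1) \<alpha>)" for \<alpha>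
    proof
      assume "P \<alpha> \<and> Q \<alpha>"
      then obtain s t where "S s \<alpha>" "T t \<alpha>" using S(2) T(2) by blast
      then show "\<exists>t. S (seq_nth t 0) \<alpha> \<and> T (seq_nth t 1) \<alpha>"
        by (intro exI[of _ "seq_code [s, t]"]) simp
    qed (use S(2) T(2) in blast)
  qed
qed

lemma semi_disj:
  assumes "semi P" "semi Q"
  shows "semi (\<lambda>\<alpha>. P \<alpha> \<or> Q \<alpha>)"
proof -
  obtain S where S: "odec (\<lambda>\<alpha>. S (\<alpha> 0) (shift \<alpha>))" "\<And>\<alpha>. P \<alpha> \<longleftrightarrow> (\<exists>t. S t \<alpha>)"
    using assms(1) by (rule semiE) blast
  obtain T where T: "odec (\<lambda>\<alpha>. T (\<alpha> 0) (shift \<alpha>))" "\<And>\<alpha>. Q \<alpha> \<longleftrightarrow> (\<exists>t. T t \<alpha>)"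
    using assms(2) by (rule semiE) blast
  show ?thesis
    by (rule semiI[where T = "\<lambda>t \<alpha>. S t \<alpha> \<or> T t \<alpha>"]) (intro odec_disj S(1) T(1), use S(2) T(2) in blast)
qed

lemma semi_ex:
  assumes "semi (\<lambda>\<alpha>. P (\<alpha> 0) (shift \<alpha>))"
  shows "semi (\<lambda>\<alpha>. \<exists>k. P k \<alpha>)"
proof -
  obtain T where T: "odec (\<lambda>\<alpha>. T (\<alpha> 0) (shift \<alpha>))" "\<And>\<alpha>. P (\<alpha> 0) (shift \<alpha>) \<longleftrightarrow> (\<exists>t. T t \<alpha>)"
    using assms by (rule semiE) blast
  have P: "P k \<alpha> \<longleftrightarrow> (\<exists>t. T t (case_nat k \<alpha>))" for k \<alpha>
    using T(2)[of "case_nat k \<alpha>"] by simp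
  show ?thesis
  proof (rule semiI)
    show "odec (\<lambda>\<alpha>. T (seq_nth (\<alpha> 0) 1) (\<lambda>x. case_nat (seq_nth (\<alpha> 0) 0) (\<lambda>y. shift \<alpha> y) x))"
      by (rule orec_apply1[where f = "\<lambda>k \<beta>. of_bool (T k \<beta>)", OF T(1)]; intro orec_intro)
    show "(\<exists>k. P k \<alpha>) \<longleftrightarrow> (\<exists>t. T (seq_nth t 1) (\<lambda>x. case_nat (seq_nth t 0) (\<lambda>y. \<alpha> y) x))" for \<alpha>
    proof
      assume "\<exists>k. P k \<alpha>"
      then obtain k t where "T t (case_nat k \<alpha>)" using P by blast
      then show "\<exists>t. T (seq_nth t 1) (\<lambda>x. case_nat (seq_nth t 0) (\<lambda>y. \<alpha> y) x)"
        by (intro exI[of _ "seq_code [k, t]"]) (simp cong: nat.case_cong)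
    qed (use P in auto)
  qed
qed

text \<open>The finitely many witnesses, one for each k below the bound, are stored as the entries
  of one number.\<close>

lemma semi_ball:
  assumes "orec b" "semi (\<lambda>\<alpha>. P (\<alpha> 0) (shift \<alpha>))"
  shows "semi (\<lambda>\<alpha>. \<forall>k<b \<alpha>. P k \<alpha>)"
proof -
  obtain T where T: "odec (\<lambda>\<alpha>. T (\<alpha> 0) (shift \<alpha>))" "\<And>\<alpha>. P (\<alpha> 0) (shift \<alpha>) \<longleftrightarrow> (\<exists>t. T t \<alpha>)"
    using assms(2) by (rule semiE) blast
  have P: "P k \<alpha> \<longleftrightarrow> (\<exists>t. T t (case_nat k \<alpha>))" for k \<alpha>
    using T(2)[of "case_nat k \<alpha>"] by simp
  show ?thesis
  proof (rule semiI)
    show "odec (\<lambda>\<alpha>. \<forall>k<b (shift \<alpha>). T (seq_nth (\<alpha> 0) k) (\<lambda>x. case_nat k (\<lambda>y. shift \<alpha> y) x))"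
    proof (rule odec_ball[OF orec_shift[OF assms(1)]])
      show "odec (\<lambda>\<alpha>. T (seq_nth (shift \<alpha> 0) (\<alpha> 0)) (\<lambda>x. case_nat (\<alpha> 0) (\<lambda>y. shift (shift \<alpha>) y) x))"
        by (rule orec_apply1[where f = "\<lambda>k \<beta>. of_bool (T k \<beta>)", OF T(1)]; intro orec_intro)
    qed
    show "(\<forall>k<b \<alpha>. P k \<alpha>) \<longleftrightarrow> (\<exists>t. \<forall>k<b \<alpha>. T (seq_nth t k) (\<lambda>x. case_nat k (\<lambda>y. \<alpha> y) x))" for \<alpha>
    proof
      assume "\<forall>k<b \<alpha>. P k \<alpha>"
      then have "\<forall>k. \<exists>t. k < b \<alpha> \<longrightarrow> T t (case_nat k \<alpha>)" using P by blast
      then obtain f where "\<forall>k. k < b \<alpha> \<longrightarrow> T (f k) (case_nat k \<alpha>)" by metis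
      moreover obtain t where "\<forall>k<b \<alpha>. seq_nth t k = f k"
        using ex_seq_nth[of "b \<alpha>" f] by blast
      ultimately show "\<exists>t. \<forall>k<b \<alpha>. T (seq_nth t k) (\<lambda>x. case_nat k (\<lambda>y. \<alpha> y) x)"
        by (intro exI[of _ t]) simp
    qed (use P in auto)
  qed
qed

lemma semi_apply2:
  assumes "semi (\<lambda>\<alpha>. R (\<alpha> 0) (\<alpha> 1) (shift (shift \<alpha>)))" and g: "orec g" "orec g'"
    and h: "orec (\<lambda>\<alpha>. h (\<alpha> 0) (shift \<alpha>))"
  shows "semi (\<lambda>\<alpha>. R (g \<alpha>) (g' \<alpha>) (\<lambda>x. h x \<alpha>))"
proof -
  obtain T where T: "odec (\<lambda>\<alpha>. T (\<alpha> 0) (shift \<alpha>))"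
    "\<And>\<alpha>. R (\<alpha> 0) (\<alpha> 1) (shift (shift \<alpha>)) \<longleftrightarrow> (\<exists>t. T t \<alpha>)"
    using assms(1) by (rule semiE) blast
  have R: "R i j \<alpha> \<longleftrightarrow> (\<exists>t. T t (case_nat i (case_nat j \<alpha>)))" for i j \<alpha>
    using T(2)[of "case_nat i (case_nat j \<alpha>)"] by simp
  show ?thesis
  proof (rule semiI)
    show "odec (\<lambda>\<alpha>. T (\<alpha> 0) (\<lambda>x. case_nat (g (shift \<alpha>)) (\<lambda>y. case_nat (g' (shift \<alpha>)) (\<lambda>z. h z (shift \<alpha>)) y) x))"
    proof (rule orec_apply1[where f = "\<lambda>k \<beta>. of_bool (T k \<beta>)", OF T(1)])
      have "orec (\<lambda>\<alpha>. h (\<alpha> 0) (shift (shift (shift (shift \<alpha>)))))"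
        by (rule orec_apply1[where f = h and h = "\<lambda>x \<alpha>. shift (shift (shift (shift \<alpha>))) x", OF h]) (intro orec_intro)+
      then show "orec (\<lambda>\<alpha>. case_nat (g (shift (shift \<alpha>)))
          (\<lambda>y. case_nat (g' (shift (shift \<alpha>))) (\<lambda>z. h z (shift (shift \<alpha>))) y) (\<alpha> 0))"
        by (intro orec_case_nat orec_shifts[OF g(1)] orec_shifts[OF g(2)] orec_app orec_const)
    qed (intro orec_intro)
    show "R (g \<alpha>) (g' \<alpha>) (\<lambda>x. h x \<alpha>) \<longleftrightarrow>
        (\<exists>t. T t (\<lambda>x. case_nat (g \<alpha>) (\<lambda>y. case_nat (g' \<alpha>) (\<lambda>z. h z \<alpha>) y) x))" for \<alpha>
      using R by simp
  qed
qed

text \<open>A witness for \<open>R\<close> depends on finitely many values of \<gamma>, so the set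
  is a union of cylinders. Here \<open>x\<close> codes all number coordinates of the point
  \<open>\<phi> x \<gamma>\<close>, and \<open>c x s m\<close> is a neighbourhood that fixes them
  together with the first m values of \<gamma>.\<close>

lemma Sigma01I:
  fixes \<phi> :: "nat \<Rightarrow> (nat \<Rightarrow> nat) \<Rightarrow> 'p" and W :: "'p rspace"
  assumes R: "semi (\<lambda>\<alpha>. R (\<alpha> 0) (shift \<alpha>))"
    and ok: "odec (\<lambda>\<alpha>. ok (\<alpha> 0))"
    and c: "orec (\<lambda>\<alpha>. c (\<alpha> 0) (\<alpha> 1) (\<alpha> 2))"
    and nbhd_c: "\<And>x s m. ok x \<Longrightarrow> 0 < m \<Longrightarrow> nbhd W (c x s m) = {\<phi> x \<gamma> |\<gamma>. \<forall>i<m. \<gamma> i = seq_nth s i}"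
    and nbhd_0: "nbhd W 0 = {}"
  shows "Sigma01 W {\<phi> x \<gamma> |x \<gamma>. ok x \<and> R x \<gamma>}"
proof -
  obtain T where T: "odec (\<lambda>\<alpha>. T (\<alpha> 0) (shift \<alpha>))" "\<And>\<alpha>. R (\<alpha> 0) (shift \<alpha>) \<longleftrightarrow> (\<exists>t. T t \<alpha>)"
    using R by (rule semiE) blast
  have R_iff: "R x \<gamma> \<longleftrightarrow> (\<exists>t. T t (case_nat x \<gamma>))" for x \<gamma>
    using T(2)[of "case_nat x \<gamma>"] by simp
  obtain a where a: "approx (\<lambda>\<alpha>. of_bool (T (\<alpha> 0) (shift \<alpha>))) a"
    using ex_approx[OF T(1)] by blast
  let ?env = "\<lambda>t x \<gamma>. case_nat t (case_nat x \<gamma>)"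
  \<comment> \<open>2 is \<open>Suc (of_bool True)\<close>: the finite part s already confirms
    \<open>T\<close>. Two numbers stand in front of it, hence \<open>Suc (Suc m)\<close>. Quadruples
    that fail the test contribute neighbourhood 0, which is empty.\<close>
  define A where "A t x s m \<longleftrightarrow> ok x \<and> 0 < m \<and> a (Suc (Suc m)) (?env t x (seq_nth s)) = 2" for t x s m
  define \<epsilon> where "\<epsilon> w = (if A (seq_nth w 0) (seq_nth w 1) (seq_nth w 2) (seq_nth w 3)
    then c (seq_nth w 1) (seq_nth w 2) (seq_nth w 3) else 0)" for w
  have "orec (\<lambda>\<alpha>. \<epsilon> (\<alpha> 0))"
    unfolding \<epsilon>_def A_def
  proof (intro orec_if odec_conj odec_eq odec_less orec_const)
    have "orec (\<lambda>\<alpha>. a (Suc (Suc (seq_nth (\<alpha> 0) 3))) (\<lambda>i. case_nat (seq_nth (\<alpha> 0) 0)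
        (\<lambda>i. case_nat (seq_nth (\<alpha> 0) 1) (\<lambda>j. seq_nth (seq_nth (\<alpha> 0) 2) j) i) i))"
      by (rule orec_apply1[OF approx_orec[OF a]]; intro orec_intro)
    then show "orec (\<lambda>\<alpha>. a (Suc (Suc (seq_nth (\<alpha> 0) 3)))
        (?env (seq_nth (\<alpha> 0) 0) (seq_nth (\<alpha> 0) 1) (seq_nth (seq_nth (\<alpha> 0) 2))))"
      by (simp cong: nat.case_cong)
    show "odec (\<lambda>\<alpha>. ok (seq_nth (\<alpha> 0) 1))"
      by (rule orec_num1[where f = "\<lambda>k. of_bool (ok k)", OF ok]) (intro orec_intro)
    show "orec (\<lambda>\<alpha>. c (seq_nth (\<alpha> 0) 1) (seq_nth (\<alpha> 0) 2) (seq_nth (\<alpha> 0) 3))"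
      by (rule orec_num3[where f = c, OF c]; intro orec_intro)
  qed (intro orec_intro)
  then have rec: "recursive_seq \<epsilon>"
    by (rule recursive_seq_orec)
  have "{\<phi> x \<gamma> |x \<gamma>. ok x \<and> R x \<gamma>} = (\<Union>w. nbhd W (\<epsilon> w))"
  proof (intro equalityI subsetI)
    fix p assume "p \<in> {\<phi> x \<gamma> |x \<gamma>. ok x \<and> R x \<gamma>}"
    then obtain x \<gamma> t where p: "p = \<phi> x \<gamma>" "ok x" "T t (case_nat x \<gamma>)"
      using R_iff by blast
    obtain M where M: "\<And>m. m \<ge> M \<Longrightarrow> a m (?env t x \<gamma>) = 2"
      using approx_eventually[OF a, of "?env t x \<gamma>"] p(3)
      unfolding eventually_sequentially by (auto simp: numeral_2_eq_2)
    obtain s where s: "\<forall>i<Suc M. seq_nth s i = \<gamma> i"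
      using ex_seq_nth[of "Suc M" \<gamma>] by blast
    have "a (Suc (Suc (Suc M))) (?env t x (seq_nth s)) = a (Suc (Suc (Suc M))) (?env t x \<gamma>)"
      by (rule approx_local[OF a]) (use s in \<open>auto split: nat.split\<close>)
    then have A: "A t x s (Suc M)"
      using M[of "Suc (Suc (Suc M))"] p(2) by (simp add: A_def)
    have "p \<in> nbhd W (c x s (Suc M))"
      using nbhd_c[OF p(2), of "Suc M" s] s p(1) by auto
    then have "p \<in> nbhd W (\<epsilon> (seq_code [t, x, s, Suc M]))"
      using A by (simp add: \<epsilon>_def eval_nat_numeral)
    then show "p \<in> (\<Union>w. nbhd W (\<epsilon> w))" by blast
  next
    fix p assume "p \<in> (\<Union>w. nbhd W (\<epsilon> w))"
    then obtain w where w: "p \<in> nbhd W (\<epsilon> w)" by blast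
    define t x s m where "t = seq_nth w 0" and "x = seq_nth w 1" and "s = seq_nth w 2" and "m = seq_nth w 3"
    have A: "A t x s m" and p: "p \<in> nbhd W (c x s m)"
      using w nbhd_0 by (auto simp: \<epsilon>_def t_def x_def s_def m_def split: if_splits)
    then obtain \<gamma> where \<gamma>: "p = \<phi> x \<gamma>" "\<forall>i<m. \<gamma> i = seq_nth s i"
      using nbhd_c[of x m s] by (auto simp: A_def)
    have "a (Suc (Suc m)) (?env t x \<gamma>) = a (Suc (Suc m)) (?env t x (seq_nth s))"
      by (rule approx_local[OF a]) (use \<gamma>(2) in \<open>auto split: nat.split\<close>)
    then have "a (Suc (Suc m)) (?env t x \<gamma>) = 2"
      using A by (simp add: A_def)
    then have "T t (case_nat x \<gamma>)"
      using approx_sound[OF a, of "Suc (Suc m)" "?env t x \<gamma>"] by (auto simp: of_bool_def split: if_splits)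
    then show "p \<in> {\<phi> x \<gamma> |x \<gamma>. ok x \<and> R x \<gamma>}"
      using R_iff \<gamma>(1) A by (auto simp: A_def)
  qed
  with rec show ?thesis
    unfolding Sigma01_def by blast
qed

text \<open>The sequence \<beta> is not an oracle but is given by a graph \<open>Q\<close> that is
  semirecursive in \<alpha>. The relation guesses a finite part s of \<beta>, verifies it by
  \<open>Q\<close> and evaluates \<open>D\<close> on it; where \<open>Q\<close> is no graph, its
  truth value is left open.\<close>

lemma semi_partial_comp:
  assumes D: "odec (\<lambda>\<alpha>. D (\<alpha> 0) (shift \<alpha>))"
    and Q: "semi (\<lambda>\<alpha>. Q (\<alpha> 0) (\<alpha> 1) (shift (shift \<alpha>)))"
    and g: "orec g"
  obtains R where "semi R" "\<And>\<alpha> \<beta>. (\<And>x v. Q x v \<alpha> \<longleftrightarrow> \<beta> x = v) \<Longrightarrow> R \<alpha> \<longleftrightarrow> D (g \<alpha>) \<beta>"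
proof -
  obtain a where a: "approx (\<lambda>\<alpha>. of_bool (D (\<alpha> 0) (shift \<alpha>))) a"
    using ex_approx[OF D] by blast
  let ?R = "\<lambda>\<alpha>. \<exists>m. \<exists>s. (\<forall>x<m. Q x (seq_nth s x) \<alpha>) \<and> a (Suc m) (case_nat (g \<alpha>) (seq_nth s)) = 2"
  have semi_R: "semi ?R"
  proof (intro semi_ex semi_conj)
    show "semi (\<lambda>\<alpha>. \<forall>x<shift \<alpha> 0. Q x (seq_nth (\<alpha> 0) x) (shift (shift \<alpha>)))"
    proof (rule semi_ball)
      show "semi (\<lambda>\<alpha>. Q (\<alpha> 0) (seq_nth (shift \<alpha> 0) (\<alpha> 0)) (shift (shift (shift \<alpha>))))"
        using semi_apply2[OF Q, of "\<lambda>\<alpha>. \<alpha> 0" "\<lambda>\<alpha>. seq_nth (shift \<alpha> 0) (\<alpha> 0)" "\<lambda>x \<alpha>. shift (shift (shift \<alpha>)) x"]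
        by (simp add: orec_intro)
    qed (intro orec_intro)
    show "semi (\<lambda>\<alpha>. a (Suc (shift \<alpha> 0)) (case_nat (g (shift (shift \<alpha>))) (seq_nth (\<alpha> 0))) = 2)"
    proof (rule semi_odec, rule odec_eq)
      have "orec (\<lambda>\<alpha>. a (Suc (shift \<alpha> 0)) (\<lambda>i. case_nat (g (shift (shift \<alpha>))) (\<lambda>j. seq_nth (\<alpha> 0) j) i))"
        by (rule orec_apply1[OF approx_orec[OF a]]; intro orec_intro orec_shifts[OF g])
      then show "orec (\<lambda>\<alpha>. a (Suc (shift \<alpha> 0)) (case_nat (g (shift (shift \<alpha>))) (seq_nth (\<alpha> 0))))"
        by simp
    qed (rule orec_const)
  qed
  moreover have "?R \<alpha> \<longleftrightarrow> D (g \<alpha>) \<beta>" if \<beta>: "\<And>x v. Q x v \<alpha> \<longleftrightarrow> \<beta> x = v" for \<alpha> \<beta>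
  proof
    assume "?R \<alpha>"
    then obtain m s where ms: "\<forall>x<m. \<beta> x = seq_nth s x" "a (Suc m) (case_nat (g \<alpha>) (seq_nth s)) = 2"
      using \<beta> by blast
    have "a (Suc m) (case_nat (g \<alpha>) \<beta>) = a (Suc m) (case_nat (g \<alpha>) (seq_nth s))"
      by (rule approx_local[OF a]) (use ms in \<open>auto split: nat.split\<close>)
    then show "D (g \<alpha>) \<beta>"
      using ms approx_sound[OF a, of "Suc m" "case_nat (g \<alpha>) \<beta>"] by (auto simp: of_bool_def split: if_splits)
  next
    assume D\<beta>: "D (g \<alpha>) \<beta>"
    then obtain M where M: "\<And>m. m \<ge> M \<Longrightarrow> a m (case_nat (g \<alpha>) \<beta>) = 2"
      using approx_eventually[OF a, of "case_nat (g \<alpha>) \<beta>"] D\<beta>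
      unfolding eventually_sequentially by (auto simp: numeral_2_eq_2)
    obtain s where s: "\<forall>i<M. seq_nth s i = \<beta> i"
      using ex_seq_nth[of M \<beta>] by blast
    have "a (Suc M) (case_nat (g \<alpha>) (seq_nth s)) = a (Suc M) (case_nat (g \<alpha>) \<beta>)"
      by (rule approx_local[OF a]) (use s in \<open>auto split: nat.split\<close>)
    then have "(\<forall>x<M. Q x (seq_nth s x) \<alpha>) \<and> a (Suc M) (case_nat (g \<alpha>) (seq_nth s)) = 2"
      using s \<beta> M[of "Suc M"] by simp
    then show "?R \<alpha>" by blast
  qed
  ultimately show thesis by (rule that)
qed

abbreviation W3 :: "'a pt rspace" where
  "W3 \<equiv> baire \<otimes>\<^sub>r (omega \<otimes>\<^sub>r omega)"

lemmas Metric_space_simps = Metric_space_rprod Metric_space_omega Metric_space_baire Metric_space_two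
lemmas presentation_simps = presentation_range_rprod presentation_range

lemma Metric_space_nbhd_0:
  assumes "Metric_space (pts X) (dst X)"
  shows "nbhd X 0 = {}"
proof -
  interpret Metric_space "pts X" "dst X" by fact
  show ?thesis using nonneg[of "pres X (seq_nth 0 0)"] by (auto simp: nbhd_def not_less[symmetric])
qed

lemma pts_baire: "pts baire = range SeqP" and pts_omega: "pts omega = range NumP"
  by (simp_all add: baire_def omega_def)

lemma pts_W3: "p \<in> pts W3 \<longleftrightarrow> (\<exists>\<gamma> w k. p = PairP (SeqP \<gamma>) (PairP (NumP w) (NumP k)))"
  unfolding rprod_simps pts_baire pts_omega by auto

lemma in_nbhd_W3: "p \<in> nbhd W3 s \<longleftrightarrow> in_ball W3 (seq_nth s 0) (seq_nth s 1) (seq_nth s 2) p"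
  by (rule in_nbhd_iff) (intro Metric_space_simps presentation_simps)+

lemma Sigma01_baire_omega_omega:
  assumes "semi (\<lambda>\<alpha>. P (\<alpha> 0) (\<alpha> 1) (shift (shift \<alpha>)))"
  shows "Sigma01 (W3 :: 'a pt rspace) {PairP (SeqP \<gamma>) (PairP (NumP w) (NumP k)) |\<gamma> w k. P w k \<gamma>}"
proof -
  let ?\<phi> = "\<lambda>x \<gamma>. PairP (SeqP \<gamma>) (PairP (NumP (seq_nth x 0)) (NumP (seq_nth x 1)))"
  \<comment> \<open>The radius is 1 / m, since denominators are stored less one. Being at most 1 it
    pins down both numbers, and in Baire space it fixes exactly the first m values.\<close>
  let ?c = "\<lambda>x s m. seq_code [seq_code [s, seq_code [seq_nth x 0, seq_nth x 1]], 1, m - 1]"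
  have "Sigma01 (W3 :: 'a pt rspace) {?\<phi> x \<gamma> |x \<gamma>. True \<and> P (seq_nth x 0) (seq_nth x 1) \<gamma>}"
  proof (rule Sigma01I[where ok = "\<lambda>_. True" and c = ?c])
    show "semi (\<lambda>\<alpha>. P (seq_nth (\<alpha> 0) 0) (seq_nth (\<alpha> 0) 1) (shift \<alpha>))"
      using semi_apply2[OF assms, of "\<lambda>\<alpha>. seq_nth (\<alpha> 0) 0" "\<lambda>\<alpha>. seq_nth (\<alpha> 0) 1" "\<lambda>x \<alpha>. shift \<alpha> x"]
      by (simp add: orec_intro)
    show "nbhd (W3 :: 'a pt rspace) (?c x s m) = {?\<phi> x \<gamma> |\<gamma>. \<forall>i<m. \<gamma> i = seq_nth s i}" if "0 < m" for x s m
    proof (rule set_eqI)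
      fix p :: "'a pt"
      show "p \<in> nbhd W3 (?c x s m) \<longleftrightarrow> p \<in> {?\<phi> x \<gamma> |\<gamma>. \<forall>i<m. \<gamma> i = seq_nth s i}"
      proof (cases "p \<in> pts W3")
        case True
        then obtain \<gamma> w k where p: "p = PairP (SeqP \<gamma>) (PairP (NumP w) (NumP k))"
          unfolding pts_W3 by blast
        show ?thesis
          unfolding p in_nbhd_W3 using that
          by auto
      next
        case False
        then have "p \<notin> nbhd W3 (?c x s m)"
          by (simp add: in_nbhd_W3 in_ball_def)
        with False show ?thesis
          unfolding pts_W3 by blast
      qed
    qed
    show "nbhd (W3 :: 'a pt rspace) 0 = {}"
      by (intro Metric_space_nbhd_0 Metric_space_simps)
  qed (intro orec_intro)+
  moreover have "{?\<phi> x \<gamma> |x \<gamma>. True \<and> P (seq_nth x 0) (seq_nth x 1) \<gamma>}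
    = ({PairP (SeqP \<gamma>) (PairP (NumP w) (NumP k)) |\<gamma> w k. P w k \<gamma>} :: 'a pt set)"
  proof (intro equalityI subsetI)
    fix p :: "'a pt" assume "p \<in> {PairP (SeqP \<gamma>) (PairP (NumP w) (NumP k)) |\<gamma> w k. P w k \<gamma>}"
    then obtain \<gamma> w k where "p = ?\<phi> (seq_code [w, k]) \<gamma>" "P w k \<gamma>"
      by auto
    then show "p \<in> {?\<phi> x \<gamma> |x \<gamma>. True \<and> P (seq_nth x 0) (seq_nth x 1) \<gamma>}"
      by (intro CollectI exI[of _ "seq_code [w, k]"] exI[of _ \<gamma>]) simp
  qed blast
  ultimately show ?thesis by simp
qed

section \<open>The \<open>S\<close>-\<open>m\<close>-\<open>n\<close> theorem for \<open>{\<epsilon>}\<close>\<close>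

text \<open>Membership of \<open>SeqP \<delta>\<close> in \<open>nbhd baire k\<close>, with the quantifier bounded so as to be decidable.\<close>

definition bnbhd :: "nat \<Rightarrow> (nat \<Rightarrow> nat) \<Rightarrow> bool" where
  "bnbhd k \<delta> \<longleftrightarrow> 0 < seq_nth k 1 \<and>
    (\<forall>n\<le>seq_nth k 2. seq_nth k 1 * (n + 1) \<le> seq_nth k 2 + 1 \<longrightarrow> seq_nth (seq_nth k 0) n = \<delta> n)"

lemma in_nbhd_baire: "SeqP \<delta> \<in> nbhd baire k \<longleftrightarrow> bnbhd k \<delta>"
  unfolding bnbhd_def in_nbhd_iff[OF Metric_space_baire presentation_range(3)] in_ball_baire ..

text \<open>Neighbourhoods of this form are the cylinders of length j + 1; single values of a point
  are read off from them.\<close>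

lemma bnbhd_seq_code: "bnbhd (seq_code [s, 1, j]) \<delta> \<longleftrightarrow> (\<forall>i\<le>j. seq_nth s i = \<delta> i)"
  by (simp add: bnbhd_def)

lemma odec_bnbhd:
  assumes "orec k" "orec (\<lambda>\<alpha>. h (\<alpha> 0) (shift \<alpha>))"
  shows "odec (\<lambda>\<alpha>. bnbhd (k \<alpha>) (\<lambda>x. h x \<alpha>))"
  unfolding bnbhd_def
  by (intro orec_intro assms orec_shifts(1)[OF assms(1)])

lemma bnbhd_inject:
  assumes "\<And>k. bnbhd k \<delta> \<Longrightarrow> bnbhd k \<delta>'"
  shows "\<delta> = \<delta>'"
proof
  fix j
  obtain s where s: "\<forall>i<Suc j. seq_nth s i = \<delta> i"
    using ex_seq_nth[of "Suc j" \<delta>] by blast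
  then have "bnbhd (seq_code [s, 1, j]) \<delta>"
    unfolding bnbhd_seq_code less_Suc_eq_le .
  from assms[OF this] have "\<forall>i\<le>j. seq_nth s i = \<delta>' i"
    unfolding bnbhd_seq_code .
  moreover have "seq_nth s j = \<delta> j"
    using s by blast
  ultimately show "\<delta> j = \<delta>' j"
    by (metis order.refl)
qed

text \<open>The numbers precede the sequence, in the order in which they are pushed onto an
  oracle.\<close>

definition univ_rel :: "('a pt rspace \<Rightarrow> 'a pt set) \<Rightarrow> nat \<Rightarrow> nat \<Rightarrow> (nat \<Rightarrow> nat) \<Rightarrow> bool" where
  "univ_rel G w k \<gamma> \<longleftrightarrow> PairP (SeqP \<gamma>) (PairP (NumP w) (NumP k)) \<in> G (omega \<otimes>\<^sub>r omega)"

text \<open>Uniqueness of the value is automatic, since points of Baire space are separated by their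
  neighbourhoods; definedness thus reduces to the neighbourhood condition.\<close>

lemma papp_eq_Some_iff:
  fixes G :: "'a pt rspace \<Rightarrow> 'a pt set"
  shows "papp G omega baire \<epsilon> (NumP w) = Some (SeqP \<delta>) \<longleftrightarrow> (\<forall>k. bnbhd k \<delta> \<longleftrightarrow> univ_rel G w k \<epsilon>)"
proof -
  define V :: "'a pt \<Rightarrow> bool" where "V y \<longleftrightarrow> y \<in> pts baire \<and>
    (\<forall>k. y \<in> nbhd baire k \<longleftrightarrow> PairP (SeqP \<epsilon>) (PairP (NumP w) (NumP k)) \<in> G (omega \<otimes>\<^sub>r omega))" for y
  have V_SeqP: "V (SeqP \<delta>) \<longleftrightarrow> (\<forall>k. bnbhd k \<delta> \<longleftrightarrow> univ_rel G w k \<epsilon>)" for \<delta>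
    by (simp add: V_def in_nbhd_baire univ_rel_def pts_baire)
  have uniq: "y = y'" if "V y" "V y'" for y y'
  proof -
    have "y \<in> range SeqP" "y' \<in> range SeqP"
      using that by (simp_all add: V_def baire_def)
    then obtain \<delta> \<delta>' where y: "y = SeqP \<delta>" "y' = SeqP \<delta>'"
      by blast
    show ?thesis
      using that bnbhd_inject[of \<delta> \<delta>'] unfolding y V_SeqP by simp
  qed
  have "papp G omega baire \<epsilon> (NumP w) = (if \<exists>!y. V y then Some (THE y. V y) else None)"
    by (simp add: papp_def V_def)
  moreover have "(if \<exists>!y. V y then Some (THE y. V y) else None) = Some (SeqP \<delta>) \<longleftrightarrow> V (SeqP \<delta>)"
    using uniq theI'[of V] by (metis option.distinct(1) option.inject the_equality)
  ultimately show ?thesis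
    using V_SeqP by simp
qed

lemma kapp_eq_Some_iff:
  fixes G :: "'a pt rspace \<Rightarrow> 'a pt set"
  shows "kapp G \<epsilon> w = Some \<delta> \<longleftrightarrow> (\<forall>k. bnbhd k \<delta> \<longleftrightarrow> univ_rel G w k \<epsilon>)"
proof -
  have "y \<in> pts baire" if "papp G omega baire \<epsilon> (NumP w) = Some y" for y
    using that theI'[of "\<lambda>y. y \<in> pts baire \<and> (\<forall>k. y \<in> nbhd baire k \<longleftrightarrow>
      PairP (SeqP \<epsilon>) (PairP (NumP w) (NumP k)) \<in> G (omega \<otimes>\<^sub>r omega))"]
    by (auto simp: papp_def Let_def split: if_splits)
  then have "y \<in> range SeqP" if "papp G omega baire \<epsilon> (NumP w) = Some y" for y
    using that by (simp add: baire_def)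
  then have "kapp G \<epsilon> w = Some \<delta> \<longleftrightarrow> papp G omega baire \<epsilon> (NumP w) = Some (SeqP \<delta>)"
    unfolding kapp_def by fastforce
  then show ?thesis
    by (simp add: papp_eq_Some_iff)
qed

abbreviation (input) Om2 :: "'a pt rspace" where
  "Om2 \<equiv> omega \<otimes>\<^sub>r omega"

lemma rp_polish_W3: "rp_polish W3" and rp_polish_Om2: "rp_polish Om2"
  by (intro rp_polish_rprod rp_polish_baire rp_polish_omega)+

lemma good_parametrization_Sigma01:
  assumes "good_parametrization G" "rp_polish X"
  shows "Sigma01 (baire \<otimes>\<^sub>r X) (G X)"
  using assms(1)[unfolded good_parametrization_def, THEN conjunct1, THEN spec, THEN mp, OF assms(2)]
  by (rule conjunct1)

lemma good_parametrization_section: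
  assumes "good_parametrization G" "rp_polish X" "P \<subseteq> pts X" "Sigma01 X P"
  shows "\<exists>\<gamma>. recursive_seq \<gamma> \<and> P = section_of (G X) \<gamma>"
  using assms(1)[unfolded good_parametrization_def, THEN conjunct1, THEN spec, THEN mp, OF assms(2),
      THEN conjunct2, THEN spec, THEN mp, OF assms(3), THEN conjunct2] assms(4)
  by (rule iffD1)

lemma good_parametrization_smn:
  assumes "good_parametrization G" "type_le1 X" "rp_polish Y"
  shows "\<exists>S. recursive_map (baire \<otimes>\<^sub>r X) baire S \<and>
    (\<forall>\<gamma>. \<forall>x \<in> pts X. \<forall>y \<in> pts Y.
      PairP (SeqP \<gamma>) (PairP x y) \<in> G (X \<otimes>\<^sub>r Y) \<longleftrightarrow> PairP (S (PairP (SeqP \<gamma>) x)) y \<in> G Y)"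
  using assms(1)[unfolded good_parametrization_def, THEN conjunct2, THEN spec, THEN spec] assms(2,3)
  by blast

text \<open>The universal set is a union of recursively listed balls, and membership in one of them
  is bounded arithmetic in the coordinates.\<close>

lemma semi_univ:
  fixes G :: "'a pt rspace \<Rightarrow> 'a pt set"
  assumes "good_parametrization G"
  shows "semi (\<lambda>\<alpha>. univ_rel G (\<alpha> 0) (\<alpha> 1) (shift (shift \<alpha>)))"
proof -
  have "Sigma01 W3 (G (omega \<otimes>\<^sub>r omega))"
    by (rule good_parametrization_Sigma01[OF assms rp_polish_Om2])
  then obtain \<epsilon> where \<epsilon>: "recursive_seq \<epsilon>" "G (omega \<otimes>\<^sub>r omega) = (\<Union>i. nbhd W3 (\<epsilon> i))"
    unfolding Sigma01_def by blast
  have rec: "orec (\<lambda>\<alpha>. \<epsilon> (f \<alpha>))" if "orec f" for f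
    by (rule orec_num1[where f = \<epsilon>, OF orec_recursive_seq[OF \<epsilon>(1)] that])
  show ?thesis
  proof (rule semiI)
    show "odec (\<lambda>\<alpha>. in_ball (W3 :: 'a pt rspace) (seq_nth (\<epsilon> (\<alpha> 0)) 0) (seq_nth (\<epsilon> (\<alpha> 0)) 1) (seq_nth (\<epsilon> (\<alpha> 0)) 2)
      (PairP (SeqP (shift (shift (shift \<alpha>)))) (PairP (NumP (shift \<alpha> 0)) (NumP (shift \<alpha> 1)))))"
      unfolding in_ball_rprod in_ball_omega in_ball_baire
      by (intro orec_intro rec)
    show "univ_rel G (\<alpha> 0) (\<alpha> 1) (shift (shift \<alpha>)) \<longleftrightarrow>
      (\<exists>t. in_ball (W3 :: 'a pt rspace) (seq_nth (\<epsilon> t) 0) (seq_nth (\<epsilon> t) 1) (seq_nth (\<epsilon> t) 2)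
      (PairP (SeqP (shift (shift \<alpha>))) (PairP (NumP (\<alpha> 0)) (NumP (\<alpha> 1)))))" for \<alpha>
      unfolding univ_rel_def \<epsilon>(2) by (simp only: UN_iff in_nbhd_W3 bex_simps UNIV_I simp_thms)
  qed
qed

text \<open>The set given by \<open>P\<close> has a recursive index \<open>e\<close>, so its section
  at \<gamma> has index \<open>S(e,\<gamma>)\<close>. The recursiveness of \<open>S\<close> is only
  a Sigma^0_1 relation between points and neighbourhoods, so a functional computing each single
  value still has to be extracted from it.\<close>

lemma smn:
  fixes G :: "'a pt rspace \<Rightarrow> 'a pt set"
  assumes G: "good_parametrization G"
    and P: "semi (\<lambda>\<alpha>. P (\<alpha> 0) (\<alpha> 1) (shift (shift \<alpha>)))"
  obtains E where "orec (\<lambda>\<alpha>. E (\<alpha> 0) (shift \<alpha>))" "\<And>\<gamma> w k. univ_rel G w k (\<lambda>j. E j \<gamma>) \<longleftrightarrow> P w k \<gamma>"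
proof -
  let ?A = "{PairP (SeqP \<gamma>) (PairP (NumP w) (NumP k)) |\<gamma> w k. P w k \<gamma>} :: 'a pt set"
  have "Sigma01 W3 ?A"
    by (rule Sigma01_baire_omega_omega[OF P])
  moreover have "?A \<subseteq> pts W3"
    unfolding subset_iff pts_W3 by blast
  ultimately obtain e where e: "recursive_seq e" "?A = section_of (G W3) e"
    using good_parametrization_section[OF G rp_polish_W3, of ?A] by blast
  have "type_le1 baire" by (rule type_le1.intros)
  then obtain S where S: "recursive_map (baire \<otimes>\<^sub>r baire) baire S"
    "\<And>\<gamma> x y. x \<in> pts baire \<Longrightarrow> y \<in> pts (Om2 :: 'a pt rspace) \<Longrightarrow>
      PairP (SeqP \<gamma>) (PairP x y) \<in> G W3 \<longleftrightarrow> PairP (S (PairP (SeqP \<gamma>) x)) y \<in> G Om2"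
    using good_parametrization_smn[OF G _ rp_polish_Om2] by meson
  let ?W = "(baire \<otimes>\<^sub>r baire) \<otimes>\<^sub>r omega :: 'a pt rspace"
  obtain \<epsilon> where \<epsilon>: "recursive_seq \<epsilon>"
    "{PairP x (NumP k) |x k. x \<in> pts (baire \<otimes>\<^sub>r baire) \<and> S x \<in> nbhd baire k} = (\<Union>i. nbhd ?W (\<epsilon> i))"
    using S(1) unfolding recursive_map_def Sigma01_def by blast
  define p :: "(nat \<Rightarrow> nat) \<Rightarrow> 'a pt" where "p \<gamma> = PairP (SeqP e) (SeqP \<gamma>)" for \<gamma>
  have p: "p \<gamma> \<in> pts (baire \<otimes>\<^sub>r baire)" for \<gamma>
    by (simp add: p_def rprod_simps baire_def)
  have "\<exists>\<delta>. S (p \<gamma>) = SeqP \<delta>" for \<gamma>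
  proof -
    have "S (p \<gamma>) \<in> pts baire"
      using S(1) p unfolding recursive_map_def by blast
    then show ?thesis by (auto simp: baire_def)
  qed
  then obtain E where E: "\<And>\<gamma>. S (p \<gamma>) = SeqP (E \<gamma>)" by metis
  have in_W: "z \<in> nbhd ?W s \<longleftrightarrow> in_ball ?W (seq_nth s 0) (seq_nth s 1) (seq_nth s 2) z" for z s
    by (rule in_nbhd_iff) (intro Metric_space_simps presentation_simps)+
  define B where "B k i \<gamma> \<longleftrightarrow> in_ball ?W (seq_nth (\<epsilon> i) 0) (seq_nth (\<epsilon> i) 1) (seq_nth (\<epsilon> i) 2) (PairP (p \<gamma>) (NumP k))" for k i \<gamma>
  have B: "bnbhd k (E \<gamma>) \<longleftrightarrow> (\<exists>i. B k i \<gamma>)" for k \<gamma>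
  proof -
    have "bnbhd k (E \<gamma>) \<longleftrightarrow> S (p \<gamma>) \<in> nbhd baire k"
      by (simp add: E in_nbhd_baire)
    also have "\<dots> \<longleftrightarrow> PairP (p \<gamma>) (NumP k) \<in> (\<Union>i. nbhd ?W (\<epsilon> i))"
      unfolding \<epsilon>(2)[symmetric] using p by simp
    finally show ?thesis
      by (simp only: UN_iff in_W B_def bex_simps UNIV_I simp_thms)
  qed
  \<comment> \<open>\<open>t\<close> codes a pair (s, i) such that the i-th listed ball confirms
    that \<open>E \<gamma>\<close> lies in the cylinder of the first j + 1 entries of s. Entry j of
    the s found first is then the value.\<close>
  define L where "L j \<gamma> = (LEAST t. B (seq_code [seq_nth t 0, 1, j]) (seq_nth t 1) \<gamma>)" for j \<gamma>
  have ex: "\<exists>t. B (seq_code [seq_nth t 0, 1, j]) (seq_nth t 1) \<gamma>" for j \<gamma>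
  proof -
    obtain s where "\<forall>i<Suc j. seq_nth s i = E \<gamma> i"
      using ex_seq_nth[of "Suc j" "E \<gamma>"] by blast
    then have "bnbhd (seq_code [s, 1, j]) (E \<gamma>)"
      by (simp only: bnbhd_seq_code less_Suc_eq_le)
    then obtain i where "B (seq_code [s, 1, j]) i \<gamma>"
      using B by blast
    then show ?thesis
      by (intro exI[of _ "seq_code [s, i]"]) simp
  qed
  have E_eq: "E \<gamma> j = seq_nth (seq_nth (L j \<gamma>) 0) j" for \<gamma> j
  proof -
    have "B (seq_code [seq_nth (L j \<gamma>) 0, 1, j]) (seq_nth (L j \<gamma>) 1) \<gamma>"
      unfolding L_def by (rule LeastI_ex) (rule ex)
    then have "bnbhd (seq_code [seq_nth (L j \<gamma>) 0, 1, j]) (E \<gamma>)"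
      using B by blast
    then show ?thesis
      unfolding bnbhd_seq_code by simp
  qed
  have rec: "orec (\<lambda>\<alpha>. \<epsilon> (f \<alpha>))" "orec (\<lambda>\<alpha>. e (f \<alpha>))" if "orec f" for f
    by (rule orec_num1[where f = \<epsilon>, OF orec_recursive_seq[OF \<epsilon>(1)] that]
        orec_num1[where f = e, OF orec_recursive_seq[OF e(1)] that])+
  have "orec (\<lambda>\<alpha>. L (\<alpha> 0) (shift \<alpha>))"
    unfolding L_def
  proof (rule orec_LEAST)
    show "odec (\<lambda>\<alpha>. B (seq_code [seq_nth (\<alpha> 0) 0, 1, shift \<alpha> 0]) (seq_nth (\<alpha> 0) 1) (shift (shift \<alpha>)))"
      unfolding B_def p_def in_ball_rprod in_ball_omega in_ball_baire
      by (intro orec_intro rec)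
  qed (rule ex)
  then have "orec (\<lambda>\<alpha>. E (shift \<alpha>) (\<alpha> 0))"
    unfolding E_eq by (intro orec_intro)
  moreover have "univ_rel G w k (\<lambda>j. E \<gamma> j) \<longleftrightarrow> P w k \<gamma>" for \<gamma> w k
  proof -
    have y: "PairP (NumP w) (NumP k) \<in> pts Om2"
      by (simp add: rprod_simps omega_def)
    have x: "SeqP \<gamma> \<in> pts baire"
      by (simp add: baire_def)
    have "univ_rel G w k (E \<gamma>) \<longleftrightarrow> PairP (SeqP \<gamma>) (PairP (NumP w) (NumP k)) \<in> section_of (G W3) e"
      unfolding univ_rel_def using S(2)[OF x y, of e] E[of \<gamma>] by (simp add: section_of_def p_def)
    also have "\<dots> \<longleftrightarrow> P w k \<gamma>"
      unfolding e(2)[symmetric] by auto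
    finally show ?thesis by simp
  qed
  ultimately show thesis
    using that[of "\<lambda>j \<gamma>. E \<gamma> j"] by simp
qed

section \<open>Borel codes for intersections, unions and complements of basic neighbourhoods\<close>

lemma seq_nth_triple:
  "seq_nth (seq_code [a, b, c]) 0 = a" "seq_nth (seq_code [a, b, c]) 1 = b" "seq_nth (seq_code [a, b, c]) 2 = c"
  by simp_all

text \<open>A presentation decides only comparisons of a distance with one fraction, so the radius
  is moved to the right. Where the subtraction is truncated at 0, both sides are false because
  \<open>d\<close> is nonnegative. The new denominator is the product (b + 1) (e + 1).\<close>

lemma frac_add_less_iff:
  assumes "0 \<le> d"
  shows "d + real a / (real b + 1) < real c / (real e + 1) \<longleftrightarrow>
    d < real (c * (b + 1) - a * (e + 1)) / (real (b * e + b + e) + 1)"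
proof -
  have pos: "0 < real b + 1" "0 < real e + 1" "real (b * e + b + e) + 1 = (real b + 1) * (real e + 1)"
    by (simp_all add: algebra_simps)
  have eq: "real c / (real e + 1) - real a / (real b + 1) =
    (real (c * (b + 1)) - real (a * (e + 1))) / ((real b + 1) * (real e + 1))"
    using pos(1,2) by (simp add: diff_frac_eq) (simp add: algebra_simps)
  show ?thesis
  proof (cases "a * (e + 1) \<le> c * (b + 1)")
    case True
    then show ?thesis
      unfolding pos(3) of_nat_diff[OF True] eq[symmetric] by linarith
  next
    case False
    then have "c * (b + 1) - a * (e + 1) = 0" "real (c * (b + 1)) - real (a * (e + 1)) < 0"
      by (simp_all del: of_nat_mult of_nat_add)
    moreover from this(2) have "real c / (real e + 1) - real a / (real b + 1) < 0"
      unfolding eq using pos by (intro divide_neg_pos) simp_all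
    ultimately show ?thesis using assms by simp
  qed
qed

lemma frac_add_eq:
  "real a / (real b + 1) + real c / (real e + 1) =
    real (a * (e + 1) + c * (b + 1)) / (real (b * e + b + e) + 1)"
  by (simp add: add_frac_eq) (simp add: algebra_simps)

lemma ex_frac_between:
  fixes a b :: real
  assumes "0 \<le> a" "a < b"
  shows "\<exists>p q. a \<le> real p / (real q + 1) \<and> real p / (real q + 1) < b"
proof -
  obtain q where q: "1 / (real q + 1) < b - a"
    using reals_Archimedean[of "b - a"] assms by (auto simp: inverse_eq_divide add.commute)
  \<comment> \<open>Rounding up costs less than 1 / (q + 1), which was chosen below b - a.\<close>
  define p where "p = nat \<lceil>a * (real q + 1)\<rceil>"
  have "a * (real q + 1) \<le> real p" "real p < a * (real q + 1) + 1"
    using assms unfolding p_def by (auto simp: real_nat_ceiling_ge) linarith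
  moreover have "a + 1 / (real q + 1) = (a * (real q + 1) + 1) / (real q + 1)"
    by (simp add: add_divide_distrib)
  ultimately have "a \<le> real p / (real q + 1)" "real p / (real q + 1) < a + 1 / (real q + 1)"
    by (simp_all only: le_divide_eq divide_strict_right_mono) (simp_all add: divide_strict_right_mono)
  with q show ?thesis
    by (intro exI[of _ p] exI[of _ q]) linarith
qed

definition radius :: "nat \<Rightarrow> real" where
  "radius k = real (seq_nth k 1) / (real (seq_nth k 2) + 1)"

abbreviation center :: "'p rspace \<Rightarrow> nat \<Rightarrow> 'p" where
  "center X k \<equiv> pres X (seq_nth k 0)"

text \<open>Inclusion of basic neighbourhoods need not be decidable; this comparison of numbers is,
  and by the triangle inequality it is sufficient for inclusion.\<close>

definition ball_inside :: "'p rspace \<Rightarrow> nat \<Rightarrow> nat \<Rightarrow> bool" where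
  "ball_inside X k l \<longleftrightarrow> dst X (center X k) (center X l) + radius k < radius l"

text \<open>Likewise a decidable condition, which forces neighbourhood \<open>l\<close> to avoid the
  closed ball of radius \<open>p / (q + 1)\<close> about the centre of \<open>k\<close>.\<close>

definition ball_outside :: "'p rspace \<Rightarrow> nat \<Rightarrow> nat \<Rightarrow> nat \<Rightarrow> nat \<Rightarrow> bool" where
  "ball_outside X l k p q \<longleftrightarrow> radius l + real p / (real q + 1) < dst X (center X l) (center X k)"

text \<open>A code in \<open>BC\<^sub>1\<close> for the complement of the closed ball of radius \<open>p / (q + 1)\<close> around the centre of
  the \<open>k\<close>-th basic neighbourhood, or for the whole space if this radius is not smaller than the one
  of the neighbourhood.\<close>

definition coball_code :: "'p rspace \<Rightarrow> nat \<Rightarrow> nat \<Rightarrow> nat \<Rightarrow> nat \<Rightarrow> nat" where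
  "coball_code X k p q j = (case j of 0 \<Rightarrow> 0 | Suc l \<Rightarrow>
     if p * (seq_nth k 2 + 1) < seq_nth k 1 * (q + 1) \<longrightarrow> ball_outside X l k p q then l else 0)"

text \<open>\<open>j\<close> codes a pair (component, position). \<open>min\<close> folds component
  indices beyond n onto n, and \<open>Suc\<close> passes over the head of the component.\<close>

definition union_code :: "nat \<Rightarrow> (nat \<Rightarrow> nat) \<Rightarrow> nat \<Rightarrow> nat" where
  "union_code n \<gamma> j = component \<gamma> (min (seq_nth j 0) n) (Suc (seq_nth j 1))"

text \<open>\<open>j\<close> codes (k, t), where t selects one listed neighbourhood of each
  component. Neighbourhood k is listed if it formally lies inside all of them; otherwise the empty
  neighbourhood 0 takes its place.\<close>

definition inter_code :: "'p rspace \<Rightarrow> nat \<Rightarrow> (nat \<Rightarrow> nat) \<Rightarrow> nat \<Rightarrow> nat" where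
  "inter_code X n \<gamma> j =
    (if \<forall>i\<le>n. ball_inside X (seq_nth j 0) (component \<gamma> i (Suc (seq_nth (seq_nth j 1) i)))
     then seq_nth j 0 else 0)"

section \<open>Open sets of a fixed recursively presented space\<close>

context
  fixes X :: "'p rspace"
  assumes X: "rp_polish X"
begin

interpretation Metric_space "pts X" "dst X"
  using X by (simp add: rp_polish_iff)

lemma pres_in_pts: "pres X i \<in> pts X"
  using X by (auto simp: rp_polish_iff)

lemma odec_inside:
  assumes "orec k" "orec l"
  shows "odec (\<lambda>\<alpha>. ball_inside X (k \<alpha>) (l \<alpha>))"
proof -
  have "odec (\<lambda>\<alpha>. dst X (pres X (\<alpha> 0)) (pres X (\<alpha> 1)) < real (\<alpha> 2) / (real (\<alpha> 3) + 1))"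
    using X unfolding rp_polish_iff by blast
  note * = orec_num4[where f = "\<lambda>i j m k. of_bool (dst X (pres X i) (pres X j) < real m / (real k + 1))", OF this]
  show ?thesis
    unfolding ball_inside_def radius_def frac_add_less_iff[OF nonneg]
    by (rule *) (intro orec_intro assms)+
qed

lemma odec_outside:
  assumes "orec l" "orec k" "orec p" "orec q"
  shows "odec (\<lambda>\<alpha>. ball_outside X (l \<alpha>) (k \<alpha>) (p \<alpha>) (q \<alpha>))"
proof -
  have "odec (\<lambda>\<alpha>. dst X (pres X (\<alpha> 0)) (pres X (\<alpha> 1)) \<le> real (\<alpha> 2) / (real (\<alpha> 3) + 1))"
    using X unfolding rp_polish_iff by blast
  note * = orec_num4[where f = "\<lambda>i j m k. of_bool (dst X (pres X i) (pres X j) \<le> real m / (real k + 1))", OF this]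
  show ?thesis
    unfolding ball_outside_def radius_def frac_add_eq not_le[symmetric]
    by (rule odec_not, rule *) (intro orec_intro assms)+
qed

lemma orec_coball_code:
  assumes "orec k" "orec p" "orec q" "orec j"
  shows "orec (\<lambda>\<alpha>. coball_code X (k \<alpha>) (p \<alpha>) (q \<alpha>) (j \<alpha>))"
  unfolding coball_code_def
  by (intro orec_intro odec_outside assms orec_shifts(1)[OF assms(1)] orec_shifts(1)[OF assms(2)]
      orec_shifts(1)[OF assms(3)])

lemma in_nbhd: "x \<in> nbhd X k \<longleftrightarrow> x \<in> pts X \<and> dst X (center X k) x < radius k"
  unfolding nbhd_def radius_def using pres_in_pts by simp

lemma nbhd_0: "nbhd X 0 = {}"
  by (rule Metric_space_nbhd_0) (rule Metric_space_axioms)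

lemma ex_small_nbhd:
  assumes "x \<in> pts X" "0 < \<epsilon>"
  obtains l where "x \<in> nbhd X l" "radius l < \<epsilon>"
proof -
  obtain M where M: "1 / (real M + 1) < \<epsilon>"
    using reals_Archimedean[OF assms(2)] by (auto simp: inverse_eq_divide add.commute)
  obtain c where "dst X x (pres X c) < 1 / (real M + 1)"
    using X assms(1) unfolding rp_polish_iff by (metis divide_pos_pos of_nat_0_le_iff zero_less_one add_nonneg_pos)
  then have "x \<in> nbhd X (seq_code [c, 1, M])" "radius (seq_code [c, 1, M]) < \<epsilon>"
    using M assms(1) by (simp_all add: in_nbhd radius_def commute)
  then show thesis by (rule that)
qed

text \<open>By the triangle inequality a listed neighbourhood avoids the closed ball; conversely, a
  point outside leaves room for a small neighbourhood that passes the test.\<close>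

lemma Union_coball_code:
  "(\<Union>j. nbhd X (shift (coball_code X k p q) j)) =
    {x \<in> pts X. real p / (real q + 1) < radius k \<longrightarrow> real p / (real q + 1) < dst X x (center X k)}"
proof -
  have frac: "p * (seq_nth k 2 + 1) < seq_nth k 1 * (q + 1) \<longleftrightarrow> real p / (real q + 1) < radius k"
  proof -
    have "real p / (real q + 1) < radius k \<longleftrightarrow> real (p * (seq_nth k 2 + 1)) < real (seq_nth k 1 * (q + 1))"
      unfolding radius_def by (simp add: field_simps)
    then show ?thesis by (simp only: of_nat_less_iff)
  qed
  show ?thesis (is "?L = ?R")
  proof (intro equalityI subsetI)
    fix x assume "x \<in> ?L"
    then obtain l where "x \<in> nbhd X (if real p / (real q + 1) < radius k \<longrightarrow> ball_outside X l k p q then l else 0)"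
      unfolding shift_apply coball_code_def nat.case frac by blast
    then have x: "x \<in> nbhd X l" and l: "real p / (real q + 1) < radius k \<longrightarrow> ball_outside X l k p q"
      using nbhd_0 by (auto split: if_splits)
    have "real p / (real q + 1) < dst X x (center X k)" if "ball_outside X l k p q"
    proof -
      have "dst X (center X l) (center X k) \<le> dst X (center X l) x + dst X x (center X k)"
        using x pres_in_pts by (intro triangle) (auto simp: in_nbhd)
      with that x show ?thesis
        unfolding ball_outside_def in_nbhd by linarith
    qed
    with l x show "x \<in> ?R"
      by (auto simp: in_nbhd)
  next
    fix x assume x: "x \<in> ?R"
    have "\<exists>l. x \<in> nbhd X l \<and> (real p / (real q + 1) < radius k \<longrightarrow> ball_outside X l k p q)"
    proof (cases "real p / (real q + 1) < radius k")
      case True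
      \<comment> \<open>Half of the gap: one half pays for the radius of the new neighbourhood, the
        other for the distance from x to its centre.\<close>
      define \<epsilon> where "\<epsilon> = (dst X x (center X k) - real p / (real q + 1)) / 2"
      have "0 < \<epsilon>"
        using x True by (simp add: \<epsilon>_def)
      then obtain l where l: "x \<in> nbhd X l" "radius l < \<epsilon>"
        using ex_small_nbhd x by blast
      have "dst X x (center X k) \<le> dst X x (center X l) + dst X (center X l) (center X k)"
        using x pres_in_pts by (intro triangle) auto
      then have "ball_outside X l k p q"
        using l unfolding ball_outside_def in_nbhd \<epsilon>_def commute[of x "center X l"] by argo
      with l show ?thesis by blast
    next
      case False
      then show ?thesis
        using ex_small_nbhd[of x 1] x by (metis (no_types, lifting) mem_Collect_eq zero_less_one)
    qed
    then obtain l where l: "x \<in> nbhd X l" "real p / (real q + 1) < radius k \<longrightarrow> ball_outside X l k p q"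
      by blast
    then have "shift (coball_code X k p q) l = l"
      unfolding shift_apply coball_code_def nat.case frac by simp
    with l(1) show "x \<in> ?L"
      by (intro UN_I[of l]) simp_all
  qed
qed

text \<open>An open ball is the union of the concentric closed balls of smaller fractional radius.
  For all other p and q the code is one of the whole space, whose complement adds nothing, so the
  union may run over all pairs.\<close>

lemma nbhd_eq_Union_coball_code:
  "nbhd X k = (\<Union>p q. pts X - (\<Union>j. nbhd X (shift (coball_code X k p q) j)))"
proof (intro equalityI subsetI)
  fix x assume x: "x \<in> nbhd X k"
  then obtain p q where "dst X x (center X k) \<le> real p / (real q + 1)" "real p / (real q + 1) < radius k"
    using ex_frac_between[of "dst X x (center X k)" "radius k"] by (auto simp: in_nbhd commute)
  with x have "x \<in> pts X - (\<Union>j. nbhd X (shift (coball_code X k p q) j))"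
    unfolding Union_coball_code by (auto simp: in_nbhd)
  then show "x \<in> (\<Union>p q. pts X - (\<Union>j. nbhd X (shift (coball_code X k p q) j)))"
    by blast
next
  fix x assume "x \<in> (\<Union>p q. pts X - (\<Union>j. nbhd X (shift (coball_code X k p q) j)))"
  then obtain p q where "x \<in> pts X" "real p / (real q + 1) < radius k" "dst X x (center X k) \<le> real p / (real q + 1)"
    unfolding Union_coball_code by auto
  then show "x \<in> nbhd X k"
    unfolding in_nbhd commute[of "center X k"] by linarith
qed

lemma Union_union_code:
  "(\<Union>j. nbhd X (union_code n \<gamma> j)) = (\<Union>i\<le>n. \<Union>j. nbhd X (shift (component \<gamma> i) j))"
proof (intro equalityI subsetI)
  fix x assume "x \<in> (\<Union>j. nbhd X (union_code n \<gamma> j))"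
  then obtain j where "x \<in> nbhd X (shift (component \<gamma> (min (seq_nth j 0) n)) (seq_nth j 1))"
    by (auto simp: union_code_def shift_apply)
  then show "x \<in> (\<Union>i\<le>n. \<Union>j. nbhd X (shift (component \<gamma> i) j))"
    by (intro UN_I[of "min (seq_nth j 0) n"] UN_I[of "seq_nth j 1"]) auto
next
  fix x assume "x \<in> (\<Union>i\<le>n. \<Union>j. nbhd X (shift (component \<gamma> i) j))"
  then obtain i j where "i \<le> n" "x \<in> nbhd X (shift (component \<gamma> i) j)"
    by auto
  then show "x \<in> (\<Union>j. nbhd X (union_code n \<gamma> j))"
    by (intro UN_I[of "seq_code [i, j]"]) (auto simp: union_code_def shift_apply min_absorb1)
qed

lemma Union_inter_code:
  "(\<Union>j. nbhd X (inter_code X n \<gamma> j)) = (\<Inter>i\<le>n. \<Union>j. nbhd X (shift (component \<gamma> i) j))"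
proof (intro equalityI subsetI)
  fix x assume "x \<in> (\<Union>j. nbhd X (inter_code X n \<gamma> j))"
  then obtain k t where x: "x \<in> nbhd X k" and
    ins: "\<And>i. i \<le> n \<Longrightarrow> ball_inside X k (shift (component \<gamma> i) (seq_nth t i))"
    by (auto simp: inter_code_def shift_apply nbhd_0 split: if_splits)
  have "x \<in> nbhd X l" if "ball_inside X k l" for l
  proof -
    have "dst X (center X l) x \<le> dst X (center X l) (center X k) + dst X (center X k) x"
      using x pres_in_pts by (intro triangle) (auto simp: in_nbhd)
    then show ?thesis
      using that x unfolding ball_inside_def in_nbhd commute[of "center X k" "center X l"] by auto
  qed
  with ins show "x \<in> (\<Inter>i\<le>n. \<Union>j. nbhd X (shift (component \<gamma> i) j))"
    by blast
next
  fix x assume x: "x \<in> (\<Inter>i\<le>n. \<Union>j. nbhd X (shift (component \<gamma> i) j))"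
  then have "\<forall>i. \<exists>j. i \<le> n \<longrightarrow> x \<in> nbhd X (shift (component \<gamma> i) j)"
    by auto
  then obtain f where f: "\<And>i. i \<le> n \<Longrightarrow> x \<in> nbhd X (shift (component \<gamma> i) (f i))"
    by metis
  define l where "l i = shift (component \<gamma> i) (f i)" for i
  \<comment> \<open>The least slack of x in the chosen neighbourhoods. With radius below \<mu> / 2,
    the new radius and the distance from x to the new centre each use less than half of it.\<close>
  define \<mu> where "\<mu> = Min ((\<lambda>i. radius (l i) - dst X (center X (l i)) x) ` {..n})"
  have \<mu>: "\<mu> \<le> radius (l i) - dst X (center X (l i)) x" if "i \<le> n" for i
    unfolding \<mu>_def using that by (intro Min_le) auto
  have "0 < \<mu>"
    unfolding \<mu>_def using f by (subst Min_gr_iff) (auto simp: l_def in_nbhd)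
  then have "0 < \<mu> / 2" by simp
  moreover have xX: "x \<in> pts X"
    using f[of 0] by (simp add: in_nbhd)
  ultimately obtain k where k: "x \<in> nbhd X k" "radius k < \<mu> / 2"
    using ex_small_nbhd by blast
  have ins: "ball_inside X k (l i)" if "i \<le> n" for i
  proof -
    have "dst X (center X k) (center X (l i)) \<le> dst X (center X k) x + dst X x (center X (l i))"
      using xX pres_in_pts by (intro triangle) auto
    then show ?thesis
      using k \<mu>[OF that] unfolding ball_inside_def in_nbhd commute[of x "center X (l i)"] by argo
  qed
  obtain t where t: "\<forall>i<Suc n. seq_nth t i = f i"
    using ex_seq_nth[of "Suc n" f] by blast
  have "inter_code X n \<gamma> (seq_code [k, t]) = k"
    using ins t by (auto simp: inter_code_def l_def shift_apply less_Suc_eq_le)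
  with k(1) show "x \<in> (\<Union>j. nbhd X (inter_code X n \<gamma> j))"
    by (intro UN_I[of "seq_code [k, t]"]) simp_all
qed

end

section \<open>Levels of Borel codes and decomposition of the coded sets\<close>

lemma BC_1: "BC G 1 = {\<gamma>. \<gamma> 0 = 0}"
  by (subst BC.simps) simp

lemma BC_gt_1: "1 < \<xi> \<Longrightarrow> BC G \<xi> = {\<gamma>. \<gamma> 0 = 1 \<and>
    (\<forall>i. \<exists>\<delta>. kapp G (shift \<gamma>) i = Some \<delta> \<and> \<delta> \<in> (\<Union>\<eta> \<in> {1..<\<xi>}. BC G \<eta>))}"
  by (subst BC.simps) auto

text \<open>The levels are cumulative only from 2 on, because the head of a code is 0 at level 1 and
  1 above it; hence the recurring \<open>BC G 1 \<union> BC G \<xi>\<close>.\<close>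

lemma BC_mono:
  assumes "1 < \<xi>" "\<xi> \<le> \<eta>"
  shows "BC G \<xi> \<subseteq> BC G \<eta>"
proof -
  have "1 < \<eta>" using assms by simp
  moreover have "{1..<\<xi>} \<subseteq> {1..<\<eta>}" using assms by auto
  ultimately show ?thesis
    unfolding BC_gt_1[OF assms(1)] BC_gt_1[OF \<open>1 < \<eta>\<close>] by blast
qed

lemma one_le_omega1: "0 < (\<xi> :: omega1) \<Longrightarrow> 1 \<le> \<xi>"
  unfolding one_omega1_def by (rule Least_le)

lemma rho_BC_1:
  assumes "\<gamma> 0 = 0"
  shows "rho G X \<gamma> = (\<Union>i. nbhd X (shift \<gamma> i))"
proof -
  have \<gamma>: "\<gamma> \<in> BC G 1"
    using assms by (simp add: BC_1)
  then have "\<gamma> \<in> BC_all G"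
    unfolding BC_all_def by (intro UN_I[of 1]) auto
  with \<gamma> show ?thesis
    by (subst rho.simps) simp
qed

lemma rho_BC_gt_1:
  assumes "1 < \<xi>" "\<gamma> \<in> BC G \<xi>"
  shows "rho G X \<gamma> = (\<Union>i. pts X - rho G X (the (kapp G (shift \<gamma>) i)))"
proof -
  have "\<gamma> \<in> BC_all G"
    using assms unfolding BC_all_def by (intro UN_I[of \<xi>]) auto
  moreover have "\<gamma> \<notin> BC G 1"
    using assms by (simp add: BC_1 BC_gt_1)
  ultimately show ?thesis
    by (subst rho.simps) simp
qed

lemma BC_gt_1_I:
  assumes "1 < \<xi>" "\<gamma> 0 = 1" "\<And>i. kapp G (shift \<gamma>) i = Some (f i)" "\<And>i. f i \<in> (\<Union>\<eta> \<in> {1..<\<xi>}. BC G \<eta>)"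
  shows "\<gamma> \<in> BC G \<xi>" "rho G X \<gamma> = (\<Union>i. pts X - rho G X (f i))"
proof -
  show "\<gamma> \<in> BC G \<xi>"
    unfolding BC_gt_1[OF assms(1)] using assms by simp
  from rho_BC_gt_1[OF assms(1) this] show "rho G X \<gamma> = (\<Union>i. pts X - rho G X (f i))"
    by (simp add: assms(3))
qed

text \<open>The codes \<delta>(i,t) of the overview. For head 0, t codes (r, p, q), and the piece
  codes the complement of the closed ball of radius p / (q + 1) in the r-th listed neighbourhood, if
  p / (q + 1) is below its radius, and the whole space otherwise. For other heads \<open>the\<close>
  is arbitrary where the value is undefined, which does not happen for Borel codes.\<close>

definition piece :: "('a pt rspace \<Rightarrow> 'a pt set) \<Rightarrow> 'a pt rspace \<Rightarrow> (nat \<Rightarrow> nat) \<Rightarrow> nat \<Rightarrow> nat \<Rightarrow> nat" where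
  "piece G X \<gamma> t =
    (if \<gamma> 0 = 0 then coball_code X (\<gamma> (Suc (seq_nth t 0))) (seq_nth t 1) (seq_nth t 2)
     else the (kapp G (shift \<gamma>) t))"

text \<open>As \<open>1 < \<xi>\<close>, the closed-ball codes of level 1 lie below \<xi> too, so an
  open set unfolds exactly like a set of level \<xi>.\<close>

lemma piece_properties:
  assumes X: "rp_polish X" and \<xi>: "1 < \<xi>" and \<gamma>: "\<gamma> \<in> BC G 1 \<union> BC G \<xi>"
  shows "piece G X \<gamma> t \<in> (\<Union>\<eta> \<in> {1..<\<xi>}. BC G \<eta>)"
    and "rho G X \<gamma> = (\<Union>t. pts X - rho G X (piece G X \<gamma> t))"
    and "\<gamma> 0 \<noteq> 0 \<Longrightarrow> kapp G (shift \<gamma>) t = Some (piece G X \<gamma> t)"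
proof -
  show "piece G X \<gamma> t \<in> (\<Union>\<eta> \<in> {1..<\<xi>}. BC G \<eta>)"
  proof (cases "\<gamma> 0 = 0")
    case True
    then have "piece G X \<gamma> t \<in> BC G 1"
      by (simp add: piece_def BC_1 coball_code_def)
    with \<xi> show ?thesis by (intro UN_I[of 1]) auto
  next
    case False
    with \<gamma> have "\<gamma> \<in> BC G \<xi>"
      by (simp add: BC_1)
    then obtain \<delta> where "kapp G (shift \<gamma>) t = Some \<delta>" "\<delta> \<in> (\<Union>\<eta> \<in> {1..<\<xi>}. BC G \<eta>)"
      unfolding BC_gt_1[OF \<xi>] by blast
    with False show ?thesis by (simp add: piece_def)
  qed
  show "rho G X \<gamma> = (\<Union>t. pts X - rho G X (piece G X \<gamma> t))"
  proof (cases "\<gamma> 0 = 0")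
    case True
    define F where "F i p q = pts X - (\<Union>j. nbhd X (shift (coball_code X (shift \<gamma> i) p q) j))" for i p q
    have nbhd_F: "x \<in> nbhd X (shift \<gamma> i) \<longleftrightarrow> (\<exists>p q. x \<in> F i p q)" for x i
      unfolding F_def by (subst nbhd_eq_Union_coball_code[OF X]) blast
    have "pts X - rho G X (piece G X \<gamma> t) = F (seq_nth t 0) (seq_nth t 1) (seq_nth t 2)" for t
    proof -
      have p: "piece G X \<gamma> t = coball_code X (shift \<gamma> (seq_nth t 0)) (seq_nth t 1) (seq_nth t 2)"
        by (simp only: piece_def True simp_thms if_True shift_apply)
      have "piece G X \<gamma> t 0 = 0"
        unfolding p coball_code_def by simp
      from rho_BC_1[of "piece G X \<gamma> t" G X, OF this] show ?thesis
        unfolding F_def p by (simp only:)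
    qed
    moreover have "rho G X \<gamma> = (\<Union>i. nbhd X (shift \<gamma> i))"
      by (rule rho_BC_1[of \<gamma>, OF True])
    moreover have "(\<Union>i. nbhd X (shift \<gamma> i)) = (\<Union>t. F (seq_nth t 0) (seq_nth t 1) (seq_nth t 2))"
    proof (intro equalityI subsetI)
      fix x assume "x \<in> (\<Union>i. nbhd X (shift \<gamma> i))"
      then obtain i p q where "x \<in> F i p q"
        using nbhd_F by blast
      then have "x \<in> F (seq_nth (seq_code [i, p, q]) 0) (seq_nth (seq_code [i, p, q]) 1) (seq_nth (seq_code [i, p, q]) 2)"
        unfolding seq_nth_triple .
      then show "x \<in> (\<Union>t. F (seq_nth t 0) (seq_nth t 1) (seq_nth t 2))"
        by blast
    next
      fix x assume "x \<in> (\<Union>t. F (seq_nth t 0) (seq_nth t 1) (seq_nth t 2))"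
      then obtain t where "x \<in> F (seq_nth t 0) (seq_nth t 1) (seq_nth t 2)" by blast
      then have "x \<in> nbhd X (shift \<gamma> (seq_nth t 0))"
        using nbhd_F by blast
      then show "x \<in> (\<Union>i. nbhd X (shift \<gamma> i))" by blast
    qed
    ultimately show ?thesis by simp
  next
    case False
    then have "\<gamma> \<in> BC G \<xi>"
      using \<gamma> by (simp add: BC_1)
    from rho_BC_gt_1[OF \<xi> this] show ?thesis
      using False by (simp add: piece_def)
  qed
  show "kapp G (shift \<gamma>) t = Some (piece G X \<gamma> t)" if "\<gamma> 0 \<noteq> 0"
  proof -
    have "\<exists>\<delta>. kapp G (shift \<gamma>) t = Some \<delta>"
      using that \<gamma> \<xi> by (auto simp: BC_1 BC_gt_1)
    with that show ?thesis by (auto simp: piece_def)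
  qed
qed

section \<open>Uniform unions and intersections\<close>

text \<open>The inverse of \<open>component\<close>: positions \<open>2 ^ i * (2 * j + 1) - 1\<close> are decoded into \<open>i\<close> and \<open>j\<close>.\<close>

definition row_index :: "nat \<Rightarrow> nat" where
  "row_index y = (LEAST i. \<not> 2 ^ Suc i dvd Suc y)"

text \<open>An inequality in place of an equation makes the search evidently total; at a position of
  row i the least solution is the exact one.\<close>

definition col_index :: "nat \<Rightarrow> nat" where
  "col_index y = (LEAST j. Suc y \<le> 2 ^ row_index y * (2 * j + 1))"

lemma row_index_component: "row_index (2 ^ i * (2 * j + 1) - 1) = i"
proof -
  have y: "Suc (2 ^ i * (2 * j + 1) - 1) = 2 ^ i * (2 * j + 1)" by simp
  show ?thesis
    unfolding row_index_def y
  proof (rule Least_equality)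
    have "(2::nat) ^ i * 2 dvd 2 ^ i * (2 * j + 1) \<longleftrightarrow> 2 dvd 2 * j + 1"
      by (rule dvd_times_left_cancel_iff) simp
    then show "\<not> 2 ^ Suc i dvd 2 ^ i * (2 * j + (1::nat))"
      unfolding power_Suc2 by simp
    fix k assume k: "\<not> 2 ^ Suc k dvd 2 ^ i * (2 * j + (1::nat))"
    show "i \<le> k"
    proof (rule ccontr)
      assume "\<not> i \<le> k"
      then have "(2::nat) ^ Suc k dvd 2 ^ i"
        by (intro le_imp_power_dvd) simp
      with k show False by (meson dvd_mult2)
    qed
  qed
qed

lemma col_index_component: "col_index (2 ^ i * (2 * j + 1) - 1) = j"
  unfolding col_index_def row_index_component
  by (rule Least_equality) (auto simp: Suc_le_eq)

lemma orec_row: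
  assumes "orec f"
  shows "orec (\<lambda>\<alpha>. row_index (f \<alpha>))"
proof -
  have "\<exists>i. \<not> (2::nat) ^ Suc i dvd Suc y" for y
  proof -
    have "Suc y < 2 ^ Suc y" by (rule less_exp)
    also have "\<dots> \<le> 2 ^ Suc (Suc y)" by simp
    finally show ?thesis
      by (intro exI[of _ "Suc y"]) (auto dest!: dvd_imp_le)
  qed
  then have "orec (\<lambda>\<alpha>. row_index (\<alpha> 0))"
    unfolding row_index_def by (intro orec_LEAST) (intro orec_intro)
  then show ?thesis
    by (rule orec_num1[where f = row_index]) (rule assms)
qed

lemma orec_col:
  assumes "orec f"
  shows "orec (\<lambda>\<alpha>. col_index (f \<alpha>))"
proof -
  have "\<exists>j. Suc y \<le> 2 ^ row_index y * (2 * j + 1)" for y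
  proof -
    have "2 * Suc y + 1 \<le> 2 ^ row_index y * (2 * Suc y + 1)"
      using mult_le_mono1[of 1 "2 ^ row_index y" "2 * Suc y + 1"] by simp
    then have "Suc y \<le> 2 ^ row_index y * (2 * Suc y + 1)"
      by (rule order.trans[rotated]) simp
    then show ?thesis ..
  qed
  then have "orec (\<lambda>\<alpha>. col_index (\<alpha> 0))"
    unfolding col_index_def by (intro orec_LEAST) (intro orec_intro orec_row)
  then show ?thesis
    by (rule orec_num1[where f = col_index]) (rule assms)
qed

text \<open>Builds a sequence with prescribed components, as needed to feed pieces into the union
  map.\<close>

lemma component_join: "component (\<lambda>y. F (row_index y) (col_index y)) i = F i"
  by (simp add: component_def row_index_component[simplified] col_index_component[simplified])

text \<open>In all functionals below, the number \<open>n\<close> and the sequence \<open>\<gamma>\<close> are passed as the single oracle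
  \<open>case_nat n \<gamma>\<close>.\<close>

definition all_open :: "(nat \<Rightarrow> nat) \<Rightarrow> bool" where
  "all_open z \<longleftrightarrow> (\<forall>i\<le>z 0. component (shift z) i 0 = 0)"

lemma odec_all_open:
  assumes "orec (\<lambda>\<alpha>. h (\<alpha> 0) (shift \<alpha>))"
  shows "odec (\<lambda>\<alpha>. all_open (\<lambda>x. h x \<alpha>))"
proof -
  have "odec (\<lambda>\<alpha>. all_open (\<lambda>x. \<alpha> x))"
    unfolding all_open_def component_def shift_apply
    by (intro orec_intro)
  then have "odec (\<lambda>\<alpha>. all_open \<alpha>)" by simp
  from orec_subst[OF this assms] show ?thesis .
qed

text \<open>The heads of the components decide the head of the code, and with it whether the tail is
  a list of neighbourhoods (\<open>B\<close>) or an index for further codes (\<open>E\<close>). One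
  functional thus serves all levels.\<close>

definition assemble :: "((nat \<Rightarrow> nat) \<Rightarrow> nat \<Rightarrow> nat) \<Rightarrow> (nat \<Rightarrow> (nat \<Rightarrow> nat) \<Rightarrow> nat) \<Rightarrow> nat \<Rightarrow> (nat \<Rightarrow> nat) \<Rightarrow> nat" where
  "assemble B E j z = (case j of 0 \<Rightarrow> of_bool (\<not> all_open z)
    | Suc i \<Rightarrow> if all_open z then B z i else E i z)"

lemma orec_assemble:
  assumes B: "orec (\<lambda>\<alpha>. B (shift \<alpha>) (\<alpha> 0))" and E: "orec (\<lambda>\<alpha>. E (\<alpha> 0) (shift \<alpha>))"
  shows "orec (\<lambda>\<alpha>. assemble B E (\<alpha> 0) (shift \<alpha>))"
proof -
  have "orec (\<lambda>\<alpha>. B (\<lambda>x. shift (shift \<alpha>) x) (\<alpha> 0))" "orec (\<lambda>\<alpha>. E (\<alpha> 0) (\<lambda>x. shift (shift \<alpha>) x))"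
    by (rule orec_apply1[where f = "\<lambda>k \<beta>. B \<beta> k", OF B] orec_apply1[OF E]; intro orec_intro)+
  moreover have "odec (\<lambda>\<alpha>. all_open (\<lambda>x. shift \<alpha> x))" "odec (\<lambda>\<alpha>. all_open (\<lambda>x. shift (shift \<alpha>) x))"
    by (rule odec_all_open; intro orec_intro)+
  ultimately show ?thesis
    unfolding assemble_def by (intro orec_case_nat orec_if odec_not orec_app orec_const) simp_all
qed

lemma orec_union_code: "orec (\<lambda>\<alpha>. union_code (shift \<alpha> 0) (shift (shift \<alpha>)) (\<alpha> 0))"
  unfolding union_code_def component_def by (intro orec_intro)

lemma orec_inter_code:
  "rp_polish X \<Longrightarrow> orec (\<lambda>\<alpha>. inter_code X (shift \<alpha> 0) (shift (shift \<alpha>)) (\<alpha> 0))"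
  unfolding inter_code_def component_def by (intro orec_intro odec_inside)

text \<open>\<open>w\<close> codes a pair (component, piece), and \<open>P\<close> says that the
  k-th neighbourhood contains that piece. For head 0 this is decidable; otherwise the universal
  relation of the component is copied, which makes sense even where no value is defined.\<close>

lemma ex_union_map:
  fixes G :: "'a pt rspace \<Rightarrow> 'a pt set" and X :: "'a pt rspace"
  assumes G: "good_parametrization G" and X: "rp_polish X"
  obtains E where "orec (\<lambda>\<alpha>. E (\<alpha> 0) (shift \<alpha>))"
    "\<And>\<xi> n \<gamma> w. 1 < \<xi> \<Longrightarrow> (\<And>i. i \<le> n \<Longrightarrow> component \<gamma> i \<in> BC G 1 \<union> BC G \<xi>) \<Longrightarrow>
      kapp G (\<lambda>j. E j (case_nat n \<gamma>)) w =
        Some (piece G X (component \<gamma> (min (seq_nth w 0) n)) (seq_nth w 1))"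
proof -
  define C where "C w z = component (shift z) (min (seq_nth w 0) (z 0))" for w z
  define P where "P w k z \<longleftrightarrow>
    C w z 0 = 0 \<and> bnbhd k (\<lambda>j. coball_code X (C w z (Suc (seq_nth (seq_nth w 1) 0)))
      (seq_nth (seq_nth w 1) 1) (seq_nth (seq_nth w 1) 2) j) \<or>
    C w z 0 \<noteq> 0 \<and> univ_rel G (seq_nth w 1) k (\<lambda>j. shift (C w z) j)" for w k z
  have "semi (\<lambda>\<alpha>. P (\<alpha> 0) (\<alpha> 1) (shift (shift \<alpha>)))"
    unfolding P_def
  proof (intro semi_disj semi_conj)
    show "semi (\<lambda>\<alpha>. bnbhd (\<alpha> 1) (\<lambda>j. coball_code X (C (\<alpha> 0) (shift (shift \<alpha>)) (Suc (seq_nth (seq_nth (\<alpha> 0) 1) 0)))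
      (seq_nth (seq_nth (\<alpha> 0) 1) 1) (seq_nth (seq_nth (\<alpha> 0) 1) 2) j))"
      unfolding C_def component_def shift_apply
      by (rule semi_odec, rule odec_bnbhd) (intro orec_intro orec_coball_code X)+
    show "semi (\<lambda>\<alpha>. univ_rel G (seq_nth (\<alpha> 0) 1) (\<alpha> 1) (\<lambda>j. shift (C (\<alpha> 0) (shift (shift \<alpha>))) j))"
      unfolding C_def component_def shift_apply
      by (rule semi_apply2[OF semi_univ[OF G]]) (intro orec_intro)+
    show "semi (\<lambda>\<alpha>. C (\<alpha> 0) (shift (shift \<alpha>)) 0 = 0)" "semi (\<lambda>\<alpha>. C (\<alpha> 0) (shift (shift \<alpha>)) 0 \<noteq> 0)"
      unfolding C_def component_def by (rule semi_odec, intro orec_intro)+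
  qed
  then obtain E where E: "orec (\<lambda>\<alpha>. E (\<alpha> 0) (shift \<alpha>))" "\<And>\<gamma> w k. univ_rel G w k (\<lambda>j. E j \<gamma>) \<longleftrightarrow> P w k \<gamma>"
    by (rule smn[OF G]) blast
  show thesis
  proof (rule that[OF E(1)])
    fix \<xi> :: omega1 and n w :: nat and \<gamma> :: "nat \<Rightarrow> nat"
    assume \<xi>: "1 < \<xi>" and \<gamma>: "\<And>i. i \<le> n \<Longrightarrow> component \<gamma> i \<in> BC G 1 \<union> BC G \<xi>"
    define c where "c = component \<gamma> (min (seq_nth w 0) n)"
    define t where "t = seq_nth w 1"
    have c: "c \<in> BC G 1 \<union> BC G \<xi>"
      unfolding c_def by (rule \<gamma>) simp
    have "bnbhd k (piece G X c t) \<longleftrightarrow> P w k (case_nat n \<gamma>)" for k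
    proof (cases "c 0 = 0")
      case True
      then show ?thesis
        by (simp add: P_def C_def c_def[symmetric] t_def piece_def)
    next
      case False
      from piece_properties(3)[OF X \<xi> c False, of t] have "bnbhd k (piece G X c t) \<longleftrightarrow> univ_rel G t k (shift c)"
        by (simp add: kapp_eq_Some_iff)
      with False show ?thesis
        by (simp add: P_def C_def c_def[symmetric] t_def)
    qed
    then show "kapp G (\<lambda>j. E j (case_nat n \<gamma>)) w = Some (piece G X c t)"
      unfolding kapp_eq_Some_iff E(2) by blast
  qed
qed

text \<open>The union map \<open>U\<close> has to be applied to a sequence \<beta> whose components
  are pieces, and these are available only through a semirecursive graph.
  \<open>semi_partial_comp\<close> makes "the k-th neighbourhood contains the result" semirecursive
  nevertheless, and \<open>smn\<close> provides the index.\<close>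

lemma ex_inter_map:
  fixes G :: "'a pt rspace \<Rightarrow> 'a pt set" and X :: "'a pt rspace"
  assumes G: "good_parametrization G" and X: "rp_polish X" and U: "orec (\<lambda>\<alpha>. U (\<alpha> 0) (shift \<alpha>))"
  obtains E where "orec (\<lambda>\<alpha>. E (\<alpha> 0) (shift \<alpha>))"
    "\<And>\<xi> n \<gamma> w. 1 < \<xi> \<Longrightarrow> (\<And>i. i \<le> n \<Longrightarrow> component \<gamma> i \<in> BC G 1 \<union> BC G \<xi>) \<Longrightarrow>
      \<exists>\<beta>. kapp G (\<lambda>j. E j (case_nat n \<gamma>)) w = Some (\<lambda>j. U j (case_nat n \<beta>)) \<and>
        (\<forall>i\<le>n. component \<beta> i = piece G X (component \<gamma> i) (seq_nth w i))"
proof -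
  \<comment> \<open>Graph of the pieces: entry l of the t-th piece of c is v. For a nonzero head the
    entry is read from a cylinder of length l + 1 accepted by the universal relation.\<close>
  define val where "val t l v c \<longleftrightarrow>
    c 0 = 0 \<and> v = coball_code X (c (Suc (seq_nth t 0))) (seq_nth t 1) (seq_nth t 2) l \<or>
    c 0 \<noteq> 0 \<and> (\<exists>s. seq_nth s l = v \<and> univ_rel G t (seq_code [s, 1, l]) (\<lambda>j. shift c j))" for t l v c
  \<comment> \<open>Graph of \<open>case_nat n \<beta>\<close> in the environment (w, k, n,
    \<gamma>): \<open>\<alpha> 0\<close> is w, \<open>\<alpha> 2\<close> is n, and the threefold
    shift is \<gamma>. Positions are moved by one because n comes first. Components beyond n are set
    to 0, so that \<beta> is total.\<close>
  define Q where "Q x v \<alpha> \<longleftrightarrow>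
    x = 0 \<and> v = \<alpha> 2 \<or>
    x \<noteq> 0 \<and> \<alpha> 2 < row_index (x - 1) \<and> v = 0 \<or>
    x \<noteq> 0 \<and> row_index (x - 1) \<le> \<alpha> 2 \<and>
      val (seq_nth (\<alpha> 0) (row_index (x - 1))) (col_index (x - 1)) v (\<lambda>j. component (shift (shift (shift \<alpha>))) (row_index (x - 1)) j)" for x v \<alpha>
  have D: "odec (\<lambda>\<alpha>. bnbhd (\<alpha> 0) (\<lambda>j. U j (shift \<alpha>)))"
  proof (rule odec_bnbhd)
    have "orec (\<lambda>\<alpha>. U (\<alpha> 0) (\<lambda>x. shift (shift \<alpha>) x))"
      by (rule orec_apply1[OF U]; intro orec_intro)
    then show "orec (\<lambda>\<alpha>. U (\<alpha> 0) (shift (shift \<alpha>)))" by simp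
  qed (intro orec_intro)
  have "semi (\<lambda>\<alpha>. Q (\<alpha> 0) (\<alpha> 1) (shift (shift \<alpha>)))"
    unfolding Q_def val_def component_def shift_apply
    by (intro semi_disj semi_conj semi_ex semi_odec[OF odec_eq] semi_odec[OF odec_not]
       semi_apply2[OF semi_univ[OF G]] semi_odec[OF odec_less] semi_odec[OF odec_le]
       orec_coball_code[OF X] orec_row orec_col orec_intro)
  then obtain R where R: "semi R"
    "\<And>\<alpha> \<beta>. (\<And>x v. Q x v \<alpha> \<longleftrightarrow> \<beta> x = v) \<Longrightarrow> R \<alpha> \<longleftrightarrow> bnbhd (\<alpha> 1) (\<lambda>j. U j \<beta>)"
    using semi_partial_comp[OF D, of Q "\<lambda>\<alpha>. \<alpha> 1"] orec_app[OF orec_const] by blast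
  have "semi (\<lambda>\<alpha>. R (case_nat (\<alpha> 0) (case_nat (\<alpha> 1) (shift (shift \<alpha>)))))"
  proof -
    have "case_nat (\<alpha> 0) (case_nat (\<alpha> 1) (shift (shift \<alpha>))) = \<alpha>" for \<alpha> :: "nat \<Rightarrow> nat"
      by (auto simp: fun_eq_iff shift_apply split: nat.split)
    with R(1) show ?thesis by simp
  qed
  then obtain E where E: "orec (\<lambda>\<alpha>. E (\<alpha> 0) (shift \<alpha>))"
    "\<And>\<gamma> w k. univ_rel G w k (\<lambda>j. E j \<gamma>) \<longleftrightarrow> R (case_nat w (case_nat k \<gamma>))"
    by (rule smn[OF G, where P = "\<lambda>w k \<gamma>. R (case_nat w (case_nat k \<gamma>))"]) blast
  show thesis
  proof (rule that[OF E(1)])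
    fix \<xi> :: omega1 and n w :: nat and \<gamma> :: "nat \<Rightarrow> nat"
    assume \<xi>: "1 < \<xi>" and \<gamma>: "\<And>i. i \<le> n \<Longrightarrow> component \<gamma> i \<in> BC G 1 \<union> BC G \<xi>"
    define F where "F i = (if i \<le> n then piece G X (component \<gamma> i) (seq_nth w i) else (\<lambda>_. 0))" for i
    define \<beta> where "\<beta> = (\<lambda>y. F (row_index y) (col_index y))"
    have \<beta>: "component \<beta> i = F i" for i
      unfolding \<beta>_def by (rule component_join)
    have val: "val t l v c \<longleftrightarrow> piece G X c t l = v" if c: "c \<in> BC G 1 \<union> BC G \<xi>" for t l v c
    proof (cases "c 0 = 0")
      case True
      then show ?thesis by (auto simp: val_def piece_def)
    next
      case False
      from piece_properties(3)[OF X \<xi> c False, of t]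
      have "univ_rel G t k (\<lambda>j. shift c j) \<longleftrightarrow> bnbhd k (piece G X c t)" for k
        by (simp add: kapp_eq_Some_iff)
      then have "val t l v c \<longleftrightarrow> (\<exists>s. seq_nth s l = v \<and> (\<forall>i\<le>l. seq_nth s i = piece G X c t i))"
        using False unfolding val_def bnbhd_seq_code[symmetric] by simp
      also have "\<dots> \<longleftrightarrow> piece G X c t l = v"
        using ex_seq_nth[of "Suc l" "piece G X c t"] unfolding less_Suc_eq_le by (metis order.refl)
      finally show ?thesis .
    qed
    have "Q x v (case_nat w (case_nat k (case_nat n \<gamma>))) \<longleftrightarrow> case_nat n \<beta> x = v" for x v k
    proof (cases x)
      case 0
      then show ?thesis by (auto simp: Q_def numeral_2_eq_2)
    next
      case (Suc y)
      show ?thesis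
      proof (cases "row_index y \<le> n")
        case True
        have "Q x v (case_nat w (case_nat k (case_nat n \<gamma>))) \<longleftrightarrow> val (seq_nth w (row_index y)) (col_index y) v (component \<gamma> (row_index y))"
          using True Suc by (auto simp: Q_def numeral_2_eq_2)
        then show ?thesis
          unfolding val[OF \<gamma>[OF True]] using True Suc by (simp add: \<beta>_def F_def)
      next
        case False
        with Suc show ?thesis by (auto simp: Q_def numeral_2_eq_2 \<beta>_def F_def)
      qed
    qed
    then have "R (case_nat w (case_nat k (case_nat n \<gamma>))) \<longleftrightarrow> bnbhd k (\<lambda>j. U j (case_nat n \<beta>))" for k
      using R(2)[of "case_nat w (case_nat k (case_nat n \<gamma>))" "case_nat n \<beta>"] by simp
    then have "kapp G (\<lambda>j. E j (case_nat n \<gamma>)) w = Some (\<lambda>j. U j (case_nat n \<beta>))"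
      unfolding kapp_eq_Some_iff E(2) by blast
    then show "\<exists>\<beta>. kapp G (\<lambda>j. E j (case_nat n \<gamma>)) w = Some (\<lambda>j. U j (case_nat n \<beta>)) \<and>
        (\<forall>i\<le>n. component \<beta> i = piece G X (component \<gamma> i) (seq_nth w i))"
      using \<beta> by (intro exI[of _ \<beta>]) (simp add: F_def)
  qed
qed

lemma recursive_map_two_omega_baire:
  fixes u :: "nat \<Rightarrow> nat \<Rightarrow> (nat \<Rightarrow> nat) \<Rightarrow> nat \<Rightarrow> nat"
  assumes u: "orec (\<lambda>\<alpha>. u (\<alpha> 1) (\<alpha> 2) (shift (shift (shift \<alpha>))) (\<alpha> 0))"
  shows "recursive_map (two \<otimes>\<^sub>r omega \<otimes>\<^sub>r baire) (baire :: 'a pt rspace)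
      (\<lambda>p. SeqP (u (the_num (pt_fst p)) (the_num (pt_fst (pt_snd p))) (the_seq (pt_snd (pt_snd p)))))"
proof -
  let ?V = "two \<otimes>\<^sub>r omega \<otimes>\<^sub>r baire :: 'a pt rspace"
  let ?W = "?V \<otimes>\<^sub>r omega :: 'a pt rspace"
  let ?f = "\<lambda>p :: 'a pt. SeqP (u (the_num (pt_fst p)) (the_num (pt_fst (pt_snd p))) (the_seq (pt_snd (pt_snd p)))) :: 'a pt"
  let ?pt = "\<lambda>a n \<gamma>. PairP (NumP a) (PairP (NumP n) (SeqP \<gamma>)) :: 'a pt"
  let ?\<phi> = "\<lambda>x \<gamma>. PairP (?pt (seq_nth x 0) (seq_nth x 1) \<gamma>) (NumP (seq_nth x 2))"
  \<comment> \<open>Again a cylinder of radius 1 / m, with the centre coded along the nesting of the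
    product; \<open>x\<close> codes (a, n, k).\<close>
  let ?c = "\<lambda>x s m. seq_code [seq_code [seq_code [seq_nth x 0, seq_code [seq_nth x 1, s]], seq_nth x 2], 1, m - 1]"
  have in_W: "p \<in> nbhd ?W s \<longleftrightarrow> in_ball ?W (seq_nth s 0) (seq_nth s 1) (seq_nth s 2) p" for p s
    by (rule in_nbhd_iff) (intro Metric_space_simps presentation_simps)+
  have pts_two: "pts (two :: 'a pt rspace) = NumP ` {0, 1}"
    by (simp add: two_def)
  have pts_V: "p \<in> pts ?V \<longleftrightarrow> (\<exists>a n \<gamma>. a \<le> 1 \<and> p = ?pt a n \<gamma>)" for p
  proof -
    have "a \<le> 1 \<longleftrightarrow> a = 0 \<or> a = 1" for a :: nat by auto
    then show ?thesis
      unfolding rprod_simps pts_two pts_omega pts_baire by auto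
  qed
  have pts_W: "p \<in> pts ?W \<longleftrightarrow> (\<exists>a n \<gamma> k. a \<le> 1 \<and> p = PairP (?pt a n \<gamma>) (NumP k))" for p
    using pts_V unfolding rprod_simps(1)[of ?V omega] pts_omega by blast
  have "Sigma01 ?W {?\<phi> x \<gamma> |x \<gamma>. seq_nth x 0 \<le> 1 \<and> bnbhd (seq_nth x 2) (\<lambda>j. u (seq_nth x 0) (seq_nth x 1) \<gamma> j)}"
  \<comment> \<open>The presentation of \<open>two\<close> truncates at 1, so the centre belongs to
    the point intended only for a \<le> 1.\<close>
  proof (rule Sigma01I[where ok = "\<lambda>x. seq_nth x 0 \<le> 1" and c = ?c])
    have "orec (\<lambda>\<alpha>. u (seq_nth (\<alpha> 1) 0) (seq_nth (\<alpha> 1) 1) (shift (shift \<alpha>)) (\<alpha> 0))"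
    proof -
      have "orec (\<lambda>\<alpha>. (\<lambda>\<beta>. u (\<beta> 1) (\<beta> 2) (shift (shift (shift \<beta>))) (\<beta> 0)) (\<lambda>i. case_nat (\<alpha> 0)
        (\<lambda>i. case_nat (seq_nth (\<alpha> 1) 0) (\<lambda>i. case_nat (seq_nth (\<alpha> 1) 1) (\<lambda>i. shift (shift \<alpha>) i) i) i) i))"
        by (rule orec_subst[OF u]) (intro orec_intro)
      then show ?thesis
        by (simp only: One_nat_def numeral_2_eq_2 nat.case shift_case_nat)
    qed
    then show "semi (\<lambda>\<alpha>. bnbhd (seq_nth (\<alpha> 0) 2) (\<lambda>j. u (seq_nth (\<alpha> 0) 0) (seq_nth (\<alpha> 0) 1) (shift \<alpha>) j))"
      by (intro semi_odec odec_bnbhd orec_intro) (simp add: shift_apply)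
    show "nbhd ?W (?c x s m) = {?\<phi> x \<gamma> |\<gamma>. \<forall>i<m. \<gamma> i = seq_nth s i}" if "seq_nth x 0 \<le> 1" "0 < m" for x s m
    proof (rule set_eqI)
      fix p :: "'a pt"
      show "p \<in> nbhd ?W (?c x s m) \<longleftrightarrow> p \<in> {?\<phi> x \<gamma> |\<gamma>. \<forall>i<m. \<gamma> i = seq_nth s i}"
      proof (cases "p \<in> pts ?W")
        case True
        then obtain a n \<gamma> k where p: "p = PairP (?pt a n \<gamma>) (NumP k)" "a \<le> 1"
          unfolding pts_W by blast
        show ?thesis
          unfolding p in_W using that p(2) by (auto simp: min_absorb1)
      next
        case False
        then have "p \<notin> nbhd ?W (?c x s m)"
          by (simp add: in_W in_ball_def)
        with False that(1) show ?thesis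
          unfolding pts_W by blast
      qed
    qed
    show "nbhd ?W 0 = {}"
      by (intro Metric_space_nbhd_0 Metric_space_simps)
  qed (intro orec_intro)+
  moreover have "{?\<phi> x \<gamma> |x \<gamma>. seq_nth x 0 \<le> 1 \<and> bnbhd (seq_nth x 2) (\<lambda>j. u (seq_nth x 0) (seq_nth x 1) \<gamma> j)}
    = {PairP x (NumP k) |x k. x \<in> pts ?V \<and> ?f x \<in> nbhd baire k}"
  proof (intro equalityI subsetI)
    fix p assume "p \<in> {?\<phi> x \<gamma> |x \<gamma>. seq_nth x 0 \<le> 1 \<and> bnbhd (seq_nth x 2) (\<lambda>j. u (seq_nth x 0) (seq_nth x 1) \<gamma> j)}"
    then obtain x \<gamma> where x: "p = ?\<phi> x \<gamma>" "seq_nth x 0 \<le> 1" "bnbhd (seq_nth x 2) (u (seq_nth x 0) (seq_nth x 1) \<gamma>)"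
      by auto
    have "?pt (seq_nth x 0) (seq_nth x 1) \<gamma> \<in> pts ?V"
      using x(2) unfolding pts_V by blast
    moreover have "?f (?pt (seq_nth x 0) (seq_nth x 1) \<gamma>) \<in> nbhd baire (seq_nth x 2)"
      using x(3) by (simp add: in_nbhd_baire)
    ultimately show "p \<in> {PairP x (NumP k) |x k. x \<in> pts ?V \<and> ?f x \<in> nbhd baire k}"
      using x(1) by blast
  next
    fix p assume "p \<in> {PairP x (NumP k) |x k. x \<in> pts ?V \<and> ?f x \<in> nbhd baire k}"
    then obtain q k where q: "p = PairP q (NumP k)" "q \<in> pts ?V" "?f q \<in> nbhd baire k"
      by blast
    obtain a n \<gamma> where a: "a \<le> 1" "q = ?pt a n \<gamma>"
      using q(2) unfolding pts_V by blast
    have "bnbhd k (u a n \<gamma>)"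
      using q(3) unfolding a in_nbhd_baire by simp
    then have "p = ?\<phi> (seq_code [a, n, k]) \<gamma> \<and> seq_nth (seq_code [a, n, k]) 0 \<le> 1 \<and>
        bnbhd (seq_nth (seq_code [a, n, k]) 2)
          (\<lambda>j. u (seq_nth (seq_code [a, n, k]) 0) (seq_nth (seq_code [a, n, k]) 1) \<gamma> j)"
      using a q(1) unfolding seq_nth_triple by simp
    then show "p \<in> {?\<phi> x \<gamma> |x \<gamma>. seq_nth x 0 \<le> 1 \<and> bnbhd (seq_nth x 2) (\<lambda>j. u (seq_nth x 0) (seq_nth x 1) \<gamma> j)}"
      by blast
  qed
  moreover have "?f ` pts ?V \<subseteq> pts baire"
    by (auto simp: pts_baire)
  ultimately show ?thesis
    unfolding recursive_map_def by simp
qed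

theorem lemma3p5:
  fixes G :: "'a pt rspace \<Rightarrow> 'a pt set"
    and X :: "'a pt rspace"
  assumes "good_parametrization G"
    and "rp_polish X"
  shows "\<exists>u :: nat \<Rightarrow> nat \<Rightarrow> (nat \<Rightarrow> nat) \<Rightarrow> (nat \<Rightarrow> nat).
    recursive_map (two \<otimes>\<^sub>r omega \<otimes>\<^sub>r baire) (baire :: 'a pt rspace)
      (\<lambda>p. SeqP (u (the_num (pt_fst p)) (the_num (pt_fst (pt_snd p))) (the_seq (pt_snd (pt_snd p))))) \<and>
    (\<forall>(\<xi> :: omega1) a n \<gamma>. 0 < \<xi> \<and> a \<in> {0, 1} \<and> (\<forall>i\<le>n. component \<gamma> i \<in> BC G 1 \<union> BC G \<xi>) \<longrightarrow>
       (u a n \<gamma> \<in> BC G 1 \<union> BC G \<xi> \<and>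
        rho G X (u 0 n \<gamma>) = (\<Inter>i\<le>n. rho G X (component \<gamma> i)) \<and>
        rho G X (u 1 n \<gamma>) = (\<Union>i\<le>n. rho G X (component \<gamma> i))) \<and>
       (1 < \<xi> \<and> (\<exists>i\<le>n. component \<gamma> i \<in> BC G \<xi>) \<longrightarrow> u a n \<gamma> \<in> BC G \<xi>))"
proof -
  note G = assms(1) and X = assms(2)
  obtain E1 where E1: "orec (\<lambda>\<alpha>. E1 (\<alpha> 0) (shift \<alpha>))"
    "\<And>\<xi> n \<gamma> w. 1 < \<xi> \<Longrightarrow> (\<And>i. i \<le> n \<Longrightarrow> component \<gamma> i \<in> BC G 1 \<union> BC G \<xi>) \<Longrightarrow>
      kapp G (\<lambda>j. E1 j (case_nat n \<gamma>)) w =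
        Some (piece G X (component \<gamma> (min (seq_nth w 0) n)) (seq_nth w 1))"
    by (rule ex_union_map[OF G X]) blast
  define U where "U = assemble (\<lambda>z. union_code (z 0) (shift z)) E1"
  have U: "orec (\<lambda>\<alpha>. U (\<alpha> 0) (shift \<alpha>))"
    unfolding U_def by (rule orec_assemble[OF orec_union_code E1(1)])
  obtain E0 where E0: "orec (\<lambda>\<alpha>. E0 (\<alpha> 0) (shift \<alpha>))"
    "\<And>\<xi> n \<gamma> w. 1 < \<xi> \<Longrightarrow> (\<And>i. i \<le> n \<Longrightarrow> component \<gamma> i \<in> BC G 1 \<union> BC G \<xi>) \<Longrightarrow>
      \<exists>\<beta>. kapp G (\<lambda>j. E0 j (case_nat n \<gamma>)) w = Some (\<lambda>j. U j (case_nat n \<beta>)) \<and>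
        (\<forall>i\<le>n. component \<beta> i = piece G X (component \<gamma> i) (seq_nth w i))"
    by (rule ex_inter_map[OF G X U]) blast
  define V where "V = assemble (\<lambda>z. inter_code X (z 0) (shift z)) E0"
  have V: "orec (\<lambda>\<alpha>. V (\<alpha> 0) (shift \<alpha>))"
    unfolding V_def by (rule orec_assemble[OF orec_inter_code[OF X] E0(1)])
  \<comment> \<open>Every nonzero a is treated like 1, the only other point of
    \<open>two\<close>.\<close>
  define u where "u a n \<gamma> = (\<lambda>j. if a = 0 then V j (case_nat n \<gamma>) else U j (case_nat n \<gamma>))"
    for a n :: nat and \<gamma>
  have rec_u: "recursive_map (two \<otimes>\<^sub>r omega \<otimes>\<^sub>r baire) (baire :: 'a pt rspace)
      (\<lambda>p. SeqP (u (the_num (pt_fst p)) (the_num (pt_fst (pt_snd p))) (the_seq (pt_snd (pt_snd p)))))"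
  proof (rule recursive_map_two_omega_baire)
    have "orec (\<lambda>\<alpha>. V (\<alpha> 0) (\<lambda>x. shift (shift \<alpha>) x))" "orec (\<lambda>\<alpha>. U (\<alpha> 0) (\<lambda>x. shift (shift \<alpha>) x))"
      by (rule orec_apply1[OF U] orec_apply1[OF V]; intro orec_intro)+
    moreover have "case_nat (\<alpha> 2) (shift (shift (shift \<alpha>))) = shift (shift \<alpha>)" for \<alpha> :: "nat \<Rightarrow> nat"
      by (auto simp: fun_eq_iff shift_apply numeral_2_eq_2 split: nat.split)
    ultimately show "orec (\<lambda>\<alpha>. u (\<alpha> 1) (\<alpha> 2) (shift (shift (shift \<alpha>))) (\<alpha> 0))"
      unfolding u_def by (intro orec_intro) simp_all
  qed
  have all_open: "all_open (case_nat n \<gamma>) \<longleftrightarrow> (\<forall>i\<le>n. component \<gamma> i \<in> BC G 1)" for n \<gamma>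
    by (simp add: all_open_def BC_1)
  have open_assemble: "(\<lambda>j. assemble B E j (case_nat n \<gamma>)) \<in> BC G 1"
    "rho G X (\<lambda>j. assemble B E j (case_nat n \<gamma>)) = (\<Union>j. nbhd X (B (case_nat n \<gamma>) j))"
    if "all_open (case_nat n \<gamma>)" for B E n \<gamma>
    using that by (simp_all add: BC_1 rho_BC_1 assemble_def shift_apply)
  have open_component: "rho G X (component \<gamma> i) = (\<Union>j. nbhd X (shift (component \<gamma> i) j))"
    if "all_open (case_nat n \<gamma>)" "i \<le> n" for n \<gamma> i
    using that by (intro rho_BC_1) (simp add: all_open_def)
  \<comment> \<open>A component with nonzero head is outside \<open>BC G 1\<close>, hence in
    \<open>BC G \<xi>\<close>, so \<xi> differs from 1.\<close>
  have gt_1: "1 < \<xi>" if "0 < \<xi>" "\<forall>i\<le>n. component \<gamma> i \<in> BC G 1 \<union> BC G \<xi>" "\<not> all_open (case_nat n \<gamma>)" for \<xi> n \<gamma>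
    using one_le_omega1[OF that(1)] that(2,3) unfolding all_open by (auto simp: le_less)
  have union: "(\<lambda>j. U j (case_nat n \<gamma>)) \<in> BC G \<xi> \<and>
      rho G X (\<lambda>j. U j (case_nat n \<gamma>)) = (\<Union>i\<le>n. rho G X (component \<gamma> i))"
    if \<xi>: "1 < \<xi>" and \<gamma>: "\<And>i. i \<le> n \<Longrightarrow> component \<gamma> i \<in> BC G 1 \<union> BC G \<xi>" and no: "\<not> all_open (case_nat n \<gamma>)" for \<xi> n \<gamma>
  proof -
    let ?C = "\<lambda>j. U j (case_nat n \<gamma>)"
    let ?p = "\<lambda>w. piece G X (component \<gamma> (min (seq_nth w 0) n)) (seq_nth w 1)"
    have "?C 0 = 1"
      using no by (simp add: U_def assemble_def)
    moreover have "shift ?C = (\<lambda>j. E1 j (case_nat n \<gamma>))"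
      using no by (simp add: U_def assemble_def shift_def)
    then have "kapp G (shift ?C) w = Some (?p w)" for w
      using E1(2)[OF \<xi> \<gamma>] by simp
    moreover have "?p w \<in> (\<Union>\<eta>\<in>{1..<\<xi>}. BC G \<eta>)" for w
      by (rule piece_properties(1)[OF X \<xi> \<gamma>]) simp
    ultimately have C: "?C \<in> BC G \<xi>" "rho G X ?C = (\<Union>w. pts X - rho G X (?p w))"
      by (rule BC_gt_1_I[OF \<xi>])+
    \<comment> \<open>A double union is flattened: w codes (i, t), and \<open>min\<close> only
      repeats sets with i = n.\<close>
    have "(\<Union>w. pts X - rho G X (?p w)) = (\<Union>i\<le>n. \<Union>t. pts X - rho G X (piece G X (component \<gamma> i) t))"
    proof (intro equalityI subsetI)
      fix x assume "x \<in> (\<Union>w. pts X - rho G X (?p w))"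
      then obtain w where "x \<in> pts X - rho G X (?p w)" by blast
      then show "x \<in> (\<Union>i\<le>n. \<Union>t. pts X - rho G X (piece G X (component \<gamma> i) t))"
        by (intro UN_I[of "min (seq_nth w 0) n"] UN_I[of "seq_nth w 1"]) auto
    next
      fix x assume "x \<in> (\<Union>i\<le>n. \<Union>t. pts X - rho G X (piece G X (component \<gamma> i) t))"
      then obtain i t where "i \<le> n" "x \<in> pts X - rho G X (piece G X (component \<gamma> i) t)" by blast
      then show "x \<in> (\<Union>w. pts X - rho G X (?p w))"
        by (intro UN_I[of "seq_code [i, t]"]) (simp_all add: min_absorb1)
    qed
    also have "\<dots> = (\<Union>i\<le>n. rho G X (component \<gamma> i))"
      using piece_properties(2)[OF X \<xi> \<gamma>] by (intro SUP_cong) simp_all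
    finally show ?thesis
      using C by simp
  qed
  \<comment> \<open>Level 1 is included, because the intersection applies this to pieces whose
    maximal level may be 1.\<close>
  have union': "(\<lambda>j. U j (case_nat n \<gamma>)) \<in> BC G 1 \<union> BC G \<xi> \<and>
      rho G X (\<lambda>j. U j (case_nat n \<gamma>)) = (\<Union>i\<le>n. rho G X (component \<gamma> i))"
    if \<xi>: "0 < \<xi>" and \<gamma>: "\<forall>i\<le>n. component \<gamma> i \<in> BC G 1 \<union> BC G \<xi>" for \<xi> n \<gamma>
  proof (cases "all_open (case_nat n \<gamma>)")
    case True
    have "rho G X (\<lambda>j. U j (case_nat n \<gamma>)) = (\<Union>i\<le>n. rho G X (component \<gamma> i))"
      unfolding U_def open_assemble(2)[OF True] using Union_union_code[OF X, of n \<gamma>] open_component[OF True]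
      by simp
    then show ?thesis
      using open_assemble(1)[OF True] by (simp add: U_def)
  next
    case False
    then show ?thesis
      using union[OF gt_1[OF \<xi> \<gamma> False]] \<gamma> by blast
  qed
  have inter: "(\<lambda>j. V j (case_nat n \<gamma>)) \<in> BC G \<xi> \<and>
      rho G X (\<lambda>j. V j (case_nat n \<gamma>)) = (\<Inter>i\<le>n. rho G X (component \<gamma> i))"
    if \<xi>: "1 < \<xi>" and \<gamma>: "\<And>i. i \<le> n \<Longrightarrow> component \<gamma> i \<in> BC G 1 \<union> BC G \<xi>" and no: "\<not> all_open (case_nat n \<gamma>)" for \<xi> n \<gamma>
  proof -
    let ?C = "\<lambda>j. V j (case_nat n \<gamma>)"
    have "\<forall>w. \<exists>\<beta>. kapp G (\<lambda>j. E0 j (case_nat n \<gamma>)) w = Some (\<lambda>j. U j (case_nat n \<beta>)) \<and>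
        (\<forall>i\<le>n. component \<beta> i = piece G X (component \<gamma> i) (seq_nth w i))"
      using E0(2)[OF \<xi> \<gamma>] by blast
    then obtain \<beta> where \<beta>: "\<And>w. kapp G (\<lambda>j. E0 j (case_nat n \<gamma>)) w = Some (\<lambda>j. U j (case_nat n (\<beta> w)))"
      "\<And>w i. i \<le> n \<Longrightarrow> component (\<beta> w) i = piece G X (component \<gamma> i) (seq_nth w i)"
      by metis
    let ?p = "\<lambda>w j. U j (case_nat n (\<beta> w))"
    \<comment> \<open>For fixed w the pieces have levels \<open>\<eta> i\<close> below \<xi> that
      vary with i. Their maximum m over i \<le> n is still below \<xi>, and \<open>BC_mono\<close>
      puts all of them into \<open>BC G 1 \<union> BC G m\<close>. So the code of their union has
      level 1 or m, and the intersection stays at level \<xi>.\<close>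
    have p: "?p w \<in> (\<Union>\<eta>\<in>{1..<\<xi>}. BC G \<eta>) \<and> rho G X (?p w) = (\<Union>i\<le>n. rho G X (component (\<beta> w) i))" for w
    proof -
      have "\<forall>i. \<exists>\<eta>. i \<le> n \<longrightarrow> \<eta> \<in> {1..<\<xi>} \<and> component (\<beta> w) i \<in> BC G \<eta>"
        using piece_properties(1)[OF X \<xi> \<gamma>] \<beta>(2) by fastforce
      then obtain \<eta> where \<eta>: "\<And>i. i \<le> n \<Longrightarrow> \<eta> i \<in> {1..<\<xi>} \<and> component (\<beta> w) i \<in> BC G (\<eta> i)"
        by metis
      define m where "m = Max (\<eta> ` {..n})"
      have "m \<in> \<eta> ` {..n}"
        unfolding m_def by (intro Max_in) auto
      then have m: "m \<in> {1..<\<xi>}"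
        using \<eta> by auto
      have "0 < m"
      proof -
        have "(0::omega1) < 1"
          \<comment> \<open>\<open>1\<close> is a least element above \<open>0\<close>, so some
            ordinal above \<open>0\<close> must be exhibited; \<xi> is one.\<close>
          unfolding one_omega1_def by (rule LeastI[of _ \<xi>]) (metis \<xi> not_less zero_omega1_def Least_le le_less_trans order.strict_trans1)
        then show ?thesis using m by auto
      qed
      moreover have "\<forall>i\<le>n. component (\<beta> w) i \<in> BC G 1 \<union> BC G m"
      proof (intro allI impI)
        fix i assume i: "i \<le> n"
        then have "\<eta> i \<le> m"
          unfolding m_def by (intro Max_ge) auto
        then show "component (\<beta> w) i \<in> BC G 1 \<union> BC G m"
          using \<eta>[OF i] BC_mono[of "\<eta> i" m G] by (cases "\<eta> i = 1") (auto simp: less_le)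
      qed
      ultimately have "?p w \<in> BC G 1 \<union> BC G m \<and> rho G X (?p w) = (\<Union>i\<le>n. rho G X (component (\<beta> w) i))"
        by (rule union')
      moreover have "1 \<in> {1..<\<xi>}"
        using \<xi> by simp
      ultimately show ?thesis
        using m by blast
    qed
    have "?C 0 = 1"
      using no by (simp add: V_def assemble_def)
    moreover have "shift ?C = (\<lambda>j. E0 j (case_nat n \<gamma>))"
      using no by (simp add: V_def assemble_def shift_def)
    then have "kapp G (shift ?C) w = Some (?p w)" for w
      using \<beta>(1) by simp
    moreover have "?p w \<in> (\<Union>\<eta>\<in>{1..<\<xi>}. BC G \<eta>)" for w
      using p by blast
    ultimately have C: "?C \<in> BC G \<xi>" "rho G X ?C = (\<Union>w. pts X - rho G X (?p w))"
      by (rule BC_gt_1_I[OF \<xi>])+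
    have "(\<Union>w. pts X - rho G X (?p w)) =
      (\<Union>w. pts X - (\<Union>i\<le>n. rho G X (piece G X (component \<gamma> i) (seq_nth w i))))"
      using p \<beta>(2) by simp
    \<comment> \<open>Distributivity: w codes a choice of t for each i \<le> n, and each such finite
      choice has a code.\<close>
    also have "\<dots> = (\<Inter>i\<le>n. \<Union>t. pts X - rho G X (piece G X (component \<gamma> i) t))"
    proof (intro equalityI subsetI)
      fix x assume "x \<in> (\<Inter>i\<le>n. \<Union>t. pts X - rho G X (piece G X (component \<gamma> i) t))"
      then have "\<forall>i. \<exists>t. i \<le> n \<longrightarrow> x \<in> pts X - rho G X (piece G X (component \<gamma> i) t)"
        by auto
      then obtain f where f: "\<And>i. i \<le> n \<Longrightarrow> x \<in> pts X - rho G X (piece G X (component \<gamma> i) (f i))"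
        by metis
      obtain w where "\<forall>i<Suc n. seq_nth w i = f i"
        using ex_seq_nth[of "Suc n" f] by blast
      with f have "x \<in> pts X - (\<Union>i\<le>n. rho G X (piece G X (component \<gamma> i) (seq_nth w i)))"
        by (auto simp: less_Suc_eq_le)
      then show "x \<in> (\<Union>w. pts X - (\<Union>i\<le>n. rho G X (piece G X (component \<gamma> i) (seq_nth w i))))"
        by blast
    qed auto
    also have "\<dots> = (\<Inter>i\<le>n. rho G X (component \<gamma> i))"
      using piece_properties(2)[OF X \<xi> \<gamma>] by (intro INF_cong) simp_all
    finally show ?thesis
      using C by simp
  qed
  have inter': "(\<lambda>j. V j (case_nat n \<gamma>)) \<in> BC G 1 \<union> BC G \<xi> \<and>
      rho G X (\<lambda>j. V j (case_nat n \<gamma>)) = (\<Inter>i\<le>n. rho G X (component \<gamma> i))"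
    if \<xi>: "0 < \<xi>" and \<gamma>: "\<forall>i\<le>n. component \<gamma> i \<in> BC G 1 \<union> BC G \<xi>" for \<xi> n \<gamma>
  proof (cases "all_open (case_nat n \<gamma>)")
    case True
    have "rho G X (\<lambda>j. V j (case_nat n \<gamma>)) = (\<Inter>i\<le>n. rho G X (component \<gamma> i))"
      unfolding V_def open_assemble(2)[OF True] using Union_inter_code[OF X, of n \<gamma>] open_component[OF True]
      by simp
    then show ?thesis
      using open_assemble(1)[OF True] by (simp add: V_def)
  next
    case False
    then show ?thesis
      using inter[OF gt_1[OF \<xi> \<gamma> False]] \<gamma> by blast
  qed
  have u: "u 0 n \<gamma> = (\<lambda>j. V j (case_nat n \<gamma>))" "u 1 n \<gamma> = (\<lambda>j. U j (case_nat n \<gamma>))" for n \<gamma>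
    by (simp_all add: u_def)
  have mem: "u a n \<gamma> \<in> BC G 1 \<union> BC G \<xi>" if "0 < \<xi>" "a \<in> {0, 1}" "\<forall>i\<le>n. component \<gamma> i \<in> BC G 1 \<union> BC G \<xi>" for \<xi> a n \<gamma>
    using that union'[OF that(1,3)] inter'[OF that(1,3)] u by auto
  have mem_gt_1: "u a n \<gamma> \<in> BC G \<xi>"
    if "1 < \<xi>" "a \<in> {0, 1}" "\<forall>i\<le>n. component \<gamma> i \<in> BC G 1 \<union> BC G \<xi>" "\<exists>i\<le>n. component \<gamma> i \<in> BC G \<xi>" for \<xi> a n \<gamma>
  proof -
    \<comment> \<open>Codes of level \<xi> > 1 have head 1, so a single such component rules out the
      open case.\<close>
    have "\<not> all_open (case_nat n \<gamma>)"
      using that(4) unfolding all_open BC_1 BC_gt_1[OF that(1)] by auto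
    with that union[of \<xi> n \<gamma>] inter[of \<xi> n \<gamma>] u show ?thesis by auto
  qed
  show ?thesis
  proof (intro exI[of _ u] conjI allI impI)
    fix \<xi> :: omega1 and a n :: nat and \<gamma> :: "nat \<Rightarrow> nat"
    assume *: "0 < \<xi> \<and> a \<in> {0, 1} \<and> (\<forall>i\<le>n. component \<gamma> i \<in> BC G 1 \<union> BC G \<xi>)"
    show "u a n \<gamma> \<in> BC G 1 \<union> BC G \<xi>"
      using * by (intro mem) blast+
    show "rho G X (u 0 n \<gamma>) = (\<Inter>i\<le>n. rho G X (component \<gamma> i))"
      "rho G X (u 1 n \<gamma>) = (\<Union>i\<le>n. rho G X (component \<gamma> i))"
      unfolding u using * inter'[of \<xi> n \<gamma>] union'[of \<xi> n \<gamma>] by blast+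
    assume "1 < \<xi> \<and> (\<exists>i\<le>n. component \<gamma> i \<in> BC G \<xi>)"
    with * show "u a n \<gamma> \<in> BC G \<xi>"
      by (intro mem_gt_1) blast+
  qed (rule rec_u)
qed

end
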